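(* Let $L$ be a nondegenerate even lattice and let $\epsilon$ be the normalized $2$-cocycle of $L$ used in the construction of the vertex algebra $V_L$ (so $\epsilon(\alpha,\beta)\epsilon(\beta,\alpha)^{-1}=(-1)^{\langle\alpha,\beta\rangle}$ for $\alpha,\beta\in L$). Set $$U=\coprod_{\alpha\in L}\mathbb{C}(e_\alpha\otimes e^{\alpha})\otimes\Delta(B_{\mathbf{h}})\subset B_{L,\epsilon}\,\sharp\,B_L.$$ Then $U$ is an ordinary vertex subalgebra of $B_{L,\epsilon}\,\sharp\,B_L$ and the linear map $$\pi:V_L\to U,\qquad e_\alpha\otimes u\mapsto(e_\alpha\otimes e^{\alpha})\otimes\Delta(u)\qquad(\alpha\in L,\ u\in S(\hat{\mathbf{h}}^{-}))$$ is an isomorphism of vertex algebras.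
   Context: All vector spaces are over $\mathbb{C}$; $(x_1\pm x_2)^n$ is expanded in nonnegative powers of the second variable. A nonlocal vertex algebra is a vector space $V$ with a linear map $Y(\cdot,x):V\to\mathrm{Hom}(V,V((x)))$ and a vacuum $\mathbf{1}$ such that $Y(\mathbf{1},x)=1$; $Y(v,x)\mathbf{1}\in V[[x]]$ with constant term $v$; and for all $u,v,w\in V$ there is $l\ge0$ with $(x_0+x_2)^lY(u,x_0+x_2)Y(v,x_2)w=(x_0+x_2)^lY(Y(u,x_0)v,x_2)w$. It is an ordinary vertex algebra if for all $u,v$ there is $k\ge0$ with $(x_1-x_2)^k[Y(u,x_1),Y(v,x_2)]=0$. For a unital associative algebra $A$ with derivation $\partial$, $(A,\partial)$ is the nonlocal vertex algebra with vacuum $1$ and $Y(a,x)b=(e^{x\partial}a)b$. Modules $(W,Y_W)$ satisfy $Y_W(\mathbf 1,x)=1_W$ and the analogous weak associativity. Lattice data: $L$ is a free abelian group of finite rank with a nondegenerate symmetric $\mathbb{Z}$-bilinear form $\langle\cdot,\cdot\rangle:L\times L\to\mathbb{Z}$ with $\langle\alpha,\alpha\rangle\in2\mathbb{Z}$; $\mathbf{h}=\mathbb{C}\otimes_{\mathbb{Z}}L$ with the extended form. A normalized $2$-cocycle is a map $\epsilon:L\times L\to\mathbb{C}^{\times}$ with $\epsilon(\alpha,0)=\epsilon(0,\alpha)=1$ and $\epsilon(\alpha,\beta+\gamma)\epsilon(\beta,\gamma)=\epsilon(\alpha+\beta,\gamma)\epsilon(\alpha,\beta)$. $\hat{\mathbf{h}}^{-}=\mathbf{h}\otimes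 t^{-1}\mathbb{C}[t^{-1}]$, $h(n)=h\otimes t^n$; $B_{\mathbf{h}}=S(\hat{\mathbf{h}}^{-})$, a bialgebra with elements of $\hat{\mathbf{h}}^-$ primitive and comultiplication $\Delta$, with derivation $L(-1)h(-n)=nh(-n-1)$, $n\ge1$. On $B_{\mathbf{h}}$, for $h\in\mathbf{h}$: $h(n)$, $n<0$, acts by multiplication; for $n\ge1$, $h(n)$ is the derivation with $h(n)\beta(-m)=n\langle h,\beta\rangle\delta_{n,m}$. $\mathbb{C}_{\epsilon}[L]$ has basis $\{e_\alpha\}$ and product $e_\alpha e_\beta=\epsilon(\alpha,\beta)e_{\alpha+\beta}$. $B_{L,\epsilon}=\mathbb{C}_{\epsilon}[L]\otimes B_{\mathbf{h}}$ with derivation $L(-1)(e_\alpha\otimes u)=e_\alpha\otimes\alpha(-1)u+e_\alpha\otimes L(-1)u$, regarded as the nonlocal vertex algebra $(B_{L,\epsilon},L(-1))$. $B_L=\mathbb{C}[L]\otimes B_{\mathbf{h}}$ is the case of trivial $\epsilon$, with group algebra basis written $e^{\alpha}$; it is a bialgebra ($e^\alpha$ group-like, $\hat{\mathbf{h}}^-$ primitive) and with $L(-1)$ a vertex bialgebra $(B_L,L(-1))$, i.e. $\Delta,\varepsilon$ are homomorphisms of nonlocal vertex algebras. Operators on $\mathbb{C}_\epsilon[L]\otimes B_{\mathbf{h}}$: $h(n)(e_\alpha\otimes u)=e_\alpha\otimes h(n)u$ for $n\neq0$, $h(0)(e_\alpha\otimes u)=\langle h,\alpha\rangle e_\alpha\otimes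 u$; $E^{\pm}(\alpha,x)=\exp\left(\sum_{n\in\pm\mathbb{Z}_{+}}\frac{\alpha(n)}{n}x^{-n}\right)$, where $\mathbb{Z}_+$ is the set of positive integers; $x^{\alpha(0)}(e_\beta\otimes u)=x^{\langle\alpha,\beta\rangle}e_\beta\otimes u$; and $e_\alpha$ acts by left multiplication. $B_{L,\epsilon}$ carries the unique $B_L$-module structure $Y_M$ (module for $B_L$ as a nonlocal vertex algebra) with $Y_M(e^{\alpha},x)=E^{+}(-\alpha,x)x^{\alpha(0)}$ for $\alpha\in L$; it makes $B_{L,\epsilon}$ a $B_L$-module nonlocal vertex algebra (i.e. for $h\in B_L$, $u,v\in B_{L,\epsilon}$: $Y_M(h,x)v\in B_{L,\epsilon}\otimes\mathbb{C}((x))$, $Y_M(h,x)\mathbf1=\varepsilon(h)\mathbf1$, $Y_M(h,x_1)Y(u,x_2)v=\sum Y(Y_M(h_{(1)},x_1-x_2)u,x_2)Y_M(h_{(2)},x_1)v$). The smash product $B_{L,\epsilon}\,\sharp\,B_L$ is the nonlocal vertex algebra on $B_{L,\epsilon}\otimes B_L$ with vacuum $\mathbf{1}\otimes\mathbf{1}$ and $Y^{\sharp}(u\otimes h,x)(v\otimes k)=\sum Y(u,x)Y_M(h_{(1)},x)v\otimes Y(h_{(2)},x)k$, where $\Delta(h)=\sum h_{(1)}\otimes h_{(2)}$. In the definition of $U$ and $\pi$ one identifies $B_{L,\epsilon}\otimes B_L$ with $\mathbb{C}_{\epsilon}[L]\otimes\mathbb{C}[L]\otimes B_{\mathbf{h}}\otimes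 B_{\mathbf{h}}$, so $(e_\alpha\otimes e^\alpha)\otimes\Delta(u)$ means $\sum(e_\alpha\otimes u_{(1)})\otimes(e^{\alpha}\otimes u_{(2)})$. $V_L$ is the vertex algebra associated with $L$ (Frenkel–Lepowsky–Meurman): as a vector space $V_L=\mathbb{C}_{\epsilon}[L]\otimes S(\hat{\mathbf{h}}^{-})$, with $\epsilon$ a normalized $2$-cocycle satisfying $\epsilon(\alpha,\beta)\epsilon(\beta,\alpha)^{-1}=(-1)^{\langle\alpha,\beta\rangle}$, vacuum $e_0\otimes1$, generated as a vertex algebra by the $e_\alpha$ ($\alpha\in L$), with $Y_{V_L}(e_\alpha,x)=E^{-}(-\alpha,x)E^{+}(-\alpha,x)e_\alpha x^{\alpha(0)}$. *)

theory Defs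
  imports
    Complex_Main
    "HOL-Library.Poly_Mapping"
    "HOL-Library.Product_Plus"
    "HOL-Library.Multiset"
begin

section \<open>Nonlocal vertex algebras\<close>

text \<open>
  A vertex operator map is given by its coefficients: \<^term>\<open>Y u v n\<close> is the coefficient of
  \<open>x^n\<close> (not of \<open>x^(-n-1)\<close>) in \<open>Y(u,x)v\<close>. Likewise a series in two variables is a function of
  the two exponents.
\<close>

text \<open>
  For \<open>F(x1,x2) = (\<Sum>a b. F a b x1^a x2^b)\<close>, the series \<open>F(x0+x2,x2)\<close>, with powers of
  \<open>x0+x2\<close> expanded in nonnegative powers of \<open>x2\<close>. The sum is finite for the
  series to which it is applied, since they are bounded below in \<open>x2\<close>.
\<close>
definition subst_add ::
  "(complex \<Rightarrow> 'v \<Rightarrow> 'v) \<Rightarrow> (int \<Rightarrow> int \<Rightarrow> 'v::ab_group_add) \<Rightarrow> int \<Rightarrow> int \<Rightarrow> 'v" where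
  "subst_add scale F a b =
     Sum_any (\<lambda>j::nat. scale (of_int (a + int j) gchoose j) (F (a + int j) (b - int j)))"

text \<open>Multiplication by \<open>(y + c z)^l\<close>, where the exponents of \<open>y\<close> and \<open>z\<close> are the arguments.\<close>
definition mult_binomial ::
  "(complex \<Rightarrow> 'v \<Rightarrow> 'v) \<Rightarrow> complex \<Rightarrow> nat \<Rightarrow> (int \<Rightarrow> int \<Rightarrow> 'v::ab_group_add)
     \<Rightarrow> int \<Rightarrow> int \<Rightarrow> 'v" where
  "mult_binomial scale c l F a b =
     (\<Sum>i\<le>l. scale (of_nat (l choose i) * c ^ i) (F (a - int (l - i)) (b - int i)))"

text \<open>
  \<open>V\<close> is a subspace of the ambient type, so that subalgebras can be treated as algebras
  in their own right.
\<close>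
locale nonlocal_vertex_algebra = vector_space scale
  for scale :: "complex \<Rightarrow> 'v::ab_group_add \<Rightarrow> 'v" +
  fixes V :: "'v set" and Y :: "'v \<Rightarrow> 'v \<Rightarrow> int \<Rightarrow> 'v" and vac :: 'v
  assumes subspace_V: "subspace V"
    and vac_in: "vac \<in> V"
    and Y_in: "\<lbrakk>u \<in> V; v \<in> V\<rbrakk> \<Longrightarrow> Y u v n \<in> V"
    and Y_truncated: "\<lbrakk>u \<in> V; v \<in> V\<rbrakk> \<Longrightarrow> \<exists>N. \<forall>n<N. Y u v n = 0"
    and Y_add_left: "\<lbrakk>u \<in> V; u' \<in> V; v \<in> V\<rbrakk> \<Longrightarrow> Y (u + u') v n = Y u v n + Y u' v n"
    and Y_scale_left: "\<lbrakk>u \<in> V; v \<in> V\<rbrakk> \<Longrightarrow> Y (scale c u) v n = scale c (Y u v n)"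
    and Y_add_right: "\<lbrakk>u \<in> V; v \<in> V; v' \<in> V\<rbrakk> \<Longrightarrow> Y u (v + v') n = Y u v n + Y u v' n"
    and Y_scale_right: "\<lbrakk>u \<in> V; v \<in> V\<rbrakk> \<Longrightarrow> Y u (scale c v) n = scale c (Y u v n)"
    and Y_vac: "v \<in> V \<Longrightarrow> Y vac v n = (if n = 0 then v else 0)"
    and Y_creation: "\<lbrakk>v \<in> V; n < 0\<rbrakk> \<Longrightarrow> Y v vac n = 0"
    and Y_creation_0: "v \<in> V \<Longrightarrow> Y v vac 0 = v"
    and weak_assoc: "\<lbrakk>u \<in> V; v \<in> V; w \<in> V\<rbrakk> \<Longrightarrow>
      \<exists>l::nat. mult_binomial scale 1 l (subst_add scale (\<lambda>a b. Y u (Y v w b) a))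
             = mult_binomial scale 1 l (\<lambda>a b. Y (Y u v a) w b)"

locale vertex_algebra = nonlocal_vertex_algebra +
  assumes locality: "\<lbrakk>u \<in> V; v \<in> V\<rbrakk> \<Longrightarrow>
      \<exists>k::nat. \<forall>w\<in>V. \<forall>a b.
        mult_binomial scale (-1) k (\<lambda>a b. Y u (Y v w b) a - Y v (Y u w a) b) a b = 0"

locale nonlocal_vertex_algebra_module =
  nonlocal_vertex_algebra scale V Y vac + W: vector_space scaleW
  for scale :: "complex \<Rightarrow> 'v::ab_group_add \<Rightarrow> 'v" and V Y vac
    and scaleW :: "complex \<Rightarrow> 'w::ab_group_add \<Rightarrow> 'w" +
  fixes W :: "'w set" and YW :: "'v \<Rightarrow> 'w \<Rightarrow> int \<Rightarrow> 'w"
  assumes subspace_W: "W.subspace W"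
    and YW_in: "\<lbrakk>u \<in> V; w \<in> W\<rbrakk> \<Longrightarrow> YW u w n \<in> W"
    and YW_truncated: "\<lbrakk>u \<in> V; w \<in> W\<rbrakk> \<Longrightarrow> \<exists>N. \<forall>n<N. YW u w n = 0"
    and YW_add_left: "\<lbrakk>u \<in> V; u' \<in> V; w \<in> W\<rbrakk> \<Longrightarrow> YW (u + u') w n = YW u w n + YW u' w n"
    and YW_scale_left: "\<lbrakk>u \<in> V; w \<in> W\<rbrakk> \<Longrightarrow> YW (scale c u) w n = scaleW c (YW u w n)"
    and YW_add_right: "\<lbrakk>u \<in> V; w \<in> W; w' \<in> W\<rbrakk> \<Longrightarrow> YW u (w + w') n = YW u w n + YW u w' n"
    and YW_scale_right: "\<lbrakk>u \<in> V; w \<in> W\<rbrakk> \<Longrightarrow> YW u (scaleW c w) n = scaleW c (YW u w n)"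
    and YW_vac: "w \<in> W \<Longrightarrow> YW vac w n = (if n = 0 then w else 0)"
    and YW_weak_assoc: "\<lbrakk>u \<in> V; v \<in> V; w \<in> W\<rbrakk> \<Longrightarrow>
      \<exists>l::nat. mult_binomial scaleW 1 l (subst_add scaleW (\<lambda>a b. YW u (YW v w b) a))
             = mult_binomial scaleW 1 l (\<lambda>a b. YW (Y u v a) w b)"

definition vertex_subalgebra ::
  "(complex \<Rightarrow> 'v \<Rightarrow> 'v) \<Rightarrow> 'v::ab_group_add set \<Rightarrow> ('v \<Rightarrow> 'v \<Rightarrow> int \<Rightarrow> 'v) \<Rightarrow> 'v \<Rightarrow> 'v set \<Rightarrow> bool"
  where
  "vertex_subalgebra scale V Y vac U \<longleftrightarrow>
     module.subspace scale U \<and> U \<subseteq> V \<and> vac \<in> U \<and> (\<forall>u\<in>U. \<forall>v\<in>U. \<forall>n. Y u v n \<in> U)"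

definition vertex_algebra_generated_by ::
  "(complex \<Rightarrow> 'v \<Rightarrow> 'v) \<Rightarrow> 'v::ab_group_add set \<Rightarrow> ('v \<Rightarrow> 'v \<Rightarrow> int \<Rightarrow> 'v) \<Rightarrow> 'v \<Rightarrow> 'v set \<Rightarrow> bool"
  where
  "vertex_algebra_generated_by scale V Y vac S \<longleftrightarrow>
     S \<subseteq> V \<and> (\<forall>U. vertex_subalgebra scale V Y vac U \<and> S \<subseteq> U \<longrightarrow> U = V)"

definition vertex_algebra_iso ::
  "(complex \<Rightarrow> 'v \<Rightarrow> 'v) \<Rightarrow> 'v::ab_group_add set \<Rightarrow> ('v \<Rightarrow> 'v \<Rightarrow> int \<Rightarrow> 'v) \<Rightarrow> 'v
   \<Rightarrow> (complex \<Rightarrow> 'w \<Rightarrow> 'w) \<Rightarrow> 'w::ab_group_add set \<Rightarrow> ('w \<Rightarrow> 'w \<Rightarrow> int \<Rightarrow> 'w) \<Rightarrow> 'w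
   \<Rightarrow> ('v \<Rightarrow> 'w) \<Rightarrow> bool" where
  "vertex_algebra_iso scaleV V YV vacV scaleW W YW vacW f \<longleftrightarrow>
     vertex_algebra scaleV V YV vacV \<and> vertex_algebra scaleW W YW vacW \<and>
     bij_betw f V W \<and>
     (\<forall>u\<in>V. \<forall>v\<in>V. f (u + v) = f u + f v) \<and>
     (\<forall>c. \<forall>u\<in>V. f (scaleV c u) = scaleW c (f u)) \<and>
     f vacV = vacW \<and>
     (\<forall>u\<in>V. \<forall>v\<in>V. \<forall>n. f (YV u v n) = YW (f u) (f v) n)"

text \<open>The map \<open>Y(a,x)b = (e^(x D) a) b\<close> of an algebra with derivation \<open>D\<close>.\<close>
definition differential_algebra_Y ::
  "(complex \<Rightarrow> 'v \<Rightarrow> 'v) \<Rightarrow> ('v \<Rightarrow> 'v \<Rightarrow> 'v) \<Rightarrow> ('v \<Rightarrow> 'v) \<Rightarrow> 'v::ab_group_add \<Rightarrow> 'v \<Rightarrow> int \<Rightarrow> 'v" where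
  "differential_algebra_Y scale mul D a b n =
     (if n < 0 then 0 else scale (1 / fact (nat n)) (mul ((D ^^ nat n) a) b))"


section \<open>Vector spaces with a basis and their tensor products\<close>

text \<open>
  The space with basis \<open>X\<close> is \<open>X \<Rightarrow>\<^sub>0 complex\<close>; the tensor product of the spaces with
  bases \<open>X\<close> and \<open>Y\<close> is the space with basis \<open>X \<times> Y\<close>. If \<open>X\<close> is an additive
  monoid, the multiplication of \<^typ>\<open>'x \<Rightarrow>\<^sub>0 complex\<close> is that of its monoid algebra.
\<close>

definition cscale :: "complex \<Rightarrow> ('x \<Rightarrow>\<^sub>0 complex) \<Rightarrow> ('x \<Rightarrow>\<^sub>0 complex)" where
  "cscale c p = Poly_Mapping.map ((*) c) p"

lemma lookup_cscale [simp]: "Poly_Mapping.lookup (cscale c p) x = c * Poly_Mapping.lookup p x"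
  by (simp add: cscale_def Poly_Mapping.map.rep_eq when_def)

global_interpretation cvec: vector_space cscale
  by unfold_locales (auto intro!: poly_mapping_eqI simp: lookup_add algebra_simps)

abbreviation basis_vec :: "'x \<Rightarrow> ('x \<Rightarrow>\<^sub>0 complex)" where
  "basis_vec x \<equiv> Poly_Mapping.single x 1"

definition lin_ext :: "('x \<Rightarrow> ('y \<Rightarrow>\<^sub>0 complex)) \<Rightarrow> ('x \<Rightarrow>\<^sub>0 complex) \<Rightarrow> ('y \<Rightarrow>\<^sub>0 complex)" where
  "lin_ext f p = (\<Sum>x\<in>Poly_Mapping.keys p. cscale (Poly_Mapping.lookup p x) (f x))"

definition tensor ::
  "('x \<Rightarrow>\<^sub>0 complex) \<Rightarrow> ('y \<Rightarrow>\<^sub>0 complex) \<Rightarrow> ('x \<times> 'y \<Rightarrow>\<^sub>0 complex)" (infixr \<open>\<otimes>\<close> 75) where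
  "p \<otimes> q = (\<Sum>x\<in>Poly_Mapping.keys p. \<Sum>y\<in>Poly_Mapping.keys q. Poly_Mapping.single (x, y) (Poly_Mapping.lookup p x * Poly_Mapping.lookup q y))"

definition tensor_op ::
  "(('x \<Rightarrow>\<^sub>0 complex) \<Rightarrow> ('x' \<Rightarrow>\<^sub>0 complex)) \<Rightarrow> (('y \<Rightarrow>\<^sub>0 complex) \<Rightarrow> ('y' \<Rightarrow>\<^sub>0 complex))
   \<Rightarrow> ('x \<times> 'y \<Rightarrow>\<^sub>0 complex) \<Rightarrow> ('x' \<times> 'y' \<Rightarrow>\<^sub>0 complex)" where
  "tensor_op f g = lin_ext (\<lambda>(x, y). f (basis_vec x) \<otimes> g (basis_vec y))"

text \<open>The identification of \<open>A \<otimes> B \<otimes> C \<otimes> D\<close> with \<open>A \<otimes> C \<otimes> B \<otimes> D\<close>.\<close>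
definition swap_middle ::
  "(('a \<times> 'b) \<times> ('c \<times> 'd) \<Rightarrow>\<^sub>0 complex) \<Rightarrow> (('a \<times> 'c) \<times> ('b \<times> 'd) \<Rightarrow>\<^sub>0 complex)" where
  "swap_middle = lin_ext (\<lambda>((a, b), (c, d)). basis_vec ((a, c), (b, d)))"

text \<open>Operator-valued power series without constant term have an exponential: the coefficient
  of degree \<open>N\<close> only involves the powers \<open>A^k\<close> with \<open>k \<le> N\<close>.\<close>

definition op_series_mult ::
  "(nat \<Rightarrow> 'v \<Rightarrow> 'v) \<Rightarrow> (nat \<Rightarrow> 'v \<Rightarrow> 'v) \<Rightarrow> nat \<Rightarrow> 'v::ab_group_add \<Rightarrow> 'v" where
  "op_series_mult A B N v = (\<Sum>i\<le>N. A i (B (N - i) v))"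

primrec op_series_power :: "(nat \<Rightarrow> 'v \<Rightarrow> 'v) \<Rightarrow> nat \<Rightarrow> nat \<Rightarrow> 'v::ab_group_add \<Rightarrow> 'v" where
  "op_series_power A 0 = (\<lambda>N v. if N = 0 then v else 0)"
| "op_series_power A (Suc k) = op_series_mult A (op_series_power A k)"

definition op_series_exp ::
  "(nat \<Rightarrow> ('x \<Rightarrow>\<^sub>0 complex) \<Rightarrow> ('x \<Rightarrow>\<^sub>0 complex)) \<Rightarrow> nat \<Rightarrow> ('x \<Rightarrow>\<^sub>0 complex) \<Rightarrow> ('x \<Rightarrow>\<^sub>0 complex)" where
  "op_series_exp A N v = (\<Sum>k\<le>N. cscale (1 / fact k) (op_series_power A k N v))"


section \<open>Lattices\<close>

context ab_group_add
begin

definition zscale :: "int \<Rightarrow> 'a \<Rightarrow> 'a" where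
  "zscale k x = (\<Sum>i<nat k. x) - (\<Sum>i<nat (- k). x)"

definition is_zcoord :: "'a set \<Rightarrow> 'a \<Rightarrow> ('a \<Rightarrow> int) \<Rightarrow> bool" where
  "is_zcoord B x c \<longleftrightarrow> (\<forall>b. b \<notin> B \<longrightarrow> c b = 0) \<and> x = (\<Sum>b\<in>B. zscale (c b) b)"

definition is_zbasis :: "'a set \<Rightarrow> bool" where
  "is_zbasis B \<longleftrightarrow> finite B \<and> (\<forall>x. \<exists>!c. is_zcoord B x c)"

end

text \<open>Free abelian groups of finite rank; rank 0 is included.\<close>
class fg_free_ab_group = ab_group_add +
  assumes ex_zbasis: "\<exists>B :: 'a set. is_zbasis B"

definition zbasis :: "'l::fg_free_ab_group set" where
  "zbasis = (SOME B. is_zbasis B)"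

definition zcoord :: "'l::fg_free_ab_group \<Rightarrow> 'l \<Rightarrow> int" where
  "zcoord x = (THE c. is_zcoord zbasis x c)"

definition nondegenerate_even_form :: "('l::ab_group_add \<Rightarrow> 'l \<Rightarrow> int) \<Rightarrow> bool" where
  "nondegenerate_even_form B \<longleftrightarrow>
     (\<forall>\<alpha> \<beta> \<gamma>. B (\<alpha> + \<beta>) \<gamma> = B \<alpha> \<gamma> + B \<beta> \<gamma>) \<and>
     (\<forall>\<alpha> \<beta>. B \<alpha> \<beta> = B \<beta> \<alpha>) \<and>
     (\<forall>\<alpha>. (\<forall>\<beta>. B \<alpha> \<beta> = 0) \<longrightarrow> \<alpha> = 0) \<and>
     (\<forall>\<alpha>. even (B \<alpha> \<alpha>))"

definition normalized_2_cocycle :: "('l::ab_group_add \<Rightarrow> 'l \<Rightarrow> complex) \<Rightarrow> bool" where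
  "normalized_2_cocycle \<epsilon> \<longleftrightarrow>
     (\<forall>\<alpha> \<beta>. \<epsilon> \<alpha> \<beta> \<noteq> 0) \<and>
     (\<forall>\<alpha>. \<epsilon> \<alpha> 0 = 1 \<and> \<epsilon> 0 \<alpha> = 1) \<and>
     (\<forall>\<alpha> \<beta> \<gamma>. \<epsilon> \<alpha> (\<beta> + \<gamma>) * \<epsilon> \<beta> \<gamma> = \<epsilon> (\<alpha> + \<beta>) \<gamma> * \<epsilon> \<alpha> \<beta>)"

text \<open>
  \<open>h = \<complex> \<otimes>\<^sub>\<int> L\<close> is the complex vector space with basis \<^const>\<open>zbasis\<close>: its elements are the
  \<open>h :: 'l \<Rightarrow>\<^sub>0 complex\<close> with \<open>keys h \<subseteq> zbasis\<close>. The following is the map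
  \<open>\<alpha> \<mapsto> 1 \<otimes> \<alpha>\<close>.
\<close>
definition to_h :: "'l::fg_free_ab_group \<Rightarrow> ('l \<Rightarrow>\<^sub>0 complex)" where
  "to_h \<alpha> = (\<Sum>b\<in>zbasis. Poly_Mapping.single b (of_int (zcoord \<alpha> b)))"

definition hform :: "('l \<Rightarrow> 'l \<Rightarrow> int) \<Rightarrow> ('l \<Rightarrow>\<^sub>0 complex) \<Rightarrow> ('l \<Rightarrow>\<^sub>0 complex) \<Rightarrow> complex" where
  "hform B h k = (\<Sum>a\<in>Poly_Mapping.keys h. \<Sum>b\<in>Poly_Mapping.keys k. Poly_Mapping.lookup h a * Poly_Mapping.lookup k b * of_int (B a b))"


section \<open>The algebra \<open>B\<^sub>h = S(h \<otimes> t^(-1) \<complex>[t^(-1)])\<close>\<close>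

text \<open>
  The vectors \<open>b(-n)\<close> with \<open>b\<close> in \<^const>\<open>zbasis\<close> and \<open>n \<ge> 1\<close> are a basis of
  \<open>h \<otimes> t^(-1) \<complex>[t^(-1)]\<close>, so \<open>B\<^sub>h\<close> is the polynomial algebra in these variables. A
  monomial is the multiset of its variables, the pair \<open>(b, n)\<close> standing for \<open>b(-n)\<close>.
\<close>
typedef (overloaded) 'l::fg_free_ab_group mon =
  "{m :: ('l \<times> nat) multiset. set_mset m \<subseteq> zbasis \<times> {1..}}"
  by (rule exI[of _ "{#}"]) simp

setup_lifting type_definition_mon

instantiation mon :: (fg_free_ab_group) comm_monoid_add
begin

lift_definition zero_mon :: "'a mon" is "{#}" by simp
lift_definition plus_mon :: "'a mon \<Rightarrow> 'a mon \<Rightarrow> 'a mon" is "(+)" by auto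

instance by standard (transfer; simp add: ac_simps)+

end

type_synonym 'l bh = "'l mon \<Rightarrow>\<^sub>0 complex"

definition hvar :: "'l::fg_free_ab_group \<times> nat \<Rightarrow> 'l bh" where
  "hvar z = basis_vec (Abs_mon {#z#})"

text \<open>\<open>h(-n)\<close> as an element of \<open>B\<^sub>h\<close>, for \<open>n \<ge> 1\<close>.\<close>
definition hneg :: "('l \<Rightarrow>\<^sub>0 complex) \<Rightarrow> nat \<Rightarrow> 'l::fg_free_ab_group bh" where
  "hneg h n = (\<Sum>b\<in>zbasis. cscale (Poly_Mapping.lookup h b) (hvar (b, n)))"

text \<open>The derivation of \<open>B\<^sub>h\<close> with the values \<open>g\<close> on the variables.\<close>
definition derivation_ext :: "('l::fg_free_ab_group \<times> nat \<Rightarrow> 'l bh) \<Rightarrow> 'l bh \<Rightarrow> 'l bh" where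
  "derivation_ext g =
     lin_ext (\<lambda>m. \<Sum>z\<in>#Rep_mon m. g z * basis_vec (Abs_mon (Rep_mon m - {#z#})))"

definition bh_Lm1 :: "'l::fg_free_ab_group bh \<Rightarrow> 'l bh" where
  "bh_Lm1 = derivation_ext (\<lambda>(b, n). cscale (of_nat n) (hvar (b, n + 1)))"

text \<open>The action of \<open>h(n)\<close> on \<open>B\<^sub>h\<close> for \<open>n \<noteq> 0\<close>.\<close>
definition bh_heis ::
  "('l \<Rightarrow> 'l \<Rightarrow> int) \<Rightarrow> ('l \<Rightarrow>\<^sub>0 complex) \<Rightarrow> int \<Rightarrow> 'l::fg_free_ab_group bh \<Rightarrow> 'l bh" where
  "bh_heis B h n u =
     (if n < 0 then hneg h (nat (- n)) * u
      else derivation_ext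
        (\<lambda>(b, m). if int m = n then cscale (of_int n * hform B h (basis_vec b)) 1 else 0) u)"

text \<open>The algebra homomorphism \<open>\<Delta>\<close> from \<open>B\<^sub>h\<close> to \<open>B\<^sub>h \<otimes> B\<^sub>h\<close> for which
  the variables are primitive.\<close>
definition bh_comult :: "'l::fg_free_ab_group bh \<Rightarrow> ('l mon \<times> 'l mon \<Rightarrow>\<^sub>0 complex)" where
  "bh_comult = lin_ext (\<lambda>m. \<Prod>z\<in>#Rep_mon m. (hvar z \<otimes> 1 + 1 \<otimes> hvar z))"


section \<open>The algebras \<open>B\<^sub>L\<^sub>,\<^sub>\<epsilon>\<close> and \<open>B\<^sub>L\<close> and the smash product\<close>

text \<open>
  \<open>\<complex>\<^sub>\<epsilon>[L] \<otimes> B\<^sub>h\<close>, with basis \<open>e\<^sub>\<alpha> \<otimes> m\<close>. This is the common underlying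
  space of \<open>B\<^sub>L\<^sub>,\<^sub>\<epsilon>\<close>, \<open>B\<^sub>L\<close> and \<open>V\<^sub>L\<close>; the element \<open>e\<^sub>\<alpha>\<close> (\<open>e^\<alpha>\<close> in \<open>B\<^sub>L\<close>) is
  \<open>basis_vec \<alpha> \<otimes> 1\<close>.
\<close>
type_synonym 'l bl = "'l \<times> 'l mon \<Rightarrow>\<^sub>0 complex"

abbreviation e_elt :: "'l::fg_free_ab_group \<Rightarrow> 'l bl" where
  "e_elt \<alpha> \<equiv> basis_vec \<alpha> \<otimes> 1"

definition bl_mult :: "('l \<Rightarrow> 'l \<Rightarrow> complex) \<Rightarrow> 'l::fg_free_ab_group bl \<Rightarrow> 'l bl \<Rightarrow> 'l bl" where
  "bl_mult \<epsilon> p q =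
     lin_ext (\<lambda>((\<alpha>, m), (\<beta>, m')). Poly_Mapping.single (\<alpha> + \<beta>, m + m') (\<epsilon> \<alpha> \<beta>)) (p \<otimes> q)"

definition bl_Lm1 :: "'l::fg_free_ab_group bl \<Rightarrow> 'l bl" where
  "bl_Lm1 = lin_ext (\<lambda>(\<alpha>, m).
     basis_vec \<alpha> \<otimes> (hneg (to_h \<alpha>) 1 * basis_vec m) + basis_vec \<alpha> \<otimes> bh_Lm1 (basis_vec m))"

definition bl_Y ::
  "('l \<Rightarrow> 'l \<Rightarrow> complex) \<Rightarrow> 'l::fg_free_ab_group bl \<Rightarrow> 'l bl \<Rightarrow> int \<Rightarrow> 'l bl" where
  "bl_Y \<epsilon> = differential_algebra_Y cscale (bl_mult \<epsilon>) bl_Lm1"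

abbreviation trivial_cocycle :: "'l \<Rightarrow> 'l \<Rightarrow> complex" where
  "trivial_cocycle \<equiv> \<lambda>_ _. 1"

text \<open>
  The element \<open>(e\<^sub>\<alpha> \<otimes> e^\<alpha>) \<otimes> t\<close>, for \<open>t\<close> in \<open>B\<^sub>h \<otimes> B\<^sub>h\<close>.
\<close>
definition diag_elt ::
  "'l \<Rightarrow> ('l mon \<times> 'l mon \<Rightarrow>\<^sub>0 complex)
     \<Rightarrow> (('l \<times> 'l::fg_free_ab_group mon) \<times> ('l \<times> 'l mon) \<Rightarrow>\<^sub>0 complex)" where
  "diag_elt \<alpha> t = swap_middle ((basis_vec \<alpha> \<otimes> basis_vec \<alpha>) \<otimes> t)"

definition bl_comult ::
  "'l::fg_free_ab_group bl \<Rightarrow> (('l \<times> 'l mon) \<times> ('l \<times> 'l mon) \<Rightarrow>\<^sub>0 complex)" where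
  "bl_comult = lin_ext (\<lambda>(\<alpha>, m). diag_elt \<alpha> (bh_comult (basis_vec m)))"

definition bl_heis ::
  "('l \<Rightarrow> 'l \<Rightarrow> int) \<Rightarrow> ('l \<Rightarrow>\<^sub>0 complex) \<Rightarrow> int \<Rightarrow> 'l::fg_free_ab_group bl \<Rightarrow> 'l bl" where
  "bl_heis B h n =
     (if n = 0 then lin_ext (\<lambda>(\<beta>, m). cscale (hform B h (to_h \<beta>)) (basis_vec (\<beta>, m)))
      else tensor_op id (bh_heis B h n))"

text \<open>The coefficient of \<open>x^(-N)\<close> in \<open>E\<^sup>+(\<alpha>,x)\<close> and of \<open>x^N\<close> in \<open>E\<^sup>-(\<alpha>,x)\<close>.\<close>

definition E_plus ::
  "('l \<Rightarrow> 'l \<Rightarrow> int) \<Rightarrow> 'l \<Rightarrow> nat \<Rightarrow> 'l::fg_free_ab_group bl \<Rightarrow> 'l bl" where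
  "E_plus B \<alpha> = op_series_exp
     (\<lambda>n v. if n = 0 then 0 else cscale (1 / of_nat n) (bl_heis B (to_h \<alpha>) (int n) v))"

definition E_minus ::
  "('l \<Rightarrow> 'l \<Rightarrow> int) \<Rightarrow> 'l \<Rightarrow> nat \<Rightarrow> 'l::fg_free_ab_group bl \<Rightarrow> 'l bl" where
  "E_minus B \<alpha> = op_series_exp
     (\<lambda>n v. if n = 0 then 0 else cscale (1 / (- of_nat n)) (bl_heis B (to_h \<alpha>) (- int n) v))"

text \<open>The coefficient of \<open>x^k\<close> in \<open>x^\<alpha>\<^sup>(\<^sup>0\<^sup>) v\<close>.\<close>
definition x_pow_zero_mode ::
  "('l \<Rightarrow> 'l \<Rightarrow> int) \<Rightarrow> 'l \<Rightarrow> 'l::fg_free_ab_group bl \<Rightarrow> int \<Rightarrow> 'l bl" where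
  "x_pow_zero_mode B \<alpha> v k =
     lin_ext (\<lambda>(\<beta>, m). if B \<alpha> \<beta> = k then basis_vec (\<beta>, m) else 0) v"

text \<open>\<open>YM\<close> is the \<open>B\<^sub>L\<close>-module structure on \<open>B\<^sub>L\<^sub>,\<^sub>\<epsilon>\<close> with
  \<open>YM(e^\<alpha>,x) = E\<^sup>+(-\<alpha>,x) x^\<alpha>\<^sup>(\<^sup>0\<^sup>)\<close>.\<close>
definition is_bl_module_map ::
  "('l \<Rightarrow> 'l \<Rightarrow> int) \<Rightarrow> ('l::fg_free_ab_group bl \<Rightarrow> 'l bl \<Rightarrow> int \<Rightarrow> 'l bl) \<Rightarrow> bool" where
  "is_bl_module_map B YM \<longleftrightarrow>
     nonlocal_vertex_algebra_module cscale UNIV (bl_Y trivial_cocycle) (e_elt 0) cscale UNIV YM \<and>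
     (\<forall>\<alpha> v n. YM (e_elt \<alpha>) v n =
        Sum_any (\<lambda>N::nat. E_plus B (- \<alpha>) N (x_pow_zero_mode B \<alpha> v (n + int N))))"

text \<open>\<open>Y\<close> is the vertex algebra structure of \<open>V\<^sub>L\<close>, in which
  \<open>Y(e\<^sub>\<alpha>,x) = E\<^sup>-(-\<alpha>,x) E\<^sup>+(-\<alpha>,x) e\<^sub>\<alpha> x^\<alpha>\<^sup>(\<^sup>0\<^sup>)\<close>.\<close>
definition is_lattice_vertex_algebra ::
  "('l \<Rightarrow> 'l \<Rightarrow> int) \<Rightarrow> ('l \<Rightarrow> 'l \<Rightarrow> complex)
     \<Rightarrow> ('l::fg_free_ab_group bl \<Rightarrow> 'l bl \<Rightarrow> int \<Rightarrow> 'l bl) \<Rightarrow> bool" where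
  "is_lattice_vertex_algebra B \<epsilon> Y \<longleftrightarrow>
     vertex_algebra cscale UNIV Y (e_elt 0) \<and>
     vertex_algebra_generated_by cscale UNIV Y (e_elt 0) (range e_elt) \<and>
     (\<forall>\<alpha> v n. Y (e_elt \<alpha>) v n =
        Sum_any (\<lambda>(i::nat, j::nat). E_minus B (- \<alpha>) i (E_plus B (- \<alpha>) j
          (bl_mult \<epsilon> (e_elt \<alpha>) (x_pow_zero_mode B \<alpha> v (n - int i + int j))))))"

text \<open>
  The map \<open>Y\<^sup>\<sharp>(u \<otimes> h, x)(v \<otimes> k) = \<Sum> Y(u,x) YM(h\<^sub>1,x) v \<otimes> Y(h\<^sub>2,x) k\<close>, extended bilinearly
  from basis vectors; the exponents \<open>a\<close>, \<open>b\<close> and \<open>n - a - b\<close> are those of the three series.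
\<close>
definition smash_Y ::
  "(('x \<Rightarrow>\<^sub>0 complex) \<Rightarrow> ('x \<Rightarrow>\<^sub>0 complex) \<Rightarrow> int \<Rightarrow> ('x \<Rightarrow>\<^sub>0 complex))
   \<Rightarrow> (('y \<Rightarrow>\<^sub>0 complex) \<Rightarrow> ('y \<Rightarrow>\<^sub>0 complex) \<Rightarrow> int \<Rightarrow> ('y \<Rightarrow>\<^sub>0 complex))
   \<Rightarrow> (('y \<Rightarrow>\<^sub>0 complex) \<Rightarrow> ('y \<times> 'y \<Rightarrow>\<^sub>0 complex))
   \<Rightarrow> (('y \<Rightarrow>\<^sub>0 complex) \<Rightarrow> ('x \<Rightarrow>\<^sub>0 complex) \<Rightarrow> int \<Rightarrow> ('x \<Rightarrow>\<^sub>0 complex))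
   \<Rightarrow> ('x \<times> 'y \<Rightarrow>\<^sub>0 complex) \<Rightarrow> ('x \<times> 'y \<Rightarrow>\<^sub>0 complex) \<Rightarrow> int \<Rightarrow> ('x \<times> 'y \<Rightarrow>\<^sub>0 complex)" where
  "smash_Y YV YH comult YM s t n =
     lin_ext (\<lambda>((u, h), (v, k)).
       lin_ext (\<lambda>(h1, h2).
         Sum_any (\<lambda>(a, b).
           YV (basis_vec u) (YM (basis_vec h1) (basis_vec v) b) a
             \<otimes> YH (basis_vec h2) (basis_vec k) (n - a - b)))
         (comult (basis_vec h)))
       (s \<otimes> t)"

abbreviation lattice_smash_Y ::
  "('l \<Rightarrow> 'l \<Rightarrow> complex) \<Rightarrow> ('l::fg_free_ab_group bl \<Rightarrow> 'l bl \<Rightarrow> int \<Rightarrow> 'l bl)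
   \<Rightarrow> (('l \<times> 'l mon) \<times> ('l \<times> 'l mon) \<Rightarrow>\<^sub>0 complex)
   \<Rightarrow> (('l \<times> 'l mon) \<times> ('l \<times> 'l mon) \<Rightarrow>\<^sub>0 complex)
   \<Rightarrow> int \<Rightarrow> (('l \<times> 'l mon) \<times> ('l \<times> 'l mon) \<Rightarrow>\<^sub>0 complex)" where
  "lattice_smash_Y \<epsilon> YM \<equiv> smash_Y (bl_Y \<epsilon>) (bl_Y trivial_cocycle) bl_comult YM"

definition U_space :: "(('l \<times> 'l::fg_free_ab_group mon) \<times> ('l \<times> 'l mon) \<Rightarrow>\<^sub>0 complex) set" where
  "U_space = cvec.span {diag_elt \<alpha> (bh_comult u) | \<alpha> u. True}"

definition pi_map ::
  "'l::fg_free_ab_group bl \<Rightarrow> (('l \<times> 'l mon) \<times> ('l \<times> 'l mon) \<Rightarrow>\<^sub>0 complex)" where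
  "pi_map = lin_ext (\<lambda>(\<alpha>, m). diag_elt \<alpha> (bh_comult (basis_vec m)))"

text \<open>\<open>\<pi>\<close> is defined on basis vectors; by \<open>pi_map_tensor\<close> below it takes the intended
  values on all \<open>e\<^sub>\<alpha> \<otimes> u\<close>.\<close>

lemma lin_ext_superset:
  assumes "finite S" "Poly_Mapping.keys p \<subseteq> S"
  shows "lin_ext f p = (\<Sum>x\<in>S. cscale (Poly_Mapping.lookup p x) (f x))"
  unfolding lin_ext_def
  by (rule sum.mono_neutral_left) (use assms in \<open>auto simp: in_keys_iff\<close>)

lemma lin_ext_add: "lin_ext f (p + q) = lin_ext f p + lin_ext f q"
proof -
  let ?S = "Poly_Mapping.keys p \<union> Poly_Mapping.keys q"
  have "Poly_Mapping.keys (p + q) \<subseteq> ?S" by (rule Poly_Mapping.keys_add)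
  then show ?thesis
    by (simp add: lin_ext_superset[of ?S] lookup_add cvec.scale_left_distrib sum.distrib)
qed

lemma lin_ext_cscale: "lin_ext f (cscale c p) = cscale c (lin_ext f p)"
proof -
  have "Poly_Mapping.keys (cscale c p) \<subseteq> Poly_Mapping.keys p" by (auto simp: in_keys_iff)
  then show ?thesis
    by (simp add: lin_ext_superset[of "Poly_Mapping.keys p"] cvec.scale_sum_right)
qed

lemma linear_lin_ext: "Vector_Spaces.linear cscale cscale (lin_ext f)"
  by unfold_locales (simp_all add: lin_ext_add lin_ext_cscale)

lemma lin_ext_single [simp]: "lin_ext f (Poly_Mapping.single x c) = cscale c (f x)"
  by (simp add: lin_ext_def)

lemma cscale_single [simp]: "cscale c (Poly_Mapping.single x d) = Poly_Mapping.single x (c * d)"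
  by (rule poly_mapping_eqI) (simp add: lookup_single when_def)

lemma tensor_basis_right:
  "basis_vec x \<otimes> q = (\<Sum>y\<in>Poly_Mapping.keys q. cscale (Poly_Mapping.lookup q y) (basis_vec (x, y)))"
  by (simp add: tensor_def)

lemma basis_expansion:
  "q = (\<Sum>y\<in>Poly_Mapping.keys q. cscale (Poly_Mapping.lookup q y) (basis_vec y))"
proof (rule poly_mapping_eqI)
  fix k
  have "Poly_Mapping.lookup (\<Sum>y\<in>Poly_Mapping.keys q. cscale (Poly_Mapping.lookup q y) (basis_vec y)) k
      = (\<Sum>y\<in>Poly_Mapping.keys q. if y = k then Poly_Mapping.lookup q k else 0)"
    unfolding lookup_sum by (rule sum.cong) (auto simp: lookup_single when_def)
  then show "Poly_Mapping.lookup q k =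
      Poly_Mapping.lookup (\<Sum>y\<in>Poly_Mapping.keys q. cscale (Poly_Mapping.lookup q y) (basis_vec y)) k"
    by (simp add: in_keys_iff)
qed

lemma tensor_superset:
  assumes "finite S" "Poly_Mapping.keys q \<subseteq> S"
  shows "p \<otimes> q = (\<Sum>x\<in>Poly_Mapping.keys p. \<Sum>y\<in>S.
           Poly_Mapping.single (x, y) (Poly_Mapping.lookup p x * Poly_Mapping.lookup q y))"
  unfolding tensor_def
  by (intro sum.cong refl sum.mono_neutral_left) (use assms in \<open>auto simp: in_keys_iff\<close>)

lemma tensor_add_right: "p \<otimes> (q + r) = p \<otimes> q + p \<otimes> r"
proof -
  let ?S = "Poly_Mapping.keys q \<union> Poly_Mapping.keys r"
  have "Poly_Mapping.keys (q + r) \<subseteq> ?S" by (rule Poly_Mapping.keys_add)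
  then show ?thesis
    by (simp add: tensor_superset[of ?S] lookup_add distrib_left single_add sum.distrib)
qed

lemma tensor_cscale_right: "p \<otimes> cscale c q = cscale c (p \<otimes> q)"
proof -
  have "Poly_Mapping.keys (cscale c q) \<subseteq> Poly_Mapping.keys q" by (auto simp: in_keys_iff)
  then show ?thesis
    by (simp add: tensor_superset[of "Poly_Mapping.keys q"] cvec.scale_sum_right mult_ac)
qed

lemma linear_diag_elt: "Vector_Spaces.linear cscale cscale (diag_elt \<alpha>)"
  by unfold_locales
    (simp_all add: diag_elt_def swap_middle_def tensor_add_right tensor_cscale_right
      lin_ext_add lin_ext_cscale)

lemma pi_map_tensor: "pi_map (basis_vec \<alpha> \<otimes> u) = diag_elt \<alpha> (bh_comult u)"
proof -
  interpret P: Vector_Spaces.linear cscale cscale "pi_map :: 'a bl \<Rightarrow> _"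
    unfolding pi_map_def by (rule linear_lin_ext)
  interpret D: Vector_Spaces.linear cscale cscale "bh_comult :: 'a bh \<Rightarrow> _"
    unfolding bh_comult_def by (rule linear_lin_ext)
  interpret E: Vector_Spaces.linear cscale cscale "diag_elt \<alpha>"
    by (rule linear_diag_elt)
  have "pi_map (basis_vec \<alpha> \<otimes> u) =
      (\<Sum>m\<in>Poly_Mapping.keys u. cscale (Poly_Mapping.lookup u m) (diag_elt \<alpha> (bh_comult (basis_vec m))))"
    by (simp add: tensor_basis_right P.sum P.scale) (simp add: pi_map_def)
  also have "\<dots> = diag_elt \<alpha> (bh_comult (\<Sum>m\<in>Poly_Mapping.keys u. cscale (Poly_Mapping.lookup u m) (basis_vec m)))"
    by (simp add: D.sum D.scale E.sum E.scale del: cscale_single)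
  finally show ?thesis by (simp only: basis_expansion[symmetric])
qed

end

theory Submission
  imports Defs "HOL-Computational_Algebra.Formal_Laurent_Series"
begin

text \<open>
  Write \<open>Y\<^sup>\<sharp>\<close> for the vertex operators of the smash product and
  \<open>\<Phi>(x) = Y\<^sub>M(e\<^sup>\<alpha>, x)\<close>. The map \<open>\<pi>\<close> is the comultiplication of \<open>B\<^sub>L\<close>; it is injective
  with image \<open>U\<close>, so everything follows from \<open>\<pi>(Y(v,x)w) = Y\<^sup>\<sharp>(\<pi> v, x) \<pi> w\<close>.
  For \<open>v = e\<^sub>\<alpha>\<close> this is a computation: multiplication by \<open>E\<^sup>-(-\<alpha>,x) e\<^sub>\<alpha>\<close> is multiplication by
  \<open>e^(x L(-1)) e\<^sub>\<alpha>\<close>, and \<open>\<Phi>\<close> commutes with \<open>\<pi>\<close>. As the \<open>e\<^sub>\<alpha>\<close> generate \<open>V\<^sub>L\<close>, it remains to pass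
  from \<open>v\<close> to the coefficients of \<open>Y(e\<^sub>\<alpha>, x)v\<close>, for which one needs weak associativity of
  \<open>Y\<^sup>\<sharp>\<close> only for triples \<open>(\<pi> e\<^sub>\<alpha>, s, t)\<close>. There it follows from weak associativity of \<open>Y\<^sub>M\<close>,
  because \<open>\<Phi>(x)\<close> is multiplicative and \<open>\<Phi>(x) e^(y L(-1)) = e^(y L(-1)) \<Phi>(x - y)\<close>.
\<close>

text \<open>For a general h only the module axioms describe \<open>YM h\<close>, yet the smash
  product involves it for every term of \<Delta>(h). With e_\<alpha> \<otimes> e^\<alpha> as left
  argument this does no harm: e^\<alpha> is group-like, \<Phi> is explicit, and the unknown operator
  enters both sides of weak associativity in the same way. Weak associativity is what carries the
  identity from v to Y(e_\<alpha>,x)v, because it determines Y(Y(u,x0)v,x2)w from Y(u,x1)Y(v,x2)w: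
  the factor (x0+x2)^l can be cancelled on series bounded below in x0. This gives stability only
  under the modes of e_\<alpha>, whereas generation speaks of subalgebras; so one passes to the set
  of all u whose modes preserve the good vectors. The product of
  \<open>B\<^sub>L\<^sub>,\<^sub>\<epsilon>\<close> is in general not commutative, but multiplying
  by an element of degree \<beta> is commutative multiplication after scaling degree \<gamma> by
  \<epsilon>(\<beta>,\<gamma>). Hence all series have coefficients in commutative monoid algebras,
  where e^(y L(-1)), the Taylor shift and \<Phi> are all multiplicative. Locality on U is carried
  over from V_L.\<close>

unbundle fps_syntax

type_synonym 'x vec = "'x \<Rightarrow>\<^sub>0 complex"

subsection \<open>Laurent series\<close>

lemma fls_sum_nth: "sum f A $$ n = (\<Sum>x\<in>A. f x $$ n)"
  by (induction A rule: infinite_finite_induct) simp_all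

text \<open>Any lower bounds for the two factors do, not only their exact orders, so products of
  different series can be summed over one index range and compared term by term.\<close>

lemma fls_times_nth_bounds:
  fixes f g :: "'a::comm_ring_1 fls"
  assumes f: "\<And>i. i < M \<Longrightarrow> f $$ i = 0" and g: "\<And>i. i < N \<Longrightarrow> g $$ i = 0"
  shows "(f * g) $$ n = (\<Sum>i=M..n - N. f $$ i * g $$ (n - i))"
proof -
  have "(f * g) $$ n = (\<Sum>i=min M (fls_subdegree f)..max (n - N) (n - fls_subdegree g). f $$ i * g $$ (n - i))"
    unfolding fls_times_nth(2)
    by (rule sum.mono_neutral_left) auto
  also have "\<dots> = (\<Sum>i=M..n - N. f $$ i * g $$ (n - i))"
    by (rule sum.mono_neutral_right) (auto simp: f g)
  finally show ?thesis .
qed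

definition fls_map :: "('a::zero \<Rightarrow> 'b::zero) \<Rightarrow> 'a fls \<Rightarrow> 'b fls" where
  "fls_map \<phi> f = Abs_fls (\<lambda>n. \<phi> (f $$ n))"

lemma fls_map_nth [simp]:
  assumes "\<phi> 0 = 0"
  shows "fls_map \<phi> f $$ n = \<phi> (f $$ n)"
proof -
  obtain N where "\<forall>n<N. f $$ n = 0" by (rule fls_nth_vanishes_belowE)
  then show ?thesis unfolding fls_map_def
    by (intro nth_Abs_fls_ex_lower_bound exI[of _ N]) (simp add: assms)
qed

lemma additive_0: "additive \<phi> \<Longrightarrow> \<phi> 0 = 0"
  by (rule additive.zero)

lemma fls_map_add: "additive \<phi> \<Longrightarrow> fls_map \<phi> (f + g) = fls_map \<phi> f + fls_map \<phi> g"
  by (rule fls_eqI) (simp add: additive_0 additive.add)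

lemma additive_fls_map: "additive \<phi> \<Longrightarrow> additive (fls_map \<phi>)"
  by (simp add: additive_def fls_map_add)

lemma fls_map_sum: "additive \<phi> \<Longrightarrow> fls_map \<phi> (sum f A) = (\<Sum>x\<in>A. fls_map \<phi> (f x))"
  by (rule additive.sum[OF additive_fls_map])

lemma fls_map_comp: "\<phi> 0 = 0 \<Longrightarrow> \<psi> 0 = 0 \<Longrightarrow> fls_map \<phi> (fls_map \<psi> f) = fls_map (\<lambda>x. \<phi> (\<psi> x)) f"
  by (rule fls_eqI) simp

lemma fls_map_const: "\<phi> 0 = 0 \<Longrightarrow> fls_map \<phi> (fls_const c) = fls_const (\<phi> c)"
  by (rule fls_eqI) simp

text \<open>Each coefficient of the product is a finite sum, so an additive Q is evaluated term by
  term. The embeddings i1, i2 put both factors into one ring (later as p \<otimes> 1 and 1 \<otimes>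
  q). Q is in general not multiplicative: the product rule is asked only for the coefficients of the
  given f and g, so it may depend on their being homogeneous.\<close>

lemma fls_map_bilinear:
  fixes i1 :: "'a::comm_ring_1 \<Rightarrow> 'c::comm_ring_1" and i2 :: "'b::comm_ring_1 \<Rightarrow> 'c"
    and Q :: "'c \<Rightarrow> 'd::comm_ring_1"
  assumes Q: "additive Q" and i: "additive i1" "additive i2" and AC: "additive A" "additive C"
    and *: "\<And>j k. Q (i1 (f $$ j) * i2 (g $$ k)) = A (f $$ j) * C (g $$ k)"
  shows "fls_map Q (fls_map i1 f * fls_map i2 g) = fls_map A f * fls_map C g"
proof (rule fls_eqI)
  fix n
  obtain M where M: "\<forall>n<M. f $$ n = 0" by (rule fls_nth_vanishes_belowE)
  obtain N where N: "\<forall>n<N. g $$ n = 0" by (rule fls_nth_vanishes_belowE)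
  note z = additive_0[OF Q] additive_0[OF i(1)] additive_0[OF i(2)] additive_0[OF AC(1)] additive_0[OF AC(2)]
  have "fls_map Q (fls_map i1 f * fls_map i2 g) $$ n = Q (\<Sum>j=M..n-N. i1 (f $$ j) * i2 (g $$ (n - j)))"
    by (subst fls_map_nth[of Q]) (use M N in \<open>simp_all add: z fls_times_nth_bounds[of M _ N]\<close>)
  also have "\<dots> = (\<Sum>j=M..n-N. A (f $$ j) * C (g $$ (n - j)))"
    by (simp add: additive.sum[OF Q] *)
  also have "\<dots> = (fls_map A f * fls_map C g) $$ n"
    using M N by (simp add: z fls_times_nth_bounds[of M _ N])
  finally show "fls_map Q (fls_map i1 f * fls_map i2 g) $$ n = (fls_map A f * fls_map C g) $$ n" .
qed

lemma fls_map_mult: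
  fixes \<phi> :: "'a::comm_ring_1 \<Rightarrow> 'b::comm_ring_1"
  assumes "additive \<phi>" "\<And>a b. \<phi> (a * b) = \<phi> a * \<phi> b"
  shows "fls_map \<phi> (f * g) = fls_map \<phi> f * fls_map \<phi> g"
proof -
  have id: "additive (\<lambda>x::'a. x)" "fls_map (\<lambda>x. x) h = h" for h :: "'a fls"
    by (simp_all add: additive_def fls_eq_iff)
  show ?thesis
    using fls_map_bilinear[OF assms(1) id(1) id(1) assms(1) assms(1), of f g] assms(2)
    by (simp add: id)
qed

subsection \<open>Higher derivations and their exponential\<close>

text \<open>A higher derivation is a sequence of maps \<open>\<delta> n\<close> behaving like \<open>d^n / n!\<close>; the map
  \<^term>\<open>fls_exp \<delta>\<close> is \<open>e^(y d)\<close> on series in \<open>y\<close>.\<close>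

definition higher_derivation :: "(nat \<Rightarrow> 'a::comm_ring_1 \<Rightarrow> 'a) \<Rightarrow> bool" where
  "higher_derivation \<delta> \<longleftrightarrow> \<delta> 0 = (\<lambda>x. x) \<and> (\<forall>n. additive (\<delta> n)) \<and>
     (\<forall>n x y. \<delta> n (x * y) = (\<Sum>i\<le>n. \<delta> i x * \<delta> (n - i) y))"

definition fls_exp :: "(nat \<Rightarrow> 'a::comm_ring_1 \<Rightarrow> 'a) \<Rightarrow> 'a fls \<Rightarrow> 'a fls" where
  "fls_exp \<delta> f = Abs_fls (\<lambda>n. \<Sum>i=fls_subdegree f..n. \<delta> (nat (n - i)) (f $$ i))"

lemma higher_derivation_0: "higher_derivation \<delta> \<Longrightarrow> \<delta> n 0 = 0"
  unfolding higher_derivation_def using additive_0 by blast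

lemma higher_derivation_additive: "higher_derivation \<delta> \<Longrightarrow> additive (\<delta> n)"
  unfolding higher_derivation_def by blast

lemma fls_exp_nth:
  assumes "higher_derivation \<delta>" and f: "\<And>i. i < N \<Longrightarrow> f $$ i = 0"
  shows "fls_exp \<delta> f $$ n = (\<Sum>i=N..n. \<delta> (nat (n - i)) (f $$ i))"
proof -
  have "fls_exp \<delta> f $$ n = (\<Sum>i=fls_subdegree f..n. \<delta> (nat (n - i)) (f $$ i))"
    unfolding fls_exp_def by (intro nth_Abs_fls_lower_bound[of "fls_subdegree f"]) simp
  also have "\<dots> = (\<Sum>i=min N (fls_subdegree f)..n. \<delta> (nat (n - i)) (f $$ i))"
    by (rule sum.mono_neutral_left) (auto simp: higher_derivation_0[OF assms(1)])
  also have "\<dots> = (\<Sum>i=N..n. \<delta> (nat (n - i)) (f $$ i))"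
    by (rule sum.mono_neutral_right) (auto simp: higher_derivation_0[OF assms(1)] f)
  finally show ?thesis .
qed

lemma fls_exp_nth_eq_0:
  assumes "higher_derivation \<delta>" and "\<And>i. i < N \<Longrightarrow> f $$ i = 0" "n < N"
  shows "fls_exp \<delta> f $$ n = 0"
  using fls_exp_nth[OF assms(1,2), where n = n] assms(3) by simp

lemma fls_exp_nth':
  assumes "higher_derivation \<delta>" and f: "\<And>i. i < N \<Longrightarrow> f $$ i = 0" and K: "n - int K \<le> N"
  shows "fls_exp \<delta> f $$ n = (\<Sum>j\<le>K. \<delta> j (f $$ (n - int j)))"
proof -
  have "(\<Sum>j\<le>K. \<delta> j (f $$ (n - int j))) = (\<Sum>i=n - int K..n. \<delta> (nat (n - i)) (f $$ i))"
    by (rule sum.reindex_bij_witness[of _ "\<lambda>i. nat (n - i)" "\<lambda>j. n - int j"]) auto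
  also have "\<dots> = (\<Sum>i=N..n. \<delta> (nat (n - i)) (f $$ i))"
    by (rule sum.mono_neutral_right)
      (use K in \<open>auto simp: f higher_derivation_0[OF assms(1)]\<close>)
  finally show ?thesis using fls_exp_nth[OF assms(1,2)] by simp
qed

lemma fls_exp_add:
  assumes "higher_derivation \<delta>"
  shows "fls_exp \<delta> (f + g) = fls_exp \<delta> f + fls_exp \<delta> g"
proof (rule fls_eqI)
  fix n
  obtain M where M: "\<forall>n<M. f $$ n = 0" by (rule fls_nth_vanishes_belowE)
  obtain N where N: "\<forall>n<N. g $$ n = 0" by (rule fls_nth_vanishes_belowE)
  have "fls_exp \<delta> h $$ n = (\<Sum>i=min M N..n. \<delta> (nat (n - i)) (h $$ i))"
    if "h = f \<or> h = g \<or> h = f + g" for h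
    by (rule fls_exp_nth[OF assms]) (use that M N in auto)
  then show "fls_exp \<delta> (f + g) $$ n = (fls_exp \<delta> f + fls_exp \<delta> g) $$ n"
    by (simp add: additive.add[OF higher_derivation_additive[OF assms]] sum.distrib)
qed

text \<open>The Leibniz rule makes e^(y d) a ring homomorphism. Both coefficients are sums over
  quadruples (i, j, p, q) with sum K: the exponents i, j above the lower bounds M, N, and the orders
  p, q of the derivations applied to the two coefficients.\<close>

lemma fls_exp_mult:
  assumes "higher_derivation \<delta>"
  shows "fls_exp \<delta> (f * g) = fls_exp \<delta> f * fls_exp \<delta> g"
proof (rule fls_eqI)
  fix n
  obtain M where M: "\<And>n. n<M \<Longrightarrow> f $$ n = 0" by (rule fls_nth_vanishes_belowE) blast
  obtain N where N: "\<And>n. n<N \<Longrightarrow> g $$ n = 0" by (rule fls_nth_vanishes_belowE) blast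
  define K where "K = nat (n - (M + N))"
  let ?F = "\<lambda>i::nat. f $$ (M + int i)" and ?G = "\<lambda>i::nat. g $$ (N + int i)"
  have fg0: "(f * g) $$ i = 0" if "i < M + N" for i
    using that by (simp add: fls_times_nth_bounds[of M f N g] M N)
  note [simp] = M N
  have add: "additive (\<delta> k)" for k using higher_derivation_additive[OF assms] .
  show "fls_exp \<delta> (f * g) $$ n = (fls_exp \<delta> f * fls_exp \<delta> g) $$ n"
  proof (cases "n < M + N")
    case True
    have "fls_exp \<delta> (f * g) $$ n = 0"
      by (rule fls_exp_nth_eq_0[OF assms fg0 True])
    moreover have "(fls_exp \<delta> f * fls_exp \<delta> g) $$ n = 0"
      using True fls_exp_nth_eq_0[OF assms M] fls_exp_nth_eq_0[OF assms N]
      by (subst fls_times_nth_bounds[of M _ N]) auto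
    ultimately show ?thesis by simp
  next
    case False
    then have n: "n = M + N + int K" by (simp add: K_def)
    have fg: "(f * g) $$ (M + N + int k) = (\<Sum>i\<le>k. ?F i * ?G (k - i))" for k
    proof -
      have "(f * g) $$ (M + N + int k) = (\<Sum>i=M..M + int k. f $$ i * g $$ (M + N + int k - i))"
        by (simp add: fls_times_nth_bounds[of M f N g] add.commute add.left_commute)
      also have "\<dots> = (\<Sum>i\<le>k. ?F i * ?G (k - i))"
        by (rule sum.reindex_bij_witness[of _ "\<lambda>j. M + int j" "\<lambda>i. nat (i - M)"]) (auto simp: algebra_simps)
      finally show ?thesis .
    qed
    have ex: "fls_exp \<delta> h $$ (R + int k) = (\<Sum>i\<le>k. \<delta> (k - i) (h $$ (R + int i)))"
      if "\<And>i. i < R \<Longrightarrow> h $$ i = 0" for h R k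
    proof -
      have "fls_exp \<delta> h $$ (R + int k) = (\<Sum>i=R..R + int k. \<delta> (nat (R + int k - i)) (h $$ i))"
        by (rule fls_exp_nth[OF assms that])
      also have "\<dots> = (\<Sum>i\<le>k. \<delta> (k - i) (h $$ (R + int i)))"
        proof (rule sum.reindex_bij_witness[of _ "\<lambda>j. R + int j" "\<lambda>i. nat (i - R)"])
        fix a assume "a \<in> {R..R + int k}"
        then have "k - nat (a - R) = nat (R + int k - a)" by auto
        with \<open>a \<in> _\<close> show "\<delta> (k - nat (a - R)) (h $$ (R + int (nat (a - R)))) = \<delta> (nat (R + int k - a)) (h $$ a)"
          by simp
      qed auto
      finally show ?thesis .
    qed
    let ?I = "{(i,j,p,q). i + j + p + q = K}"
    have fin: "finite ?I"
      by (rule finite_subset[of _ "{..K} \<times> {..K} \<times> {..K} \<times> {..K}"]) auto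
    let ?t = "\<lambda>(i,j,p,q). \<delta> p (?F i) * \<delta> q (?G j)"
    have "fls_exp \<delta> (f * g) $$ n = (\<Sum>k\<le>K. \<delta> (K - k) ((f * g) $$ (M + N + int k)))"
      unfolding n by (rule ex[OF fg0])
    also have "\<dots> = (\<Sum>k\<le>K. \<Sum>i\<le>k. \<Sum>p\<le>K - k. \<delta> p (?F i) * \<delta> (K - k - p) (?G (k - i)))"
      using assms unfolding fg by (simp add: additive.sum[OF add] higher_derivation_def)
    also have "\<dots> = (\<Sum>x\<in>(SIGMA k:{..K}. SIGMA i:{..k}. {..K - k}). ?t (fst (snd x), fst x - fst (snd x), snd (snd x), K - fst x - snd (snd x)))"
      by (simp add: sum.Sigma case_prod_unfold) (intro sum.cong refl, auto simp: of_nat_diff)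
    also have "\<dots> = sum ?t ?I"
      by (rule sum.reindex_bij_witness[of _ "\<lambda>(i,j,p,q). (i + j, i, p)"
            "\<lambda>(k,i,p). (i, k - i, p, K - k - p)"]) auto
    also have "\<dots> = (\<Sum>x\<in>(SIGMA k:{..K}. SIGMA i:{..k}. {..K - k}). ?t (fst (snd x), snd (snd x), fst x - fst (snd x), K - fst x - snd (snd x)))"
      by (rule sum.reindex_bij_witness[of _ "\<lambda>(k,i,j). (i, j, k - i, K - k - j)"
            "\<lambda>(i,j,p,q). (i + p, i, j)"]) auto
    also have "\<dots> = (\<Sum>k\<le>K. fls_exp \<delta> f $$ (M + int k) * fls_exp \<delta> g $$ (N + int (K - k)))"
      by (simp add: ex[OF M] ex[OF N] sum.Sigma case_prod_unfold sum_product diff_diff_left del: of_nat_diff)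
    also have "\<dots> = (\<Sum>i=M..n - N. fls_exp \<delta> f $$ i * fls_exp \<delta> g $$ (n - i))"
      by (rule sum.reindex_bij_witness[of _ "\<lambda>i. nat (i - M)" "\<lambda>k. M + int k"])
        (auto simp: n algebra_simps)
    also have "\<dots> = (fls_exp \<delta> f * fls_exp \<delta> g) $$ n"
      by (rule fls_times_nth_bounds[symmetric])
        (auto intro: fls_exp_nth_eq_0[OF assms M] fls_exp_nth_eq_0[OF assms N])
    finally show ?thesis .
  qed
qed

lemma fls_exp_const:
  assumes "higher_derivation \<delta>"
  shows "fls_exp \<delta> (fls_const a) $$ n = (if n < 0 then 0 else \<delta> (nat n) a)"
proof (cases "n < 0")
  case True
  then show ?thesis using fls_exp_nth_eq_0[OF assms, of 0 "fls_const a" n] by simp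
next
  case False
  have "fls_exp \<delta> (fls_const a) $$ n = (\<Sum>i=0..n. \<delta> (nat (n - i)) (fls_const a $$ i))"
    by (rule fls_exp_nth[OF assms]) simp
  also have "\<dots> = (\<Sum>i\<in>{0}. \<delta> (nat (n - i)) (fls_const a $$ i))"
    by (rule sum.mono_neutral_right) (use False in \<open>auto simp: higher_derivation_0[OF assms]\<close>)
  finally show ?thesis using False by simp
qed

text \<open>Scalars enter through a map \<kappa>, so that one lemma on divided powers serves the
  monoid algebras as well as the Laurent and power series over them.\<close>

definition scalar_embedding :: "(complex \<Rightarrow> 'a::comm_ring_1) \<Rightarrow> bool" where
  "scalar_embedding \<kappa> \<longleftrightarrow> \<kappa> 1 = 1 \<and> additive \<kappa> \<and> (\<forall>a b. \<kappa> (a * b) = \<kappa> a * \<kappa> b)"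

lemma scalar_embedding_of_nat: "scalar_embedding \<kappa> \<Longrightarrow> \<kappa> (of_nat n) = of_nat n"
  by (induction n) (auto simp: scalar_embedding_def additive.add additive_0)

definition derivation :: "(complex \<Rightarrow> 'a::comm_ring_1) \<Rightarrow> ('a \<Rightarrow> 'a) \<Rightarrow> bool" where
  "derivation \<kappa> d \<longleftrightarrow> additive d \<and> (\<forall>x y. d (x * y) = d x * y + x * d y) \<and> (\<forall>c. d (\<kappa> c) = 0)"

lemma derivation_funpow_additive: "derivation \<kappa> d \<Longrightarrow> additive (d ^^ n)"
  by (induction n) (auto simp: derivation_def additive_def)

lemma derivation_scale: "derivation \<kappa> d \<Longrightarrow> d (\<kappa> c * x) = \<kappa> c * d x"
  by (simp add: derivation_def)

lemma derivation_funpow_scale: "derivation \<kappa> d \<Longrightarrow> (d ^^ n) (\<kappa> c * x) = \<kappa> c * (d ^^ n) x"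
  by (induction n) (auto simp: derivation_scale)

text \<open>Induction on n: applying d to the Leibniz rule of order n raises one of the two orders
  and multiplies by the new order. The term of orders i and n + 1 - i thus receives the weight i +
  (n + 1 - i) = n + 1, which is invertible.\<close>

lemma higher_derivation_powers:
  assumes \<kappa>: "scalar_embedding \<kappa>" and d: "derivation \<kappa> d"
  shows "higher_derivation (\<lambda>n x. \<kappa> (1 / fact n) * (d ^^ n) x)" (is "higher_derivation ?\<delta>")
proof -
  have k1: "\<kappa> 1 = 1" and km: "\<kappa> (a * b) = \<kappa> a * \<kappa> b" for a b
    using \<kappa> by (auto simp: scalar_embedding_def)
  have step: "d (?\<delta> n x) = of_nat (Suc n) * ?\<delta> (Suc n) x" for n x
  proof -
    have "of_nat (Suc n) * \<kappa> (1 / fact (Suc n)) = \<kappa> (1 / fact n)"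
      unfolding scalar_embedding_of_nat[OF \<kappa>, symmetric] km[symmetric]
      by (simp add: field_simps del: of_nat_Suc)
    then show ?thesis by (simp add: derivation_scale[OF d] mult.assoc[symmetric])
  qed
  have inj: "x = y" if "of_nat (Suc n) * x = of_nat (Suc n) * y" for n and x y :: 'a
  proof -
    have "\<kappa> (1 / of_nat (Suc n)) * (of_nat (Suc n) * z) = z" for z :: 'a
      unfolding scalar_embedding_of_nat[OF \<kappa>, symmetric] mult.assoc[symmetric] km[symmetric]
      by (simp add: k1 del: of_nat_Suc)
    then show ?thesis using that by metis
  qed
  have add: "additive (?\<delta> n)" for n
    using derivation_funpow_additive[OF d, of n] by (simp add: additive_def distrib_left)
  have leib: "?\<delta> n (x * y) = (\<Sum>i\<le>n. ?\<delta> i x * ?\<delta> (n - i) y)" for n x y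
  proof (induction n)
    case 0
    then show ?case by (simp add: k1)
  next
    case (Suc n)
    have dadd: "additive d" using d by (simp add: derivation_def)
    let ?A = "\<lambda>i. ?\<delta> i x" and ?B = "\<lambda>i. ?\<delta> i y"
    have "of_nat (Suc n) * ?\<delta> (Suc n) (x * y) = d (\<Sum>i\<le>n. ?A i * ?B (n - i))"
      by (simp only: step[symmetric] Suc.IH)
    also have "\<dots> = (\<Sum>i\<le>n. d (?A i) * ?B (n - i) + ?A i * d (?B (n - i)))"
      using d by (simp add: additive.sum[OF dadd] derivation_def)
    also have "\<dots> = (\<Sum>i\<le>n. of_nat (Suc i) * (?A (Suc i) * ?B (n - i)))
        + (\<Sum>i\<le>n. of_nat (Suc (n - i)) * (?A i * ?B (Suc (n - i))))"
      unfolding sum.distrib step by (simp add: ac_simps)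
    also have "(\<Sum>i\<le>n. of_nat (Suc i) * (?A (Suc i) * ?B (n - i))) = (\<Sum>i\<le>Suc n. of_nat i * (?A i * ?B (Suc n - i)))"
      by (simp add: sum.atMost_Suc_shift del: sum.atMost_Suc of_nat_Suc)
    also have "(\<Sum>i\<le>n. of_nat (Suc (n - i)) * (?A i * ?B (Suc (n - i)))) = (\<Sum>i\<le>Suc n. of_nat (Suc n - i) * (?A i * ?B (Suc n - i)))"
      by (simp add: Suc_diff_le del: of_nat_Suc of_nat_diff fact_Suc funpow.simps)
    also have "(\<Sum>i\<le>Suc n. of_nat i * (?A i * ?B (Suc n - i))) + \<dots> = of_nat (Suc n) * (\<Sum>i\<le>Suc n. ?A i * ?B (Suc n - i))"
      unfolding sum.distrib[symmetric] sum_distrib_left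
      by (intro sum.cong refl) (simp add: distrib_right[symmetric] of_nat_add[symmetric] del: of_nat_Suc of_nat_add)
    finally show ?case by (rule inj)
  qed
  show ?thesis unfolding higher_derivation_def using add leib by (auto simp: k1)
qed

subsection \<open>Series in two variables\<close>

text \<open>A series that is bounded below in both variables has an expansion in \<open>K((x))((y))\<close> and one
  in \<open>K((y))((x))\<close>; the following relates them.\<close>

definition same_series :: "'a::comm_ring_1 fls fls \<Rightarrow> 'a fls fls \<Rightarrow> bool" where
  "same_series F G \<longleftrightarrow> (\<forall>a b. F $$ b $$ a = G $$ a $$ b)"

text \<open>Agreement of the two expansions makes each series bounded below uniformly in both
  variables. A coefficient of the product is then a finite double sum, whose order can be
  exchanged.\<close>

lemma same_series_mult:
  assumes 1: "same_series F1 G1" and 2: "same_series F2 G2"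
  shows "same_series (F1 * F2) (G1 * G2)"
  unfolding same_series_def
proof (intro allI)
  fix a b
  obtain N1 where N1: "\<And>n. n<N1 \<Longrightarrow> F1 $$ n = 0" by (rule fls_nth_vanishes_belowE) blast
  obtain N2 where N2: "\<And>n. n<N2 \<Longrightarrow> F2 $$ n = 0" by (rule fls_nth_vanishes_belowE) blast
  obtain M1 where M1: "\<And>n. n<M1 \<Longrightarrow> G1 $$ n = 0" by (rule fls_nth_vanishes_belowE) blast
  obtain M2 where M2: "\<And>n. n<M2 \<Longrightarrow> G2 $$ n = 0" by (rule fls_nth_vanishes_belowE) blast
  have [simp]: "F1 $$ i $$ j = G1 $$ j $$ i" "F2 $$ i $$ j = G2 $$ j $$ i" for i j
    using 1 2 by (simp_all add: same_series_def)
  have z: "G1 $$ j $$ i = 0" if "i < N1" for i j using N1[OF that] 1 by (metis same_series_def fls_zero_nth)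
  have z': "G2 $$ j $$ i = 0" if "i < N2" for i j using N2[OF that] 2 by (metis same_series_def fls_zero_nth)
  have "(F1 * F2) $$ b $$ a = (\<Sum>i=N1..b - N2. \<Sum>j=M1..a - M2. G1 $$ j $$ i * G2 $$ (a - j) $$ (b - i))"
    by (subst fls_times_nth_bounds[of N1 _ N2]) (auto simp: N1 N2 M1 M2 fls_sum_nth fls_times_nth_bounds[of M1 _ M2])
  also have "\<dots> = (\<Sum>j=M1..a - M2. \<Sum>i=N1..b - N2. G1 $$ j $$ i * G2 $$ (a - j) $$ (b - i))"
    by (rule sum.swap)
  also have "\<dots> = (G1 * G2) $$ a $$ b"
    by (subst fls_times_nth_bounds[of M1 _ M2]) (auto simp: M1 M2 z z' fls_sum_nth fls_times_nth_bounds[of N1 _ N2])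
  finally show "(F1 * F2) $$ b $$ a = (G1 * G2) $$ a $$ b" .
qed

lemma same_series_add: "same_series F1 G1 \<Longrightarrow> same_series F2 G2 \<Longrightarrow> same_series (F1 + F2) (G1 + G2)"
  by (simp add: same_series_def)

lemma same_series_1: "same_series 1 1"
  by (simp add: same_series_def)

lemma same_series_power: "same_series F G \<Longrightarrow> same_series (F ^ n) (G ^ n)"
  by (induction n) (auto intro: same_series_mult same_series_1)

text \<open>The inner plus the outer variable. By symmetry one element represents x0 + x2 both in
  K((x0))((x2)) and in K((x2))((x0)).\<close>

definition two_var_sum :: "'a::comm_ring_1 fls fls" where
  "two_var_sum = fls_const fls_X + fls_X"

lemma same_series_two_var_sum: "same_series two_var_sum two_var_sum"
  by (auto simp: same_series_def two_var_sum_def)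

lemma two_var_sum_mult_nth:
  "(two_var_sum * F) $$ b $$ a = F $$ b $$ (a - 1) + F $$ (b - 1) $$ a"
  by (simp add: two_var_sum_def distrib_right fls_X_times_conv_shift)

subsection \<open>Weak associativity as an identity of Laurent series\<close>

abbreviation scalar :: "complex \<Rightarrow> 'x::comm_monoid_add vec" where
  "scalar c \<equiv> Poly_Mapping.single 0 c"

lemma cscale_conv_mult: "cscale c p = scalar c * p"
  unfolding cscale_def by (rule mult_map_scale_conv_mult)

lemma scalar_embedding_scalar: "scalar_embedding scalar"
  by (simp add: scalar_embedding_def additive_def single_add mult_single)

lemma scalar_embedding_fls_const: "scalar_embedding (\<lambda>c. fls_const (scalar c))"
  by (simp add: scalar_embedding_def additive_def single_add mult_single fls_eq_iff)

lemma of_int_mult_conv_cscale: "of_int k * p = cscale (of_int k) (p :: 'x::comm_monoid_add \<Rightarrow>\<^sub>0 complex)"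
proof -
  have "(of_int k :: 'x \<Rightarrow>\<^sub>0 complex) = scalar (of_int k)"
    by (cases k) (simp_all only: of_int_of_nat_eq of_int_minus single_of_nat single_uminus)
  then show ?thesis by (simp add: cscale_conv_mult)
qed

lemma fls_const_scalar_nth [simp]: "(fls_const (scalar c) * f) $$ n = cscale c (f $$ n)"
  by (simp add: cscale_conv_mult)

definition div_deriv :: "nat \<Rightarrow> 'x::comm_monoid_add vec fls \<Rightarrow> 'x vec fls" where
  "div_deriv n f = fls_const (scalar (1 / fact n)) * (fls_deriv ^^ n) f"

lemma derivation_fls_deriv: "derivation (\<lambda>c. fls_const (scalar c)) fls_deriv"
  by (simp add: derivation_def additive_def mult.commute)

lemma higher_derivation_div_deriv: "higher_derivation div_deriv"
  unfolding div_deriv_def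
  by (rule higher_derivation_powers[OF scalar_embedding_fls_const derivation_fls_deriv])

lemma fls_deriv_funpow_nth:
  fixes f :: "'x::comm_monoid_add vec fls"
  shows "(fls_deriv ^^ n) f $$ a = cscale (pochhammer (of_int a + 1) n) (f $$ (a + int n))"
proof (induction n arbitrary: a)
  case (Suc n)
  have "(fls_deriv ^^ Suc n) f $$ a = cscale (of_int (a + 1)) ((fls_deriv ^^ n) f $$ (a + 1))"
    by (simp only: funpow.simps o_apply fls_deriv_nth of_int_mult_conv_cscale)
  then show ?case by (simp add: Suc pochhammer_rec algebra_simps)
qed simp

lemma div_deriv_nth:
  "div_deriv n f $$ a = cscale (of_int (a + int n) gchoose n) (f $$ (a + int n))"
  by (simp add: div_deriv_def fls_deriv_funpow_nth gbinomial_pochhammer' add.commute flip: cscale_conv_mult)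

text \<open>Taylor's formula: the exponential of x2 d/dx1 replaces x1 by x1 + x2 and expands in
  nonnegative powers of x2. This makes the substitution a ring homomorphism by
  \<open>fls_exp_mult\<close>.\<close>

lemma subst_add_conv_fls_exp:
  "subst_add cscale (\<lambda>a b. F $$ b $$ a) a b = fls_exp div_deriv F $$ b $$ a"
proof -
  obtain N where N: "\<And>n. n<N \<Longrightarrow> F $$ n = 0" by (rule fls_nth_vanishes_belowE) blast
  \<comment> \<open>For j > K the exponent b - j lies below the bound N, so the sum over all j is
    finite.\<close>
  define K where "K = nat (b - N)"
  have "subst_add cscale (\<lambda>a b. F $$ b $$ a) a b
      = (\<Sum>j\<le>K. cscale (of_int (a + int j) gchoose j) (F $$ (b - int j) $$ (a + int j)))"
    unfolding subst_add_def
  proof (rule Sum_any.expand_superset)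
    have "F $$ (b - int j) = 0" if "\<not> j \<le> K" for j
      using that by (intro N) (auto simp: K_def)
    then show "{j. cscale (of_int (a + int j) gchoose j) (F $$ (b - int j) $$ (a + int j)) \<noteq> 0} \<subseteq> {..K}"
      by (auto, metis cvec.scale_zero_right fls_zero_nth)
  qed simp
  also have "\<dots> = fls_exp div_deriv F $$ b $$ a"
    by (subst fls_exp_nth'[OF higher_derivation_div_deriv N, where K = K])
      (auto simp: K_def fls_sum_nth div_deriv_nth)
  finally show ?thesis .
qed

lemma mult_binomial_0 [simp]: "mult_binomial cscale 1 0 F = F"
  by (intro ext) (simp add: mult_binomial_def)

text \<open>Pascal's rule. It peels off one factor x0 + x2, which reduces facts about all powers to
  inductions on l.\<close>

lemma mult_binomial_Suc:
  "mult_binomial cscale 1 (Suc l) F a b =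
     mult_binomial cscale 1 l F (a - 1) b + mult_binomial cscale 1 l F a (b - 1)"
proof -
  define f where "f i = F (a - (int (Suc l) - int i)) (b - int i)" for i
  have mb: "mult_binomial cscale 1 k F c d =
      (\<Sum>i\<le>k. cscale (of_nat (k choose i)) (F (c - (int k - int i)) (d - int i)))" for k c d
    unfolding mult_binomial_def by (intro sum.cong refl) (simp add: of_nat_diff)
  have "mult_binomial cscale 1 (Suc l) F a b = (\<Sum>i\<le>Suc l. cscale (of_nat (Suc l choose i)) (f i))"
    by (simp only: mb f_def)
  also have "\<dots> = f 0 + (\<Sum>i\<le>l. cscale (of_nat (l choose Suc i)) (f (Suc i)))
       + (\<Sum>i\<le>l. cscale (of_nat (l choose i)) (f (Suc i)))"
    by (simp add: sum.atMost_Suc_shift cvec.scale_left_distrib sum.distrib algebra_simps del: sum.atMost_Suc)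
  also have "f 0 + (\<Sum>i\<le>l. cscale (of_nat (l choose Suc i)) (f (Suc i)))
      = (\<Sum>i\<le>Suc l. cscale (of_nat (l choose i)) (f i))"
    by (simp add: sum.atMost_Suc_shift del: sum.atMost_Suc)
  also have "\<dots> = mult_binomial cscale 1 l F (a - 1) b"
    by (simp add: mb f_def algebra_simps)
  also have "(\<Sum>i\<le>l. cscale (of_nat (l choose i)) (f (Suc i))) = mult_binomial cscale 1 l F a (b - 1)"
    by (simp add: mb f_def algebra_simps)
  finally show ?thesis .
qed

lemma mult_binomial_conv_power:
  "mult_binomial cscale 1 l (\<lambda>a b. F $$ b $$ a) a b = (two_var_sum ^ l * F) $$ b $$ a"
  "mult_binomial cscale 1 l (\<lambda>a b. F $$ a $$ b) a b = (two_var_sum ^ l * F) $$ a $$ b"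
  by (induction l arbitrary: a b)
    (simp_all add: mult_binomial_Suc mult.assoc two_var_sum_mult_nth add.commute)

text \<open>\<open>F\<close> is a series \<open>F(x1,x2)\<close> in \<open>K((x1))((x2))\<close> and \<open>G\<close> a series
  \<open>G(x0,x2)\<close> in \<open>K((x2))((x0))\<close>; the condition is \<open>(x0+x2)^l F(x0+x2,x2) = (x0+x2)^l G(x0,x2)\<close>.\<close>

definition weakly_assoc ::
  "'x::comm_monoid_add vec fls fls \<Rightarrow> 'x vec fls fls \<Rightarrow> bool" where
  "weakly_assoc F G \<longleftrightarrow>
     (\<exists>l. same_series (two_var_sum ^ l * fls_exp div_deriv F) (two_var_sum ^ l * G))"

lemma weakly_assoc_iff:
  "weakly_assoc F G \<longleftrightarrow> (\<exists>l. mult_binomial cscale 1 l (subst_add cscale (\<lambda>a b. F $$ b $$ a))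
     = mult_binomial cscale 1 l (\<lambda>a b. G $$ a $$ b))"
proof -
  have sub: "subst_add cscale (\<lambda>a b. F $$ b $$ a) = (\<lambda>a b. fls_exp div_deriv F $$ b $$ a)"
    by (intro ext) (rule subst_add_conv_fls_exp)
  show ?thesis
    unfolding weakly_assoc_def same_series_def sub by (simp add: fun_eq_iff mult_binomial_conv_power)
qed

lemma same_series_power_mono:
  assumes "same_series (two_var_sum ^ l * F) (two_var_sum ^ l * G)" "l \<le> k"
  shows "same_series (two_var_sum ^ k * F) (two_var_sum ^ k * G)"
proof -
  have "k = (k - l) + l" using assms(2) by simp
  then have "two_var_sum ^ k * H = two_var_sum ^ (k - l) * (two_var_sum ^ l * H)"
    for H :: "'a fls fls" by (metis mult.assoc power_add)
  then show ?thesis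
    using same_series_mult[OF same_series_power[OF same_series_two_var_sum] assms(1)] by metis
qed

lemma weakly_assoc_add:
  assumes "weakly_assoc F G" "weakly_assoc F' G'"
  shows "weakly_assoc (F + F') (G + G')"
proof -
  obtain l where l: "same_series (two_var_sum ^ l * fls_exp div_deriv F) (two_var_sum ^ l * G)"
    using assms(1) weakly_assoc_def by blast
  obtain k where k: "same_series (two_var_sum ^ k * fls_exp div_deriv F') (two_var_sum ^ k * G')"
    using assms(2) weakly_assoc_def by blast
  have "same_series (two_var_sum ^ max l k * fls_exp div_deriv (F + F')) (two_var_sum ^ max l k * (G + G'))"
    using same_series_add[OF same_series_power_mono[OF l, of "max l k"] same_series_power_mono[OF k, of "max l k"]]
    by (simp add: fls_exp_add[OF higher_derivation_div_deriv] distrib_left)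
  then show ?thesis unfolding weakly_assoc_def ..
qed

text \<open>The substitution x1 = x0 + x2 is multiplicative, so a factor that matches exactly,
  before any multiplication by x0 + x2, can be put in front of both sides.\<close>

lemma weakly_assoc_mult:
  assumes "same_series (fls_exp div_deriv C) C'" "weakly_assoc F G"
  shows "weakly_assoc (C * F) (C' * G)"
proof -
  obtain l where l: "same_series (two_var_sum ^ l * fls_exp div_deriv F) (two_var_sum ^ l * G)"
    using assms(2) weakly_assoc_def by blast
  have "same_series (two_var_sum ^ l * fls_exp div_deriv (C * F)) (two_var_sum ^ l * (C' * G))"
    using same_series_mult[OF assms(1) l]
    by (simp add: fls_exp_mult[OF higher_derivation_div_deriv] ac_simps)
  then show ?thesis unfolding weakly_assoc_def ..
qed

lemma weakly_assoc_0: "weakly_assoc 0 0"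
proof -
  have "fls_exp div_deriv (0 :: 'a vec fls fls) = 0"
    by (rule fls_eqI) (use fls_exp_nth_eq_0[OF higher_derivation_div_deriv, of "n + 1" 0 n for n] in simp)
  then show ?thesis by (simp add: weakly_assoc_def same_series_def)
qed

lemma weakly_assoc_sum:
  "(\<And>x. x \<in> A \<Longrightarrow> weakly_assoc (F x) (G x)) \<Longrightarrow> weakly_assoc (sum F A) (sum G A)"
  by (induction A rule: infinite_finite_induct) (auto intro: weakly_assoc_0 weakly_assoc_add)

lemma div_deriv_const_nth: "div_deriv n (fls_const c) = (if n = 0 then fls_const c else 0)"
proof -
  have "(fls_deriv ^^ n) (fls_const c) = (if n = 0 then fls_const c else 0)"
    by (induction n) auto
  then show ?thesis by (simp add: div_deriv_def)
qed

lemma weakly_assoc_scale: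
  assumes "weakly_assoc F G"
  shows "weakly_assoc (fls_const (fls_const (scalar c)) * F) (fls_const (fls_const (scalar c)) * G)"
proof (rule weakly_assoc_mult[OF _ assms])
  show "same_series (fls_exp div_deriv (fls_const (fls_const (scalar c)))) (fls_const (fls_const (scalar c)))"
    by (auto simp: same_series_def fls_exp_const[OF higher_derivation_div_deriv] div_deriv_const_nth)
qed

definition clinear :: "('x vec \<Rightarrow> 'y vec) \<Rightarrow> bool" where
  "clinear L \<longleftrightarrow> additive L \<and> (\<forall>c p. L (cscale c p) = cscale c (L p))"

lemma clinear_additive: "clinear L \<Longrightarrow> additive L"
  by (simp add: clinear_def)

lemma weakly_assoc_map:
  fixes L :: "'x::comm_monoid_add vec \<Rightarrow> 'y::comm_monoid_add vec"
  assumes L: "clinear L" and "weakly_assoc F G"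
  shows "weakly_assoc (fls_map (fls_map L) F) (fls_map (fls_map L) G)"
proof -
  obtain l where l: "same_series (two_var_sum ^ l * fls_exp div_deriv F) (two_var_sum ^ l * G)"
    using assms(2) weakly_assoc_def by blast
  let ?L = "fls_map (fls_map L)"
  have add: "additive L" using clinear_additive[OF L] .
  have z: "fls_map L 0 = 0" by (rule additive_0[OF additive_fls_map[OF add]])
  have nth: "?L H $$ i $$ j = L (H $$ i $$ j)" for H i j
    by (simp add: z additive_0[OF add])
  have p: "two_var_sum ^ l * ?L H = ?L (two_var_sum ^ l * H)" for H
  proof (induction l arbitrary: H)
    case (Suc k)
    have "two_var_sum * ?L H = ?L (two_var_sum * H)"
      by (intro fls_eqI) (simp add: two_var_sum_mult_nth nth additive.add[OF add])
    then show ?case by (simp only: power_Suc2 mult.assoc Suc)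
  qed simp
  have e: "fls_exp div_deriv (?L F) = ?L (fls_exp div_deriv F)"
  proof (intro fls_eqI)
    fix b a
    obtain N where N: "\<And>n. n<N \<Longrightarrow> F $$ n = 0" by (rule fls_nth_vanishes_belowE) blast
    show "fls_exp div_deriv (?L F) $$ b $$ a = ?L (fls_exp div_deriv F) $$ b $$ a"
      using L by (subst fls_exp_nth[OF higher_derivation_div_deriv, of N])
        (auto simp: N z nth fls_exp_nth[OF higher_derivation_div_deriv, of N] fls_sum_nth
          div_deriv_nth clinear_def additive.sum[OF add] additive_0[OF add])
  qed
  have "same_series (two_var_sum ^ l * fls_exp div_deriv (?L F)) (two_var_sum ^ l * ?L G)"
    using l unfolding e p by (simp add: same_series_def nth)
  then show ?thesis unfolding weakly_assoc_def ..
qed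

text \<open>The factor \<open>(x0+x2)^l\<close> can be cancelled on series that are bounded below in \<open>x0\<close>.\<close>

lemma mult_binomial_closed:
  assumes S: "cvec.subspace S" and G: "\<And>a b. a < N \<Longrightarrow> G a b = 0"
    and m: "\<And>a b. mult_binomial cscale 1 l G a b \<in> S"
  shows "G a b \<in> S"
  using m
proof (induction l arbitrary: a b)
  case (Suc l)
  let ?H = "mult_binomial cscale 1 l G"
  have H0: "?H a b = 0" if "a < N" for a b
    using that G unfolding mult_binomial_def by (intro sum.neutral) simp
  have "?H a b \<in> S" for a b
  proof (cases "a < N")
    case True
    then show ?thesis using H0 cvec.subspace_0[OF S] by simp
  next
    case False
    then have "N \<le> a" by simp
    \<comment> \<open>Upwards in a, for all b at once: the coefficient at (a + 1, b + 1) is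
      \<open>?H a (b + 1) + ?H (a + 1) b\<close>, and its first summand is already known to lie in
      S. The start works because \<open>?H\<close> vanishes at N - 1.\<close>
    then show ?thesis
    proof (induction a arbitrary: b rule: int_ge_induct)
      case base
      have "?H (N - 1) (b + 1) + ?H N b \<in> S"
        using Suc.prems[of N "b + 1"] by (simp only: mult_binomial_Suc) simp
      then show ?case by (simp add: H0)
    next
      case (step a)
      have "?H a (b + 1) + ?H (a + 1) b \<in> S"
        using Suc.prems[of "a + 1" "b + 1"] by (simp only: mult_binomial_Suc) simp
      with step.IH[of "b + 1"] show ?case
        using cvec.subspace_diff[OF S] by (metis add_diff_cancel_left')
    qed
  qed
  then show ?case by (rule Suc.IH)
qed simp

lemma mult_binomial_mono:
  assumes "mult_binomial cscale 1 l F = mult_binomial cscale 1 l G" "l \<le> k"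
  shows "mult_binomial cscale 1 k F = mult_binomial cscale 1 k G"
  using assms(2) by (induction rule: dec_induct) (simp_all add: assms(1) mult_binomial_Suc fun_eq_iff)

lemma mult_binomial_diff:
  "mult_binomial cscale 1 l (\<lambda>a b. F a b - G a b) a b =
     mult_binomial cscale 1 l F a b - mult_binomial cscale 1 l G a b"
  by (induction l arbitrary: a b) (simp_all add: mult_binomial_Suc)

subsection \<open>Weak associativity from a homomorphism into Laurent series\<close>

definition divided_power ::
  "('x::comm_monoid_add vec \<Rightarrow> 'x vec) \<Rightarrow> nat \<Rightarrow> 'x vec \<Rightarrow> 'x vec" where
  "divided_power d n p = scalar (1 / fact n) * (d ^^ n) p"

text \<open>\<open>e^(x d) p\<close>\<close>

definition exp_series ::
  "('x::comm_monoid_add vec \<Rightarrow> 'x vec) \<Rightarrow> 'x vec \<Rightarrow> 'x vec fls" where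
  "exp_series d p = fls_exp (divided_power d) (fls_const p)"

locale differential_algebra =
  fixes d :: "'x::comm_monoid_add vec \<Rightarrow> 'x vec"
  assumes derivation: "derivation scalar d"
begin

lemma higher_derivation: "higher_derivation (divided_power d)"
  unfolding divided_power_def
  by (rule higher_derivation_powers[OF scalar_embedding_scalar derivation])

lemma divided_power_additive: "additive (divided_power d n)"
  by (rule higher_derivation_additive[OF higher_derivation])

lemma divided_power_zero [simp]: "divided_power d n 0 = 0"
  by (rule additive_0[OF divided_power_additive])

lemma exp_series_nth: "exp_series d p $$ n = (if n < 0 then 0 else divided_power d (nat n) p)"
  unfolding exp_series_def by (rule fls_exp_const[OF higher_derivation])

lemma exp_series_additive: "additive (exp_series d)"
  by (simp add: additive_def fls_eq_iff exp_series_nth additive.add[OF divided_power_additive])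

lemma exp_series_mult: "exp_series d (p * q) = exp_series d p * exp_series d q"
  by (simp add: exp_series_def fls_exp_mult[OF higher_derivation, symmetric] fls_const_mult_const)

lemma exp_series_zero [simp]: "exp_series d 0 = 0"
  by (rule additive_0[OF exp_series_additive])

lemma exp_series_scalar: "exp_series d (scalar c) = fls_const (scalar c)"
proof -
  have "(d ^^ n) (scalar c) = (if n = 0 then scalar c else 0)" for n
    using derivation by (induction n) (auto simp: derivation_def additive_0)
  then show ?thesis
    by (auto simp: fls_eq_iff exp_series_nth divided_power_def)
qed

lemma divided_power_comp:
  "divided_power d m (divided_power d n p) = cscale (of_nat (m + n) gchoose m) (divided_power d (m + n) p)"
proof -
  have "divided_power d m (divided_power d n p) = scalar (1 / fact m * (1 / fact n)) * (d ^^ (m + n)) p"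
    unfolding divided_power_def derivation_funpow_scale[OF derivation] funpow_add
    by (simp add: mult.assoc[symmetric] mult_single)
  also have "\<dots> = cscale (of_nat (m + n) gchoose m) (divided_power d (m + n) p)"
  proof -
    have "(of_nat (m + n) :: complex) gchoose m = fact (m + n) / (fact m * fact n)"
      using binomial_fact[of m "m + n", where 'a = complex] by (simp add: binomial_gbinomial)
    then show ?thesis
      by (simp add: cscale_conv_mult divided_power_def mult.assoc[symmetric] mult_single)
  qed
  finally show ?thesis .
qed

end

text \<open>\<open>\<phi>_deriv\<close> says [d, \<phi>(x)] = \<phi>'(x), the infinitesimal form of
  \<phi>(x) e^(y d) = e^(y d) \<phi>(x - y).\<close>

locale conformal_hom = differential_algebra d
  for d :: "'x::comm_monoid_add vec \<Rightarrow> 'x vec" +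
  fixes \<phi> :: "'x vec \<Rightarrow> 'x vec fls"
  assumes \<phi>_additive: "additive \<phi>"
    and \<phi>_mult: "\<phi> (p * q) = \<phi> p * \<phi> q"
    and \<phi>_scale: "\<phi> (scalar c * p) = fls_const (scalar c) * \<phi> p"
    and \<phi>_deriv: "fls_map d (\<phi> p) = \<phi> (d p) + fls_deriv (\<phi> p)"
begin

lemma d_additive: "additive d"
  using derivation by (simp add: derivation_def)

text \<open>These are the coefficients of y^n in e^(y d) \<phi>(x) p = \<phi>(x + y) e^(y d) p. As
  for the Leibniz rule, applying d to case n gives each term the weights i and n + 1 - i, which add
  up to n + 1.\<close>

lemma fls_map_divided_power:
  "fls_map (divided_power d n) (\<phi> p) = (\<Sum>i\<le>n. div_deriv i (\<phi> (divided_power d (n - i) p)))"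
proof (induction n)
  case 0
  then show ?case
    by (simp add: div_deriv_def divided_power_def fls_eq_iff)
next
  case (Suc n)
  have d0: "d 0 = 0" by (rule additive_0[OF d_additive])
  have comm: "fls_map d (div_deriv i f) = div_deriv i (fls_map d f)" for i f
    using derivation_scale[OF derivation]
    by (intro fls_eqI) (simp add: d0 div_deriv_nth cscale_conv_mult)
  have dd: "fls_deriv (div_deriv i f) = cs" if "cs = fls_const (scalar (of_nat (Suc i))) * div_deriv (Suc i) f" for i and f cs :: "'x vec fls"
  proof -
    have "(scalar (of_nat (Suc i)) * scalar (1 / fact (Suc i)) :: 'x \<Rightarrow>\<^sub>0 complex) = scalar (1 / fact i)"
      by (simp add: mult_single del: of_nat_Suc single_of_nat)
    then show ?thesis
      unfolding that div_deriv_def derivation_scale[OF derivation_fls_deriv] mult.assoc[symmetric] fls_const_mult_const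
      by (simp only: funpow.simps o_apply)
  qed
  have dp: "d (divided_power d i q) = scalar (of_nat (Suc i)) * divided_power d (Suc i) q" for i q
  proof -
    have "(scalar (of_nat (Suc i)) * scalar (1 / fact (Suc i)) :: 'x \<Rightarrow>\<^sub>0 complex) = scalar (1 / fact i)"
      by (simp add: mult_single del: of_nat_Suc single_of_nat)
    then show ?thesis
      unfolding divided_power_def derivation_scale[OF derivation] mult.assoc[symmetric]
      by (simp only: funpow.simps o_apply)
  qed
  have div_add: "additive (div_deriv i :: 'x vec fls \<Rightarrow> _)" for i
    by (rule higher_derivation_additive[OF higher_derivation_div_deriv])
  have div_deriv_d: "div_deriv i (fls_deriv f) = fls_deriv (div_deriv i f)" for i and f :: "'x vec fls"
    unfolding div_deriv_def derivation_scale[OF derivation_fls_deriv] by (simp add: funpow_swap1)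
  have div_scale: "div_deriv i (fls_const (scalar c) * f) = fls_const (scalar c) * div_deriv i f" for i c and f :: "'x vec fls"
    unfolding div_deriv_def derivation_funpow_scale[OF derivation_fls_deriv] by (simp add: ac_simps)
  let ?D = "\<lambda>i. divided_power d i p"
  let ?s = "\<lambda>i. fls_const (scalar (of_nat i)) :: 'x vec fls"
  have "?s (Suc n) * fls_map (divided_power d (Suc n)) (\<phi> p) = fls_map d (fls_map (divided_power d n) (\<phi> p))"
    by (intro fls_eqI) (simp add: d0 dp cscale_conv_mult)
  also have "\<dots> = (\<Sum>i\<le>n. div_deriv i (fls_map d (\<phi> (?D (n - i)))))"
    unfolding Suc by (simp add: fls_map_sum[OF d_additive] comm)
  also have "\<dots> = (\<Sum>i\<le>n. div_deriv i (\<phi> (d (?D (n - i))))) + (\<Sum>i\<le>n. fls_deriv (div_deriv i (\<phi> (?D (n - i)))))"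
    unfolding \<phi>_deriv by (simp add: additive.add[OF div_add] div_deriv_d sum.distrib)
  also have "(\<Sum>i\<le>n. div_deriv i (\<phi> (d (?D (n - i))))) = (\<Sum>i\<le>n. ?s (Suc (n - i)) * div_deriv i (\<phi> (?D (Suc (n - i)))))"
    by (simp only: dp \<phi>_scale div_scale)
  also have "\<dots> = (\<Sum>i\<le>Suc n. ?s (Suc n - i) * div_deriv i (\<phi> (?D (Suc n - i))))"
    by (simp add: Suc_diff_le del: of_nat_Suc of_nat_diff)
  also have "(\<Sum>i\<le>n. fls_deriv (div_deriv i (\<phi> (?D (n - i))))) = (\<Sum>i\<le>n. ?s (Suc i) * div_deriv (Suc i) (\<phi> (?D (n - i))))"
    by (intro sum.cong refl dd)
  also have "\<dots> = (\<Sum>i\<le>Suc n. ?s i * div_deriv i (\<phi> (?D (Suc n - i))))"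
    by (simp add: sum.atMost_Suc_shift del: sum.atMost_Suc of_nat_Suc)
  also have "(\<Sum>i\<le>Suc n. ?s (Suc n - i) * div_deriv i (\<phi> (?D (Suc n - i)))) + \<dots>
      = ?s (Suc n) * (\<Sum>i\<le>Suc n. div_deriv i (\<phi> (?D (Suc n - i))))"
  proof -
    have "?s (Suc n - i) + ?s i = ?s (Suc n)" if "i \<le> Suc n" for i
    proof -
      have "(of_nat (Suc n - i) + of_nat i :: 'x \<Rightarrow>\<^sub>0 complex) = of_nat (Suc n)"
        using that by (simp only: of_nat_add[symmetric] le_add_diff_inverse2)
      then show ?thesis by (simp add: fls_eq_iff del: of_nat_Suc of_nat_diff)
    qed
    then show ?thesis
      unfolding sum.distrib[symmetric] sum_distrib_left
      by (intro sum.cong refl) (simp add: distrib_right[symmetric] del: of_nat_Suc of_nat_diff)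
  qed
  finally have eq: "?s (Suc n) * fls_map (divided_power d (Suc n)) (\<phi> p)
      = ?s (Suc n) * (\<Sum>i\<le>Suc n. div_deriv i (\<phi> (?D (Suc n - i))))" .
  have "fls_const (scalar (1 / of_nat (Suc n))) * (?s (Suc n) * f) = f" for f
    by (simp add: mult.assoc[symmetric] fls_const_mult_const mult_single del: of_nat_Suc single_of_nat)
  with eq show ?case by metis
qed

text \<open>Setting x1 = x0 + x2 in \<phi>(x1) e^(x2 d) s gives e^(x2 d) \<phi>(x0) s by the
  commutation rule; b is the exponent of x2. The match is exact, as \<open>weakly_assoc_mult\<close>
  requires.\<close>

lemma fls_exp_shift:
  "fls_exp div_deriv (fls_map \<phi> (exp_series d s)) $$ b = (if b < 0 then 0 else fls_map (divided_power d (nat b)) (\<phi> s))"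
proof -
  have \<phi>0: "\<phi> 0 = 0" by (rule additive_0[OF \<phi>_additive])
  have z: "fls_map \<phi> (exp_series d s) $$ i = 0" if "i < 0" for i
    using that by (simp add: \<phi>0 exp_series_nth)
  show ?thesis
  proof (cases "b < 0")
    case True
    then show ?thesis using fls_exp_nth_eq_0[OF higher_derivation_div_deriv z] by simp
  next
    case False
    then have "fls_exp div_deriv (fls_map \<phi> (exp_series d s)) $$ b
        = (\<Sum>j\<le>nat b. div_deriv j (fls_map \<phi> (exp_series d s) $$ (b - int j)))"
      by (intro fls_exp_nth'[OF higher_derivation_div_deriv z]) auto
    also have "\<dots> = (\<Sum>j\<le>nat b. div_deriv j (\<phi> (divided_power d (nat b - j) s)))"
      by (intro sum.cong refl) (use False in \<open>auto simp: \<phi>0 exp_series_nth nat_diff_distrib\<close>)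
    finally show ?thesis using False by (simp add: fls_map_divided_power)
  qed
qed

text \<open>Both new factors match exactly after x1 = x0 + x2: e^(x1 d) P becomes e^(x2 d) e^(x0 d)
  P, and \<phi>(x1) e^(x2 d) s becomes e^(x2 d) \<phi>(x0) s. The power of x0 + x2 is that of the
  given pair.\<close>

lemma weakly_assoc_conformal:
  assumes "weakly_assoc (fls_map \<phi> M) R"
  shows "weakly_assoc (fls_const (exp_series d P) * fls_map \<phi> (exp_series d s * M))
     (fls_map (exp_series d) (exp_series d P * \<phi> s) * R)"
proof -
  have E: "same_series (fls_exp div_deriv (fls_const (exp_series d P))) (fls_map (exp_series d) (exp_series d P))"
    unfolding same_series_def
  proof (intro allI)
    fix a b
    show "fls_exp div_deriv (fls_const (exp_series d P)) $$ b $$ a = fls_map (exp_series d) (exp_series d P) $$ a $$ b"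
    proof (cases "a < 0 \<or> b < 0")
      case True
      show ?thesis
      proof (cases "b < 0")
        case False
        with True have a: "a < 0" by simp
        \<comment> \<open>The right side has no negative powers of x0. On the left the coefficient
          of e^(x1 d) P is 0 for a + b < 0, and for 0 \<le> a + b < b the binomial coefficient
          vanishes.\<close>
        have "(of_int (a + b) :: complex) gchoose nat b = 0" if "0 \<le> a + b"
        proof -
          have "nat (a + b) < nat b" using a False that by simp
          then have "(of_nat (nat (a + b)) :: complex) gchoose nat b = 0"
            by (simp add: binomial_gbinomial[symmetric])
          then show ?thesis using that by simp
        qed
        then show ?thesis using a False
          by (cases "0 \<le> a + b")
            (auto simp: fls_exp_const[OF higher_derivation_div_deriv] div_deriv_nth exp_series_nth)
      qed (simp add: fls_exp_const[OF higher_derivation_div_deriv] exp_series_nth)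
    next
      case False
      then have "nat (a + b) = nat b + nat a" "(of_int (a + b) :: complex) = of_nat (nat b + nat a)"
        by (auto simp: nat_add_distrib)
      then show ?thesis using False
        by (auto simp: fls_exp_const[OF higher_derivation_div_deriv] div_deriv_nth exp_series_nth divided_power_comp add.commute)
    qed
  qed
  have S: "same_series (fls_exp div_deriv (fls_map \<phi> (exp_series d s))) (fls_map (exp_series d) (\<phi> s))"
    unfolding same_series_def fls_exp_shift by (auto simp: exp_series_nth)
  have "weakly_assoc (fls_const (exp_series d P) * (fls_map \<phi> (exp_series d s) * fls_map \<phi> M))
     (fls_map (exp_series d) (exp_series d P) * (fls_map (exp_series d) (\<phi> s) * R))"
    by (intro weakly_assoc_mult E S assms)
  then show ?thesis
    by (simp add: fls_map_mult[OF \<phi>_additive \<phi>_mult] fls_map_mult[OF exp_series_additive exp_series_mult] mult.assoc)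
qed

end

subsection \<open>Tensor products of monoid algebras\<close>

lemma additive_eqI:
  assumes "additive f" "additive g" "\<And>x c. f (Poly_Mapping.single x c) = g (Poly_Mapping.single x c)"
  shows "f p = g (p :: 'x \<Rightarrow>\<^sub>0 complex)"
proof -
  have "f q = g q" if "q = (\<Sum>y\<in>Poly_Mapping.keys p. Poly_Mapping.single y (Poly_Mapping.lookup p y))" for q
    by (simp add: that additive.sum[OF assms(1)] additive.sum[OF assms(2)] assms(3))
  then show ?thesis using basis_expansion[of p] by simp
qed

lemma clinear_add: "clinear L \<Longrightarrow> L (p + q) = L p + L q"
  by (simp add: clinear_def additive.add)

lemma clinear_cscale: "clinear L \<Longrightarrow> L (cscale c p) = cscale c (L p)"
  by (simp add: clinear_def)

lemma clinear_zero: "clinear L \<Longrightarrow> L 0 = 0"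
  by (rule additive_0[OF clinear_additive])

lemma clinear_sum: "clinear L \<Longrightarrow> L (sum f A) = (\<Sum>x\<in>A. L (f x))"
  by (rule additive.sum[OF clinear_additive])

lemma clinear_lin_ext: "clinear (lin_ext f)"
  by (simp add: clinear_def additive_def lin_ext_add lin_ext_cscale)

lemma clinear_eqI:
  assumes "clinear f" "clinear g" "\<And>x. f (basis_vec x) = g (basis_vec x)"
  shows "f p = g p"
proof (rule additive_eqI[OF clinear_additive[OF assms(1)] clinear_additive[OF assms(2)]])
  fix x c
  show "f (Poly_Mapping.single x c) = g (Poly_Mapping.single x c)"
    using clinear_cscale[OF assms(1), of c "basis_vec x"] clinear_cscale[OF assms(2), of c "basis_vec x"] assms(3)
    by simp
qed

lemma clinear_eq_lin_ext: "clinear f \<Longrightarrow> f p = lin_ext (\<lambda>x. f (basis_vec x)) p"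
  by (rule clinear_eqI[OF _ clinear_lin_ext]) simp_all

lemma clinear_comp: "clinear f \<Longrightarrow> clinear g \<Longrightarrow> clinear (\<lambda>p. f (g p))"
  by (simp add: clinear_def additive_def)

lemma clinear_plus: "clinear f \<Longrightarrow> clinear g \<Longrightarrow> clinear (\<lambda>p. f p + g p)"
  by (simp add: clinear_def additive_def cvec.scale_right_distrib)

lemma clinear_id: "clinear (\<lambda>p. p)" "clinear id"
  by (simp_all add: clinear_def additive_def)

lemma cscale_mult_left: "cscale c p * q = cscale c (p * q)" for p q :: "'x::comm_monoid_add vec"
  by (simp add: cscale_conv_mult mult.assoc)

lemma cscale_mult_right: "p * cscale c q = cscale c (p * q)" for p q :: "'x::comm_monoid_add vec"
  by (simp add: cscale_conv_mult ac_simps)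

lemma clinear_mult_left: "clinear (\<lambda>p. q * p)" for q :: "'x::comm_monoid_add vec"
  by (simp add: clinear_def additive_def distrib_left cscale_mult_right)

lemma clinear_mult_right: "clinear (\<lambda>p. p * q)" for q :: "'x::comm_monoid_add vec"
  by (simp add: clinear_def additive_def distrib_right cscale_mult_left)

lemma tensor_single [simp]:
  "Poly_Mapping.single x a \<otimes> Poly_Mapping.single y b = Poly_Mapping.single (x, y) (a * b)"
  by (simp add: tensor_def)

lemma tensor_superset_left:
  assumes "finite S" "Poly_Mapping.keys p \<subseteq> S"
  shows "p \<otimes> q = (\<Sum>x\<in>S. \<Sum>y\<in>Poly_Mapping.keys q. Poly_Mapping.single (x, y) (Poly_Mapping.lookup p x * Poly_Mapping.lookup q y))"
  unfolding tensor_def by (rule sum.mono_neutral_left) (use assms in \<open>auto simp: in_keys_iff\<close>)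

lemma tensor_add_left: "(p + q) \<otimes> r = p \<otimes> r + q \<otimes> r"
proof -
  let ?S = "Poly_Mapping.keys p \<union> Poly_Mapping.keys q"
  have "Poly_Mapping.keys (p + q) \<subseteq> ?S" by (rule Poly_Mapping.keys_add)
  then show ?thesis
    by (simp add: tensor_superset_left[of ?S] lookup_add distrib_right single_add sum.distrib)
qed

lemma tensor_cscale_left: "cscale c p \<otimes> q = cscale c (p \<otimes> q)"
proof -
  have "Poly_Mapping.keys (cscale c p) \<subseteq> Poly_Mapping.keys p" by (auto simp: in_keys_iff)
  then show ?thesis
    by (simp add: tensor_superset_left[of "Poly_Mapping.keys p"] cvec.scale_sum_right mult_ac)
qed

lemma clinear_tensor_left: "clinear (\<lambda>p. p \<otimes> q)"
  by (simp add: clinear_def additive_def tensor_add_left tensor_cscale_left)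

lemma tensor_zero_left: "0 \<otimes> q = 0"
  by (rule clinear_zero[OF clinear_tensor_left])

lemma clinear_tensor_right: "clinear (\<lambda>q. p \<otimes> q)"
  by (simp add: clinear_def additive_def tensor_add_right tensor_cscale_right)

lemma tensor_zero_right: "p \<otimes> 0 = 0"
  by (rule clinear_zero[OF clinear_tensor_right])

text \<open>Both sides are linear in each argument, so the arguments are reduced to basis vectors
  one at a time. Later multilinear identities are proved by the same pattern.\<close>

lemma tensor_mult:
  fixes p p' :: "'x::comm_monoid_add vec" and q q' :: "'y::comm_monoid_add vec"
  shows "(p \<otimes> q) * (p' \<otimes> q') = (p * p') \<otimes> (q * q')"
proof -
  have 1: "(basis_vec x \<otimes> basis_vec y) * (basis_vec x' \<otimes> q') = (basis_vec x * basis_vec x') \<otimes> (basis_vec y * q')"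
    for x x' :: 'x and y :: 'y
    by (rule clinear_eqI[of _ _ q', OF clinear_comp[OF clinear_mult_left clinear_tensor_right]
            clinear_comp[OF clinear_tensor_right clinear_mult_left]])
      (simp add: mult_single)
  have 2: "(basis_vec x \<otimes> basis_vec y) * (p' \<otimes> q') = (basis_vec x * p') \<otimes> (basis_vec y * q')"
    for x :: 'x and y :: 'y
    by (rule clinear_eqI[of _ _ p', OF clinear_comp[OF clinear_mult_left clinear_tensor_left]
            clinear_comp[OF clinear_tensor_left clinear_mult_left]]) (rule 1)
  have 3: "(basis_vec x \<otimes> q) * (p' \<otimes> q') = (basis_vec x * p') \<otimes> (q * q')" for x :: 'x
    by (rule clinear_eqI[of _ _ q, OF clinear_comp[OF clinear_mult_right clinear_tensor_right]
            clinear_comp[OF clinear_tensor_right clinear_mult_right]]) (rule 2)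
  show ?thesis
    by (rule clinear_eqI[of _ _ p, OF clinear_comp[OF clinear_mult_right clinear_tensor_left]
            clinear_comp[OF clinear_tensor_left clinear_mult_right]]) (rule 3)
qed

lemma one_tensor_one: "(1 :: 'x::comm_monoid_add \<Rightarrow>\<^sub>0 complex) \<otimes> (1 :: 'y::comm_monoid_add \<Rightarrow>\<^sub>0 complex) = 1"
  by (simp add: single_one[symmetric] zero_prod_def del: single_one)

lemma clinear_tensor_op: "clinear (tensor_op f g)"
  unfolding tensor_op_def by (rule clinear_lin_ext)

lemma tensor_op_tensor:
  assumes f: "clinear f" and g: "clinear g"
  shows "tensor_op f g (p \<otimes> q) = f p \<otimes> g q"
proof -
  have 1: "tensor_op f g (basis_vec x \<otimes> q) = f (basis_vec x) \<otimes> g q" for x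
    by (rule clinear_eqI[of _ _ q, OF clinear_comp[OF clinear_tensor_op clinear_tensor_right]
            clinear_comp[OF clinear_tensor_right g]])
      (simp add: tensor_op_def)
  show ?thesis
    by (rule clinear_eqI[of _ _ p, OF clinear_comp[OF clinear_tensor_op clinear_tensor_left]
            clinear_comp[OF clinear_tensor_left f]]) (rule 1)
qed

lemma derivation_clinear: "derivation scalar d \<Longrightarrow> clinear d"
  using derivation_scale[of scalar d] by (simp add: clinear_def cscale_conv_mult derivation_def)

text \<open>The Leibniz rule extends bilinearly from basis vectors. At the unit it gives d 1 = d 1 +
  d 1, so d vanishes on scalars.\<close>

lemma derivationI:
  assumes d: "clinear d" and *: "\<And>x y. d (basis_vec x * basis_vec y) = d (basis_vec x) * basis_vec y + basis_vec x * d (basis_vec y)"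
  shows "derivation scalar (d :: 'x::comm_monoid_add vec \<Rightarrow> _)"
proof -
  have 1: "d (basis_vec x * q) = d (basis_vec x) * q + basis_vec x * d q" for x q
    by (rule clinear_eqI[of _ _ q, OF clinear_comp[OF d clinear_mult_left]
            clinear_plus[OF clinear_mult_left clinear_comp[OF clinear_mult_left d]]]) (rule *)
  have 2: "d (p * q) = d p * q + p * d q" for p q
    by (rule clinear_eqI[of _ _ p, OF clinear_comp[OF d clinear_mult_right]
            clinear_plus[OF clinear_comp[OF clinear_mult_right d] clinear_mult_right]]) (rule 1)
  have "d 1 = 0" using 2[of 1 1] by simp
  then have "d (scalar c) = 0" for c
    using clinear_cscale[OF d, of c 1] by (simp add: cscale_conv_mult)
  with 2 show ?thesis using clinear_additive[OF d] by (simp add: derivation_def)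
qed

lemma derivation_mult: "derivation \<kappa> d \<Longrightarrow> d (x * y) = d x * y + x * d y"
  and derivation_scalar: "derivation \<kappa> d \<Longrightarrow> d (\<kappa> c) = 0"
  and derivation_add: "derivation \<kappa> d \<Longrightarrow> d (x + y) = d x + d y"
  by (simp_all add: derivation_def additive.add)

lemma derivation_plus: "derivation \<kappa> d \<Longrightarrow> derivation \<kappa> d' \<Longrightarrow> derivation \<kappa> (\<lambda>p. d p + d' p)"
  by (simp add: derivation_def additive_def algebra_simps)

lemma derivation_tensor_op_right:
  fixes d :: "'y::comm_monoid_add vec \<Rightarrow> 'y vec"
  assumes "derivation scalar d"
  shows "derivation scalar (tensor_op (id :: 'x::comm_monoid_add vec \<Rightarrow> _) d)"
proof (rule derivationI[OF clinear_tensor_op])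
  fix x y :: "'x \<times> 'y"
  have b: "basis_vec z = basis_vec (fst z) \<otimes> basis_vec (snd z)" for z :: "'x \<times> 'y" by simp
  show "tensor_op id d (basis_vec x * basis_vec y) = tensor_op id d (basis_vec x) * basis_vec y + basis_vec x * tensor_op id d (basis_vec y)"
    using assms unfolding b tensor_mult tensor_op_tensor[OF clinear_id(2) derivation_clinear[OF assms]]
    by (simp add: derivation_def tensor_add_right del: tensor_single)
qed

lemma derivation_tensor_op_left:
  fixes d :: "'y::comm_monoid_add vec \<Rightarrow> 'y vec"
  assumes "derivation scalar d"
  shows "derivation scalar (tensor_op d (id :: 'x::comm_monoid_add vec \<Rightarrow> _))"
proof (rule derivationI[OF clinear_tensor_op])
  fix x y :: "'y \<times> 'x"
  have b: "basis_vec z = basis_vec (fst z) \<otimes> basis_vec (snd z)" for z :: "'y \<times> 'x" by simp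
  show "tensor_op d id (basis_vec x * basis_vec y) = tensor_op d id (basis_vec x) * basis_vec y + basis_vec x * tensor_op d id (basis_vec y)"
    using assms unfolding b tensor_mult tensor_op_tensor[OF derivation_clinear[OF assms] clinear_id(2)]
    by (simp add: derivation_def tensor_add_left del: tensor_single)
qed

subsection \<open>The derivations of \<open>B\<^sub>h\<close> and \<open>B\<^sub>L\<close>\<close>

lemma Rep_Abs_mon_single: "z \<in> zbasis \<times> {1..} \<Longrightarrow> Rep_mon (Abs_mon {#z#}) = {#z#}"
  by (rule Abs_mon_inverse) simp

lemma Rep_Abs_mon_diff: "Rep_mon (Abs_mon (Rep_mon m - {#z#})) = Rep_mon m - {#z#}"
  using Rep_mon[of m] by (intro Abs_mon_inverse) (auto dest: in_diffD)

lemma mon_induct [case_names zero add]: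
  assumes "P 0" "\<And>z m. z \<in> zbasis \<times> {1..} \<Longrightarrow> P m \<Longrightarrow> P (Abs_mon {#z#} + m)"
  shows "P m"
proof -
  have "\<forall>m. Rep_mon m = M \<longrightarrow> P m" for M
  proof (induction M)
    case empty
    have "m = 0" if "Rep_mon m = {#}" for m :: "'a mon"
      using that by (simp add: Rep_mon_inject[symmetric] zero_mon.rep_eq)
    then show ?case using assms(1) by auto
  next
    case (add z M)
    show ?case
    proof (intro allI impI)
      fix m :: "'a mon" assume m: "Rep_mon m = add_mset z M"
      let ?m = "Abs_mon (Rep_mon m - {#z#})"
      have z: "z \<in> zbasis \<times> {1..}" using Rep_mon[of m] m by auto
      have "Rep_mon ?m = M" by (simp only: Rep_Abs_mon_diff) (simp add: m)
      moreover from this have "m = Abs_mon {#z#} + ?m"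
        by (simp add: Rep_mon_inject[symmetric] plus_mon.rep_eq Rep_Abs_mon_single[OF z] m)
      ultimately show "P m" using add assms(2)[OF z] by metis
    qed
  qed
  then show ?thesis by blast
qed

lemma derivation_ext_basis:
  "derivation_ext g (basis_vec m) = (\<Sum>z\<in>#Rep_mon m. g z * basis_vec (Abs_mon (Rep_mon m - {#z#})))"
  by (simp add: derivation_ext_def)

text \<open>The variables of a product are those of x together with those of y, counted with
  multiplicity, and deleting one that occurs in x leaves the other factor y untouched.\<close>

lemma derivation_derivation_ext: "derivation scalar (derivation_ext g)"
proof (rule derivationI)
  show "clinear (derivation_ext g)" unfolding derivation_ext_def by (rule clinear_lin_ext)
  fix x y :: "'a mon"
  have "Abs_mon (Rep_mon (x + y) - {#z#}) = Abs_mon (Rep_mon x - {#z#}) + y" if "z \<in># Rep_mon x" for z and x y :: "'a mon"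
    using Rep_Abs_mon_diff[of "x + y" z] that
    by (simp add: Rep_mon_inject[symmetric] plus_mon.rep_eq Rep_Abs_mon_diff)
  then have "image_mset (\<lambda>z. g z * basis_vec (Abs_mon (Rep_mon (x + y) - {#z#}))) (Rep_mon x)
      = image_mset (\<lambda>z. g z * basis_vec (Abs_mon (Rep_mon x - {#z#})) * basis_vec y) (Rep_mon x)" for x y
    by (intro image_mset_cong) (simp add: mult.assoc mult_single)
  then have *: "(\<Sum>z\<in>#Rep_mon x. g z * basis_vec (Abs_mon (Rep_mon (x + y) - {#z#})))
      = derivation_ext g (basis_vec x) * basis_vec y" for x y
    by (simp add: derivation_ext_basis sum_mset_distrib_right)
  show "derivation_ext g (basis_vec x * basis_vec y)
      = derivation_ext g (basis_vec x) * basis_vec y + basis_vec x * derivation_ext g (basis_vec y)"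
    using *[of x y] *[of y x]
    by (simp add: derivation_ext_basis mult_single plus_mon.rep_eq add.commute[of y x] mult.commute[of "basis_vec x"])
qed

lemma derivation_ext_hvar: "z \<in> zbasis \<times> {1..} \<Longrightarrow> derivation_ext g (hvar z) = g z"
proof -
  assume z: "z \<in> zbasis \<times> {1..}"
  have "Abs_mon {#} = (0 :: 'a mon)" by (simp add: zero_mon_def)
  then show ?thesis by (simp add: hvar_def derivation_ext_basis Rep_Abs_mon_single[OF z])
qed

section \<open>Coordinates in the lattice and the map from L to h\<close>

lemma is_zbasis_zbasis: "is_zbasis (zbasis :: 'l::fg_free_ab_group set)"
  unfolding zbasis_def by (rule someI_ex[OF ex_zbasis])

lemma finite_zbasis: "finite (zbasis :: 'l::fg_free_ab_group set)"
  using is_zbasis_zbasis unfolding is_zbasis_def by blast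

lemma is_zcoord_zcoord: "is_zcoord zbasis x (zcoord x)"
  using is_zbasis_zbasis unfolding is_zbasis_def zcoord_def by (metis theI')

lemma zcoord_unique: "is_zcoord zbasis x c \<Longrightarrow> zcoord x = c"
  using is_zbasis_zbasis is_zcoord_zcoord unfolding is_zbasis_def by metis

lemma zscale_int: "zscale (int n) x = (\<Sum>i<n. x)" and zscale_neg_int: "zscale (- int n) x = - (\<Sum>i<n. x)"
  for x :: "'a::ab_group_add"
  by (simp_all add: zscale_def)

lemma zscale_Suc: "zscale (k + 1) x = zscale k x + x" for x :: "'a::ab_group_add"
proof (cases k)
  case (nonneg n)
  then have "k + 1 = int (Suc n)" by simp
  then show ?thesis using nonneg by (simp only: zscale_int) simp
next
  case (neg n)
  then have "k + 1 = - int n" by simp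
  then show ?thesis using neg by (simp only: zscale_neg_int) simp
qed

lemma zscale_add: "zscale (k + l) x = zscale k x + zscale l x" for x :: "'a::ab_group_add"
proof (induction l rule: int_induct[where k = 0])
  case base
  show ?case by (simp add: zscale_def)
next
  case (step1 l)
  then show ?case using zscale_Suc[of "k + l" x] zscale_Suc[of l x] by (simp add: add.assoc)
next
  case (step2 l)
  then show ?case using zscale_Suc[of "k + (l - 1)" x] zscale_Suc[of "l - 1" x]
    by (simp add: algebra_simps)
qed

lemma zcoord_add: "zcoord (x + y) b = zcoord x b + zcoord y b"
proof -
  have "is_zcoord zbasis (x + y) (\<lambda>b. zcoord x b + zcoord y b)"
    using is_zcoord_zcoord[of x] is_zcoord_zcoord[of y]
    unfolding is_zcoord_def by (auto simp: zscale_add sum.distrib)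
  then show ?thesis by (simp add: zcoord_unique)
qed

lemma to_h_add: "to_h (\<alpha> + \<beta>) = to_h \<alpha> + to_h \<beta>"
  by (simp add: to_h_def zcoord_add single_add sum.distrib)

lemma lookup_to_h: "b \<in> zbasis \<Longrightarrow> Poly_Mapping.lookup (to_h \<alpha>) b = of_int (zcoord \<alpha> b)"
  by (simp add: to_h_def lookup_sum lookup_single when_def sum.If_cases finite_zbasis)

lemma hneg_add: "hneg (h + k) n = hneg h n + hneg k n"
  by (simp add: hneg_def lookup_add cvec.scale_left_distrib sum.distrib)

abbreviation one_tensor :: "'y vec \<Rightarrow> ('x::comm_monoid_add \<times> 'y) vec" where
  "one_tensor u \<equiv> 1 \<otimes> u"

lemma tensor_basis_mult:
  fixes u v :: "'y::comm_monoid_add vec" and \<alpha> \<beta> :: "'x::comm_monoid_add"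
  shows "(basis_vec \<alpha> \<otimes> u) * (basis_vec \<beta> \<otimes> v) = basis_vec (\<alpha> + \<beta>) \<otimes> (u * v)"
  by (simp add: tensor_mult mult_single)

lemma bl_Lm1_tensor:
  "bl_Lm1 (basis_vec \<alpha> \<otimes> u) = basis_vec \<alpha> \<otimes> (hneg (to_h \<alpha>) 1 * u) + basis_vec \<alpha> \<otimes> bh_Lm1 u"
proof (rule clinear_eqI[of _ _ u])
  show "clinear (\<lambda>u. bl_Lm1 (basis_vec \<alpha> \<otimes> u))"
    unfolding bl_Lm1_def by (rule clinear_comp[OF clinear_lin_ext clinear_tensor_right])
  have "clinear (bh_Lm1 :: 'a bh \<Rightarrow> _)"
    unfolding bh_Lm1_def by (rule derivation_clinear[OF derivation_derivation_ext])
  then show "clinear (\<lambda>u. basis_vec \<alpha> \<otimes> (hneg (to_h \<alpha>) 1 * u) + basis_vec \<alpha> \<otimes> bh_Lm1 u)"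
    by (intro clinear_plus clinear_comp[OF clinear_tensor_right clinear_mult_left] clinear_comp[OF clinear_tensor_right])
qed (simp add: bl_Lm1_def)

lemma derivation_bh_Lm1: "derivation scalar bh_Lm1"
  unfolding bh_Lm1_def by (rule derivation_derivation_ext)

lemma derivation_bl_Lm1: "derivation scalar bl_Lm1"
proof (rule derivationI)
  show "clinear bl_Lm1" unfolding bl_Lm1_def by (rule clinear_lin_ext)
  fix x y :: "'a \<times> 'a mon"
  obtain \<alpha> m \<beta> n where x: "basis_vec x = basis_vec \<alpha> \<otimes> basis_vec m" and y: "basis_vec y = basis_vec \<beta> \<otimes> basis_vec n"
    by (metis mult_1 prod.collapse tensor_single)
  have L: "bh_Lm1 (u * v) = bh_Lm1 u * v + u * bh_Lm1 v" for u v :: "'a bh"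
    by (rule derivation_mult[OF derivation_bh_Lm1])
  show "bl_Lm1 (basis_vec x * basis_vec y) = bl_Lm1 (basis_vec x) * basis_vec y + basis_vec x * bl_Lm1 (basis_vec y)"
    unfolding x y tensor_basis_mult bl_Lm1_tensor L to_h_add hneg_add distrib_left distrib_right tensor_add_right
    by (simp add: ac_simps)
qed

interpretation bl: differential_algebra "bl_Lm1 :: 'l::fg_free_ab_group bl \<Rightarrow> _"
  by unfold_locales (rule derivation_bl_Lm1)

lemma e_elt_conv: "e_elt \<alpha> = basis_vec (\<alpha>, 0)"
  unfolding single_one[symmetric] by (subst tensor_single) simp

text \<open>Two multiplicative maps, or two derivations along one multiplicative map, agree once
  they agree on the algebra generators: scalars, e_\<alpha> and the variables b(-n).\<close>

lemma bl_induct [case_names scalar e_elt hvar add mult]: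
  fixes p :: "'l::fg_free_ab_group bl"
  assumes "\<And>c. P (scalar c)" and e: "\<And>\<alpha>. P (e_elt \<alpha>)"
    and v: "\<And>z. z \<in> zbasis \<times> {1..} \<Longrightarrow> P (one_tensor (hvar z))"
    and add: "\<And>p q. P p \<Longrightarrow> P q \<Longrightarrow> P (p + q)" and mult: "\<And>p q. P p \<Longrightarrow> P q \<Longrightarrow> P (p * q)"
  shows "P p"
proof -
  have m: "P (basis_vec (0, m))" for m :: "'l mon"
  proof (induction m rule: mon_induct)
    case zero
    show ?case using e[of 0] by (simp only: e_elt_conv)
  next
    case (add z m)
    then show ?case using mult[OF v[OF add(1)] add(2)]
      by (simp add: hvar_def mult_single single_one[symmetric] del: single_one)
  qed
  have s: "P (Poly_Mapping.single x c)" for x c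
    using mult[OF assms(1)[of c] mult[OF e[of "fst x"] m[of "snd x"]]]
    by (simp add: e_elt_conv mult_single)
  have "P (\<Sum>y\<in>A. Poly_Mapping.single y (Poly_Mapping.lookup p y))" if "finite A" for A
    using that assms(1)[of 0] by induction (simp_all add: add s)
  from this[of "Poly_Mapping.keys p"] show ?thesis using basis_expansion[of p] by simp
qed

lemma derivation_1: "derivation scalar d \<Longrightarrow> d 1 = 0"
  unfolding derivation_def by (metis single_one)

lemma bl_Lm1_e_elt: "bl_Lm1 (e_elt \<alpha>) = one_tensor (hneg (to_h \<alpha>) 1) * e_elt \<alpha>"
  by (simp add: bl_Lm1_tensor tensor_mult derivation_1[OF derivation_bh_Lm1] tensor_zero_right)

lemma to_h_0: "to_h 0 = 0"
  using to_h_add[of 0 0] by simp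

lemma hneg_0: "hneg 0 n = 0"
  by (simp add: hneg_def)

lemma bl_Lm1_one_tensor: "bl_Lm1 (one_tensor u) = one_tensor (bh_Lm1 u)"
  using bl_Lm1_tensor[of 0 u] by (simp add: to_h_0 hneg_0 tensor_zero_right)

lemma bl_Lm1_hvar:
  assumes "(b, n) \<in> zbasis \<times> {1..}"
  shows "bl_Lm1 (one_tensor (hvar (b, n))) = cscale (of_nat n) (one_tensor (hvar (b, n + 1)))"
  by (simp add: bl_Lm1_one_tensor bh_Lm1_def derivation_ext_hvar[OF assms] tensor_cscale_right del: cscale_single)

subsection \<open>The comultiplication of \<open>B\<^sub>L\<close>\<close>

type_synonym 'l bl2 = "('l \<times> 'l mon) \<times> ('l \<times> 'l mon) \<Rightarrow>\<^sub>0 complex"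

lemma bl_comult_eq_pi_map: "bl_comult = pi_map"
  by (simp add: bl_comult_def pi_map_def)

lemma clinear_pi_map: "clinear pi_map"
  unfolding pi_map_def by (rule clinear_lin_ext)

lemma pi_map_zero: "pi_map 0 = 0"
  by (rule clinear_zero[OF clinear_pi_map])

lemma pi_map_add: "pi_map (p + q) = pi_map p + pi_map q"
  by (rule clinear_add[OF clinear_pi_map])

lemma pi_map_cscale: "pi_map (cscale c p) = cscale c (pi_map p)"
  by (rule clinear_cscale[OF clinear_pi_map])

lemma additive_pi_map: "additive pi_map"
  by (rule clinear_additive[OF clinear_pi_map])

lemma clinear_bh_comult: "clinear bh_comult"
  unfolding bh_comult_def by (rule clinear_lin_ext)

lemma bh_comult_mult: "bh_comult (u * v) = bh_comult u * bh_comult v"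
proof -
  have 1: "bh_comult (basis_vec m * v) = bh_comult (basis_vec m) * bh_comult v" for m
    by (rule clinear_eqI[of _ _ v, OF clinear_comp[OF clinear_bh_comult clinear_mult_left]
          clinear_comp[OF clinear_mult_left clinear_bh_comult]])
      (simp add: bh_comult_def mult_single plus_mon.rep_eq)
  show ?thesis
    by (rule clinear_eqI[of _ _ u, OF clinear_comp[OF clinear_bh_comult clinear_mult_right]
          clinear_comp[OF clinear_mult_right clinear_bh_comult]]) (rule 1)
qed

lemma bh_comult_hvar: "z \<in> zbasis \<times> {1..} \<Longrightarrow> bh_comult (hvar z) = hvar z \<otimes> 1 + 1 \<otimes> hvar z"
  by (simp add: bh_comult_def hvar_def Rep_Abs_mon_single)

lemma swap_middle_tensor:
  fixes a :: "'a vec" and b :: "'b vec" and c :: "'c vec" and d :: "'d vec"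
  shows "swap_middle ((a \<otimes> b) \<otimes> (c \<otimes> d)) = (a \<otimes> c) \<otimes> (b \<otimes> d)"
proof -
  have l: "clinear swap_middle" unfolding swap_middle_def by (rule clinear_lin_ext)
  note i = clinear_tensor_left clinear_tensor_right
  note c = clinear_comp[OF i(1)] clinear_comp[OF i(2)] clinear_comp[OF l]
  have 1: "swap_middle ((basis_vec x \<otimes> basis_vec y) \<otimes> (basis_vec z \<otimes> d)) = (basis_vec x \<otimes> basis_vec z) \<otimes> (basis_vec y \<otimes> d)"
    for x :: 'a and y :: 'b and z :: 'c
    by (rule clinear_eqI[of _ _ d, OF c(3)[OF c(2)[OF i(2)]] c(2)[OF i(2)]]) (simp add: swap_middle_def)
  have 2: "swap_middle ((basis_vec x \<otimes> basis_vec y) \<otimes> (c \<otimes> d)) = (basis_vec x \<otimes> c) \<otimes> (basis_vec y \<otimes> d)"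
    for x :: 'a and y :: 'b
    by (rule clinear_eqI[of _ _ c, OF c(3)[OF c(2)[OF i(1)]] c(1)[OF i(2)]]) (rule 1)
  have 3: "swap_middle ((basis_vec x \<otimes> b) \<otimes> (c \<otimes> d)) = (basis_vec x \<otimes> c) \<otimes> (b \<otimes> d)"
    for x :: 'a
    by (rule clinear_eqI[of _ _ b, OF c(3)[OF c(1)[OF i(2)]] c(2)[OF i(1)]]) (rule 2)
  show ?thesis
    by (rule clinear_eqI[of _ _ a, OF c(3)[OF c(1)[OF i(1)]] c(1)[OF i(1)]]) (rule 3)
qed

lemma clinear_diag_elt: "clinear (diag_elt \<alpha>)"
  unfolding diag_elt_def swap_middle_def by (rule clinear_comp[OF clinear_lin_ext clinear_tensor_right])

lemma diag_elt_tensor: "diag_elt \<alpha> (u \<otimes> v) = (basis_vec \<alpha> \<otimes> u) \<otimes> (basis_vec \<alpha> \<otimes> v)"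
  unfolding diag_elt_def by (rule swap_middle_tensor)

lemma diag_elt_mult: "diag_elt \<alpha> s * diag_elt \<beta> t = diag_elt (\<alpha> + \<beta>) (s * t)"
proof -
  have b: "diag_elt \<gamma> (basis_vec z) = basis_vec ((\<gamma>, fst z), (\<gamma>, snd z))" for \<gamma> :: 'a and z
    using diag_elt_tensor[of \<gamma> "basis_vec (fst z)" "basis_vec (snd z)"] by simp
  have 1: "diag_elt \<alpha> (basis_vec x) * diag_elt \<beta> t = diag_elt (\<alpha> + \<beta>) (basis_vec x * t)" for x
    by (rule clinear_eqI[of _ _ t, OF clinear_comp[OF clinear_mult_left clinear_diag_elt]
            clinear_comp[OF clinear_diag_elt clinear_mult_left]])
      (simp add: b mult_single)
  show ?thesis
    by (rule clinear_eqI[of _ _ s, OF clinear_comp[OF clinear_mult_right clinear_diag_elt]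
            clinear_comp[OF clinear_diag_elt clinear_mult_right]]) (rule 1)
qed

lemma pi_map_mult: "pi_map (p * q) = pi_map p * pi_map q"
proof -
  have pt: "pi_map (basis_vec x) = diag_elt (fst x) (bh_comult (basis_vec (snd x)))" for x :: "'a \<times> 'a mon"
    using pi_map_tensor[of "fst x" "basis_vec (snd x)"] by simp
  have 1: "pi_map (basis_vec x * q) = pi_map (basis_vec x) * pi_map q" for x
    by (rule clinear_eqI[of _ _ q, OF clinear_comp[OF clinear_pi_map clinear_mult_left]
            clinear_comp[OF clinear_mult_left clinear_pi_map]])
      (simp add: mult_single pt diag_elt_mult bh_comult_mult[symmetric])
  show ?thesis
    by (rule clinear_eqI[of _ _ p, OF clinear_comp[OF clinear_pi_map clinear_mult_right]
            clinear_comp[OF clinear_mult_right clinear_pi_map]]) (rule 1)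
qed

lemma bh_comult_1: "bh_comult 1 = 1 \<otimes> 1"
  by (simp add: bh_comult_def one_tensor_one single_one[symmetric] zero_mon.rep_eq zero_prod_def del: single_one)

lemma pi_map_e_elt: "pi_map (e_elt \<alpha>) = e_elt \<alpha> \<otimes> e_elt \<alpha>"
  by (simp only: pi_map_tensor bh_comult_1 diag_elt_tensor)

lemma pi_map_one_tensor: "pi_map (one_tensor u) = diag_elt 0 (bh_comult u)"
  using pi_map_tensor[of 0 u] by simp

lemma diag_elt_0: "diag_elt 0 (u \<otimes> v) = one_tensor u \<otimes> one_tensor v"
  using diag_elt_tensor[of 0 u v] by simp

lemma pi_map_hvar:
  "z \<in> zbasis \<times> {1..} \<Longrightarrow> pi_map (one_tensor (hvar z)) = one_tensor (hvar z) \<otimes> 1 + 1 \<otimes> one_tensor (hvar z)"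
  by (simp only: pi_map_one_tensor bh_comult_hvar clinear_add[OF clinear_diag_elt] diag_elt_0 one_tensor_one)

lemma pi_map_1: "pi_map 1 = 1"
  using pi_map_e_elt[of 0] by (simp only: single_one one_tensor_one)

lemma pi_map_scalar: "pi_map (scalar c) = scalar c"
  using clinear_cscale[OF clinear_pi_map, of c 1] by (simp add: cscale_conv_mult pi_map_1)

text \<open>This is id \<otimes> counit: the counit of B_L is 1 on every e^\<beta> and kills
  monomials of positive degree. By the counit law it is a left inverse of the comultiplication,
  which makes \<open>pi_map\<close> injective.\<close>

definition counit_right :: "'l::fg_free_ab_group bl2 \<Rightarrow> 'l bl" where
  "counit_right = lin_ext (\<lambda>(x, y). if snd y = 0 then basis_vec x else 0)"

lemma clinear_counit_right: "clinear counit_right"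
  unfolding counit_right_def by (rule clinear_lin_ext)

lemma mon_add_eq_0: "m + m' = 0 \<longleftrightarrow> m = 0 \<and> m' = (0 :: 'l::fg_free_ab_group mon)"
  by (simp add: Rep_mon_inject[symmetric] plus_mon.rep_eq zero_mon.rep_eq)

lemma counit_right_mult: "counit_right (s * t) = counit_right s * counit_right t"
proof -
  have 1: "counit_right (basis_vec x * t) = counit_right (basis_vec x) * counit_right t" for x
    by (rule clinear_eqI[of _ _ t, OF clinear_comp[OF clinear_counit_right clinear_mult_left]
            clinear_comp[OF clinear_mult_left clinear_counit_right]])
      (auto simp: mult_single counit_right_def split_beta mon_add_eq_0)
  show ?thesis
    by (rule clinear_eqI[of _ _ s, OF clinear_comp[OF clinear_counit_right clinear_mult_right]
            clinear_comp[OF clinear_mult_right clinear_counit_right]]) (rule 1)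
qed

lemma counit_right_pi_map: "counit_right (pi_map p) = p"
proof (induction p rule: bl_induct)
  case (scalar c)
  show ?case by (simp only: pi_map_scalar) (simp add: counit_right_def zero_prod_def split_beta)
next
  case (e_elt \<alpha>)
  show ?case by (simp only: pi_map_e_elt) (simp add: e_elt_conv counit_right_def)
next
  case (hvar z)
  have "Abs_mon {#z#} \<noteq> 0"
    using Rep_Abs_mon_single[OF hvar] by (auto simp: zero_mon.rep_eq)
  then show ?case
    unfolding pi_map_hvar[OF hvar] clinear_add[OF clinear_counit_right]
    by (simp add: hvar_def single_one[symmetric] counit_right_def split_beta zero_prod_def del: single_one)
qed (simp_all add: pi_map_add clinear_add[OF clinear_counit_right]
  pi_map_mult counit_right_mult)

lemma inj_pi_map: "inj pi_map"
  by (rule inj_on_inverseI[of _ counit_right]) (rule counit_right_pi_map)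

lemma U_space_eq: "U_space = range (pi_map :: 'l::fg_free_ab_group bl \<Rightarrow> _)"
proof
  have "{diag_elt \<alpha> (bh_comult u) |\<alpha> u. True} \<subseteq> range pi_map"
    by (auto simp: pi_map_tensor[symmetric])
  moreover have "cvec.subspace (range (pi_map :: 'l bl \<Rightarrow> _))"
  proof (rule cvec.subspaceI)
    show "0 \<in> range (pi_map :: 'l bl \<Rightarrow> _)"
      using pi_map_zero by (metis rangeI)
    show "x + y \<in> range (pi_map :: 'l bl \<Rightarrow> _)" if "x \<in> range pi_map" "y \<in> range pi_map" for x y
      using that by (auto simp: clinear_add[OF clinear_pi_map, symmetric])
    show "cscale c x \<in> range (pi_map :: 'l bl \<Rightarrow> _)" if "x \<in> range pi_map" for x c
      using that by (auto simp: clinear_cscale[OF clinear_pi_map, symmetric])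
  qed
  ultimately show "U_space \<subseteq> range (pi_map :: 'l bl \<Rightarrow> _)"
    unfolding U_space_def by (rule cvec.span_minimal)
next
  show "range pi_map \<subseteq> (U_space :: 'l bl2 set)"
    unfolding U_space_def pi_map_def lin_ext_def
    by (auto intro!: cvec.span_sum cvec.span_scale intro: cvec.span_base)
qed

section \<open>Compatibility of the comultiplication with L(-1)\<close>

definition bl2_Lm1 :: "'l::fg_free_ab_group bl2 \<Rightarrow> 'l bl2" where
  "bl2_Lm1 t = tensor_op bl_Lm1 id t + tensor_op id bl_Lm1 t"

lemma derivation_bl2_Lm1: "derivation scalar bl2_Lm1"
  unfolding bl2_Lm1_def
  by (rule derivation_plus[OF derivation_tensor_op_left[OF derivation_bl_Lm1] derivation_tensor_op_right[OF derivation_bl_Lm1]])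

interpretation bl2: differential_algebra "bl2_Lm1 :: 'l::fg_free_ab_group bl2 \<Rightarrow> _"
  by unfold_locales (rule derivation_bl2_Lm1)

lemma clinear_bl_Lm1: "clinear bl_Lm1"
  by (rule derivation_clinear[OF derivation_bl_Lm1])

lemma bl_Lm1_zero: "bl_Lm1 0 = 0"
  by (rule clinear_zero[OF clinear_bl_Lm1])

lemma bl2_Lm1_tensor: "bl2_Lm1 (p \<otimes> q) = bl_Lm1 p \<otimes> q + p \<otimes> bl_Lm1 q"
  by (simp add: bl2_Lm1_def tensor_op_tensor[OF clinear_bl_Lm1 clinear_id(2)] tensor_op_tensor[OF clinear_id(2) clinear_bl_Lm1])

lemma pi_map_hneg: "n \<ge> 1 \<Longrightarrow> pi_map (one_tensor (hneg h n)) = one_tensor (hneg h n) \<otimes> 1 + 1 \<otimes> one_tensor (hneg h n)"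
proof -
  assume n: "n \<ge> 1"
  let ?f = "\<lambda>t :: 'a bh. pi_map (one_tensor t :: 'a bl)" and ?g = "\<lambda>t :: 'a bh. one_tensor t \<otimes> 1 + 1 \<otimes> one_tensor t :: 'a bl2"
  have f: "clinear ?f" by (rule clinear_comp[OF clinear_pi_map clinear_tensor_right])
  have g: "clinear ?g"
    by (rule clinear_plus[OF clinear_comp[OF clinear_tensor_left clinear_tensor_right] clinear_comp[OF clinear_tensor_right clinear_tensor_right]])
  show ?thesis
    unfolding hneg_def clinear_sum[OF f] clinear_sum[OF g] clinear_cscale[OF f] clinear_cscale[OF g]
    using n by (intro sum.cong refl arg_cong2[where f = cscale] pi_map_hvar) auto
qed

text \<open>Both sides are derivations along the multiplicative map \<open>pi_map\<close>, so
  generators suffice. At e_\<alpha>, where L(-1) e_\<alpha> = \<alpha>(-1) e_\<alpha>, it is the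
  primitivity of \<alpha>(-1).\<close>

lemma pi_map_bl_Lm1: "pi_map (bl_Lm1 p) = bl2_Lm1 (pi_map p)"
proof (induction p rule: bl_induct)
  case (scalar c)
  show ?case
    by (simp add: pi_map_scalar derivation_scalar[OF derivation_bl_Lm1] derivation_scalar[OF derivation_bl2_Lm1]
        pi_map_zero)
next
  case (e_elt \<alpha>)
  show ?case
    unfolding bl_Lm1_e_elt pi_map_mult pi_map_e_elt pi_map_hneg[OF order_refl] bl2_Lm1_tensor distrib_right
    unfolding tensor_mult by simp
next
  case (hvar z)
  obtain b n where z: "z = (b, n)" by (cases z)
  have z': "(b, n + 1) \<in> zbasis \<times> {1..}" "(b, n) \<in> zbasis \<times> {1..}" using hvar z by auto
  show ?case
    unfolding z bl_Lm1_hvar[OF z'(2)] pi_map_cscale pi_map_hvar[OF z'(1)] pi_map_hvar[OF z'(2)]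
      clinear_add[OF derivation_clinear[OF derivation_bl2_Lm1]] bl2_Lm1_tensor derivation_1[OF derivation_bl_Lm1]
      tensor_cscale_left tensor_cscale_right tensor_zero_left tensor_zero_right
    by (simp add: cvec.scale_right_distrib del: cscale_single tensor_single)
next
  case (add p q)
  then show ?case
    by (simp add: pi_map_add clinear_add[OF clinear_bl_Lm1] clinear_add[OF derivation_clinear[OF derivation_bl2_Lm1]])
next
  case (mult p q)
  then show ?case
    by (simp add: pi_map_mult derivation_mult[OF derivation_bl_Lm1] derivation_mult[OF derivation_bl2_Lm1]
        pi_map_add)
qed

subsection \<open>Exponentials of operator series\<close>

text \<open>Acting on all power series turns \<open>op_series_power\<close> into iterates of a
  single operator, and a series of derivations into a single derivation, to which
  \<open>higher_derivation_powers\<close> applies.\<close>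

definition op_series_fps :: "(nat \<Rightarrow> 'a \<Rightarrow> 'a) \<Rightarrow> 'a::comm_ring_1 fps \<Rightarrow> 'a fps" where
  "op_series_fps A F = Abs_fps (\<lambda>N. \<Sum>i\<le>N. A i (F $ (N - i)))"

lemma op_series_fps_nth: "op_series_fps A F $ N = (\<Sum>i\<le>N. A i (F $ (N - i)))"
  by (simp add: op_series_fps_def)

lemma op_series_power_conv: "op_series_power A k N v = (op_series_fps A ^^ k) (fps_const v) $ N"
  by (induction k arbitrary: N) (simp_all add: op_series_mult_def op_series_fps_nth)

lemma derivation_op_series_fps:
  assumes A: "\<And>n. derivation \<kappa> (A n)"
  shows "derivation (\<lambda>c. fps_const (\<kappa> c)) (op_series_fps A)"
  unfolding derivation_def
proof (intro conjI allI)
  have add: "additive (A n)" for n using A by (simp add: derivation_def)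
  show "additive (op_series_fps A)"
    by (simp add: additive_def fps_eq_iff op_series_fps_nth derivation_add[OF A] sum.distrib)
  show "op_series_fps A (fps_const (\<kappa> c)) = 0" for c
    by (auto simp: fps_eq_iff op_series_fps_nth derivation_scalar[OF A] additive_0[OF add] intro!: sum.neutral)
  fix F G :: "'a fps"
  show "op_series_fps A (F * G) = op_series_fps A F * G + F * op_series_fps A G"
  proof (rule fps_ext)
    fix N :: nat
    \<comment> \<open>All the double sums below are sums over such triples: i is the index of the
      operator, j and k are the exponents in F and G.\<close>
    let ?I = "{(i, j, k). i + j + k = N}"
    have 1: "(\<Sum>i\<le>N. \<Sum>j\<le>N - i. f i j (N - i - j)) = (\<Sum>(i, j, k)\<in>?I. f i j k)" for f :: "nat \<Rightarrow> nat \<Rightarrow> nat \<Rightarrow> 'a"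
      unfolding sum.Sigma[OF finite_atMost ballI[OF finite_atMost]]
      by (rule sum.reindex_bij_witness[of _ "\<lambda>(i, j, k). (i, j)" "\<lambda>(i, j). (i, j, N - i - j)"]) auto
    have 2: "(\<Sum>s\<le>N. \<Sum>i\<le>s. f i (s - i) (N - s)) = (\<Sum>(i, j, k)\<in>?I. f i j k)" for f :: "nat \<Rightarrow> nat \<Rightarrow> nat \<Rightarrow> 'a"
      unfolding sum.Sigma[OF finite_atMost ballI[OF finite_atMost]]
      by (rule sum.reindex_bij_witness[of _ "\<lambda>(i, j, k). (i + j, i)" "\<lambda>(s, i). (i, s - i, N - s)"]) auto
    have 3: "(\<Sum>j\<le>N. \<Sum>i\<le>N - j. f i j (N - j - i)) = (\<Sum>(i, j, k)\<in>?I. f i j k)" for f :: "nat \<Rightarrow> nat \<Rightarrow> nat \<Rightarrow> 'a"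
      unfolding sum.Sigma[OF finite_atMost ballI[OF finite_atMost]]
      by (rule sum.reindex_bij_witness[of _ "\<lambda>(i, j, k). (j, i)" "\<lambda>(j, i). (i, j, N - j - i)"]) auto
    have "op_series_fps A (F * G) $ N
        = (\<Sum>i\<le>N. \<Sum>j\<le>N - i. A i (F $ j) * G $ (N - i - j)) + (\<Sum>i\<le>N. \<Sum>j\<le>N - i. F $ j * A i (G $ (N - i - j)))"
      by (simp add: op_series_fps_nth fps_mult_nth additive.sum[OF add] derivation_mult[OF A] sum.distrib atLeast0AtMost)
    also have "\<dots> = (\<Sum>s\<le>N. \<Sum>i\<le>s. A i (F $ (s - i)) * G $ (N - s)) + (\<Sum>j\<le>N. \<Sum>i\<le>N - j. F $ j * A i (G $ (N - j - i)))"
      unfolding 1[of "\<lambda>i j k. A i (F $ j) * G $ k"] 1[of "\<lambda>i j k. F $ j * A i (G $ k)"]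
        2[of "\<lambda>i j k. A i (F $ j) * G $ k"] 3[of "\<lambda>i j k. F $ j * A i (G $ k)"] ..
    also have "\<dots> = (op_series_fps A F * G + F * op_series_fps A G) $ N"
      by (simp add: op_series_fps_nth fps_mult_nth sum_distrib_left sum_distrib_right atLeast0AtMost)
    finally show "op_series_fps A (F * G) $ N = (op_series_fps A F * G + F * op_series_fps A G) $ N" .
  qed
qed

text \<open>Since A 0 = 0, every application raises the power of x. Hence the truncation k \<le> N
  in \<open>op_series_exp\<close> loses no term.\<close>

lemma op_series_fps_funpow_nth_0:
  assumes "A 0 = (\<lambda>_. 0)" "\<And>n. A n 0 = 0" "N < k"
  shows "(op_series_fps A ^^ k) F $ N = 0"
  using assms(3)
proof (induction k arbitrary: N)
  case (Suc k)
  have "A i ((op_series_fps A ^^ k) F $ (N - i)) = 0" if "i \<le> N" for i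
    using that Suc by (cases i) (simp_all add: assms(1,2))
  then show ?case by (simp add: op_series_fps_nth)
qed simp

lemma scalar_embedding_fps_const: "scalar_embedding (\<lambda>c. fps_const (scalar c))"
  by (simp add: scalar_embedding_def additive_def single_add mult_single fps_eq_iff)

locale derivation_series =
  fixes A :: "nat \<Rightarrow> 'x::comm_monoid_add vec \<Rightarrow> 'x vec"
  assumes derivation: "\<And>n. derivation scalar (A n)" and A_0: "A 0 = (\<lambda>_. 0)"
begin

abbreviation pow :: "nat \<Rightarrow> 'x vec \<Rightarrow> nat \<Rightarrow> 'x vec" where
  "pow k v N \<equiv> (fps_const (scalar (1 / fact k)) * (op_series_fps A ^^ k) (fps_const v)) $ N"

lemma A_zero: "A n 0 = 0"
  using derivation additive_0 derivation_def by blast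

lemma exp_conv: "op_series_exp A N v = (\<Sum>k\<le>N. pow k v N)"
  by (simp add: op_series_exp_def op_series_power_conv cscale_conv_mult)

lemma higher: "higher_derivation (\<lambda>k F. fps_const (scalar (1 / fact k)) * (op_series_fps A ^^ k) F)"
  by (rule higher_derivation_powers[OF scalar_embedding_fps_const derivation_op_series_fps[OF derivation]])

lemma pow_mult: "pow k (p * q) N = (\<Sum>l\<le>k. \<Sum>i\<le>N. pow l p i * pow (k - l) q (N - i))"
proof -
  have "fps_const (scalar (1 / fact k)) * (op_series_fps A ^^ k) (fps_const p * fps_const q)
     = (\<Sum>l\<le>k. fps_const (scalar (1 / fact l)) * (op_series_fps A ^^ l) (fps_const p) *
          (fps_const (scalar (1 / fact (k - l))) * (op_series_fps A ^^ (k - l)) (fps_const q)))"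
    using higher unfolding higher_derivation_def by blast
  then show ?thesis
    by (simp add: fps_sum_nth fps_mult_nth[of "_ * _" "_ * _"] atLeast0AtMost)
qed

lemma pow_eq_0: "N < k \<Longrightarrow> pow k v N = 0"
  by (simp add: op_series_fps_funpow_nth_0[where A = A, OF A_0 A_zero])

lemma exp_mult: "op_series_exp A N (p * q) = (\<Sum>i\<le>N. op_series_exp A i p * op_series_exp A (N - i) q)"
proof -
  let ?t = "\<lambda>(i, l, m). pow l p i * pow m q (N - i)"
  let ?S = "{(i, l, m). i \<le> N \<and> l + m \<le> N}"
  have fin: "finite ?S"
    by (rule finite_subset[of _ "{..N} \<times> {..N} \<times> {..N}"]) auto
  have "op_series_exp A N (p * q) = (\<Sum>x\<in>(SIGMA k:{..N}. SIGMA l:{..k}. {..N}). ?t (snd (snd x), fst (snd x), fst x - fst (snd x)))"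
    unfolding exp_conv pow_mult by (simp add: sum.Sigma case_prod_unfold)
  also have "\<dots> = sum ?t ?S"
    by (rule sum.reindex_bij_witness[of _ "\<lambda>(i, l, m). (l + m, l, i)" "\<lambda>(k, l, i). (i, l, k - l)"]) auto
  \<comment> \<open>The truncations differ: the left exponential has l + m \<le> N, the product on
    the right has l \<le> i and m \<le> N - i. The surplus terms vanish by
    \<open>pow_eq_0\<close>.\<close>
  also have "\<dots> = sum ?t (SIGMA i:{..N}. {..i} \<times> {..N - i})"
  proof (rule sum.mono_neutral_right[OF fin])
    show "\<forall>x\<in>?S - (SIGMA i:{..N}. {..i} \<times> {..N - i}). ?t x = 0"
    proof
      fix x assume x: "x \<in> ?S - (SIGMA i:{..N}. {..i} \<times> {..N - i})"
      obtain i l m where x': "x = (i, l, m)" by (cases x)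
      from x x' have "i < l \<or> N - i < m" by auto
      then show "?t x = 0" unfolding x' using pow_eq_0 by (auto simp del: fps_mult_left_const_nth)
    qed
  qed auto
  also have "\<dots> = (\<Sum>i\<le>N. op_series_exp A i p * op_series_exp A (N - i) q)"
    unfolding exp_conv by (simp add: sum.Sigma sum.cartesian_product sum_product split_beta)
  finally show ?thesis .
qed

lemma clinear_exp: "clinear (op_series_exp A N)"
proof -
  have a: "(op_series_fps A ^^ k) (F + G) = (op_series_fps A ^^ k) F + (op_series_fps A ^^ k) G" for k F G
    using derivation_funpow_additive[OF derivation_op_series_fps[OF derivation]] by (simp add: additive_def)
  have s: "(op_series_fps A ^^ k) (fps_const (scalar c) * F) = fps_const (scalar c) * (op_series_fps A ^^ k) F" for k c F
    by (rule derivation_funpow_scale[OF derivation_op_series_fps[OF derivation]])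
  have e: "fps_const (cscale c v) = fps_const (scalar c) * fps_const v" for c v
    by (simp add: cscale_conv_mult)
  have "pow k (cscale c v) N = cscale c (pow k v N)" for c v k
    unfolding e s unfolding cscale_conv_mult by (simp add: ac_simps)
  moreover have "pow k (v + w) N = pow k v N + pow k w N" for v w k
    by (simp add: a fps_const_add[symmetric] distrib_left del: fps_const_add)
  ultimately show ?thesis
    by (simp only: clinear_def additive_def exp_conv sum.distrib cvec.scale_sum_right simp_thms)
qed

text \<open>Only the terms of order 0 and 1 of the exponential survive. The generators are of this
  kind: the modes h(n), n > 0, kill e_\<beta> and send a variable to a scalar.\<close>

lemma exp_quadratic:
  assumes "\<And>i j. A i (A j v) = 0"
  shows "op_series_exp A N v = (if N = 0 then v else A N v)"
proof -
  have 1: "op_series_fps A (fps_const v) $ N = A N v" for N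
  proof -
    have "op_series_fps A (fps_const v) $ N = (\<Sum>i\<in>{N}. A i (fps_const v $ (N - i)))"
      unfolding op_series_fps_nth by (rule sum.mono_neutral_right) (auto simp: A_zero)
    then show ?thesis by simp
  qed
  have 2: "(op_series_fps A ^^ (k + 2)) (fps_const v) = 0" for k
  proof (induction k)
    case 0
    have "op_series_fps A (op_series_fps A (fps_const v)) = 0"
      by (rule fps_ext) (simp only: op_series_fps_nth[of A "op_series_fps A (fps_const v)"] 1 assms sum.neutral_const fps_zero_nth)
    then show ?case by (simp add: numeral_2_eq_2)
  next
    case (Suc k)
    have "op_series_fps A 0 = 0" by (simp add: fps_eq_iff op_series_fps_nth A_zero)
    then show ?case by (simp only: add_Suc funpow.simps o_apply Suc)
  qed
  have k2: "pow k v N = 0" if "k \<ge> 2" for k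
  proof -
    have "(op_series_fps A ^^ k) (fps_const v) = 0"
      using 2[of "k - 2"] that by (simp only: le_add_diff_inverse2)
    then show ?thesis by simp
  qed
  show ?thesis
  proof (cases N)
    case 0
    then show ?thesis by (simp add: exp_conv)
  next
    case (Suc M)
    have "op_series_exp A N v = (\<Sum>k\<in>{0, 1}. pow k v N)"
      unfolding exp_conv by (rule sum.mono_neutral_right) (use Suc k2 in auto)
    then show ?thesis using Suc by (simp add: 1)
  qed
qed

end

subsection \<open>The operators \<open>E\<^sup>\<plusminus>\<close>\<close>

abbreviation E_plus_arg :: "('l::fg_free_ab_group \<Rightarrow> 'l \<Rightarrow> int) \<Rightarrow> 'l \<Rightarrow> nat \<Rightarrow> 'l bl \<Rightarrow> 'l bl" where
  "E_plus_arg B \<alpha> \<equiv> \<lambda>n v. if n = 0 then 0 else cscale (1 / of_nat n) (bl_heis B (to_h \<alpha>) (int n) v)"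

lemma derivation_cscale: "derivation scalar d \<Longrightarrow> derivation scalar (\<lambda>v. cscale c (d v))"
  by (simp add: derivation_def additive_def cvec.scale_right_distrib cscale_mult_left cscale_mult_right)

lemma bl_heis_pos: "n > 0 \<Longrightarrow> bl_heis B h (int n) = tensor_op id (derivation_ext
     (\<lambda>(b, m). if m = n then cscale (of_nat n * hform B h (basis_vec b)) 1 else 0))"
  unfolding bl_heis_def bh_heis_def[abs_def] by (simp cong: if_cong)

lemma derivation_series_E_plus: "derivation_series (E_plus_arg B \<alpha>)"
proof
  fix n
  show "derivation scalar (E_plus_arg B \<alpha> n)"
  proof (cases n)
    case 0
    then show ?thesis by (simp add: derivation_def additive_def)
  next
    case (Suc k)
    have "derivation scalar (\<lambda>v. cscale (1 / of_nat n) (bl_heis B (to_h \<alpha>) (int n) v))"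
      unfolding bl_heis_pos[of n, unfolded Suc, OF zero_less_Suc, folded Suc]
      by (rule derivation_cscale[OF derivation_tensor_op_right[OF derivation_derivation_ext]])
    then show ?thesis using Suc by simp
  qed
qed simp

interpretation E_plus: derivation_series "E_plus_arg B \<alpha>" for B \<alpha>
  by (rule derivation_series_E_plus)

lemma E_plus_mult: "E_plus B \<alpha> N (p * q) = (\<Sum>i\<le>N. E_plus B \<alpha> i p * E_plus B \<alpha> (N - i) q)"
  unfolding E_plus_def by (rule E_plus.exp_mult)

lemma clinear_E_plus: "clinear (E_plus B \<alpha> N)"
  unfolding E_plus_def by (rule E_plus.clinear_exp)

lemma E_plus_arg_tensor:
  "n > 0 \<Longrightarrow> E_plus_arg B \<alpha> n (p \<otimes> u) = cscale (1 / of_nat n) (p \<otimes> derivation_ext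
     (\<lambda>(b, m). if m = n then cscale (of_nat n * hform B (to_h \<alpha>) (basis_vec b)) 1 else 0) u)"
  by (simp add: bl_heis_pos tensor_op_tensor[OF clinear_id(2) derivation_clinear[OF derivation_derivation_ext]])

lemma E_plus_arg_e_elt: "E_plus_arg B \<alpha> n (e_elt \<beta>) = 0"
proof (cases "n = 0")
  case False
  then show ?thesis
    unfolding E_plus_arg_tensor[OF False[unfolded neq0_conv]]
    by (simp add: derivation_1[OF derivation_derivation_ext] tensor_zero_right)
qed simp

lemma E_plus_e_elt: "E_plus B \<alpha> N (e_elt \<beta>) = (if N = 0 then e_elt \<beta> else 0)"
  unfolding E_plus_def
  by (subst E_plus.exp_quadratic) (simp_all only: E_plus_arg_e_elt E_plus.A_zero)

lemma scalar_conv_cscale: "scalar c = cscale c 1"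
  by (simp add: cscale_conv_mult)

lemma E_plus_arg_hvar:
  assumes "(b, m) \<in> zbasis \<times> {1..}"
  shows "E_plus_arg B \<alpha> n (one_tensor (hvar (b, m))) = (if m = n then scalar (hform B (to_h \<alpha>) (basis_vec b)) else 0)"
proof (cases "n = 0")
  case True
  then show ?thesis using assms by auto
next
  case False
  then show ?thesis
    unfolding E_plus_arg_tensor[OF False[unfolded neq0_conv]] derivation_ext_hvar[OF assms]
    using False by (auto simp: tensor_cscale_right one_tensor_one tensor_zero_right scalar_conv_cscale
        cvec.scale_scale simp del: cscale_single)
qed

lemma E_plus_hvar:
  assumes "(b, m) \<in> zbasis \<times> {1..}"
  shows "E_plus B \<alpha> N (one_tensor (hvar (b, m))) =
     (if N = 0 then one_tensor (hvar (b, m)) else if N = m then scalar (hform B (to_h \<alpha>) (basis_vec b)) else 0)"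
proof -
  have "E_plus_arg B \<alpha> i (E_plus_arg B \<alpha> j (one_tensor (hvar (b, m)))) = 0" for i j
    unfolding E_plus_arg_hvar[OF assms]
    by (cases "m = j") (simp_all only: simp_thms if_True if_False E_plus.A_zero derivation_scalar[OF E_plus.derivation])
  then show ?thesis unfolding E_plus_def
    by (subst E_plus.exp_quadratic) (simp_all only: E_plus_arg_hvar[OF assms] if_distrib, auto)
qed

lemma to_h_minus: "to_h (- \<alpha>) = - to_h \<alpha>"
  using to_h_add[of \<alpha> "- \<alpha>"] by (simp add: to_h_0 eq_neg_iff_add_eq_0 add.commute)

lemma hneg_minus: "hneg (- h) n = - hneg h n"
  using hneg_add[of h "- h" n] by (simp add: hneg_0 eq_neg_iff_add_eq_0 add.commute)

section \<open>The operator E^- as multiplication by a power series\<close>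

abbreviation hneg_bl :: "'l \<Rightarrow> nat \<Rightarrow> 'l::fg_free_ab_group bl" where
  "hneg_bl \<alpha> n \<equiv> one_tensor (hneg (to_h \<alpha>) n)"

text \<open>The exponent of E^-(-\<alpha>,x). The sign of -\<alpha> cancels that of 1/n for negative
  n, and the modes of negative index act by multiplication, so the exponent is a power series over
  the commutative algebra.\<close>

definition E_minus_fps :: "'l \<Rightarrow> 'l::fg_free_ab_group bl fps" where
  "E_minus_fps \<alpha> = Abs_fps (\<lambda>n. if n = 0 then 0 else cscale (1 / of_nat n) (hneg_bl \<alpha> n))"

lemma tensor_op_mult: "tensor_op id (\<lambda>u. a * u) w = one_tensor a * (w :: ('x::comm_monoid_add \<times> 'y::comm_monoid_add) \<Rightarrow>\<^sub>0 complex)"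
proof (rule clinear_eqI[OF clinear_tensor_op clinear_mult_left])
  fix x :: "'x \<times> 'y"
  have "tensor_op id (\<lambda>u. a * u) (basis_vec (fst x) \<otimes> basis_vec (snd x)) = one_tensor a * (basis_vec (fst x) \<otimes> basis_vec (snd x))"
    unfolding tensor_op_tensor[OF clinear_id(2) clinear_mult_left] tensor_mult by simp
  then show "tensor_op id (\<lambda>u. a * u) (basis_vec x) = one_tensor a * basis_vec x" by simp
qed

definition E_minus_coeff :: "'l \<Rightarrow> nat \<Rightarrow> 'l::fg_free_ab_group bl" where
  "E_minus_coeff \<alpha> N = (\<Sum>k\<le>N. scalar (1 / fact k) * (E_minus_fps \<alpha> ^ k) $ N)"

lemma E_minus_conv: "E_minus B (- \<alpha>) N w = E_minus_coeff \<alpha> N * w"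
proof -
  define A where "A = (\<lambda>n (v :: 'a bl). if n = 0 then 0 else cscale (1 / (- of_nat n)) (bl_heis B (to_h (- \<alpha>)) (- int n) v))"
  have A: "A n v = E_minus_fps \<alpha> $ n * v" for n v
  proof (cases "n = 0")
    case False
    have "bl_heis B (to_h (- \<alpha>)) (- int n) v = - (hneg_bl \<alpha> n * v)"
    proof -
      have "bl_heis B (to_h (- \<alpha>)) (- int n) v = tensor_op id (\<lambda>u. - hneg (to_h \<alpha>) n * u) v"
        using False unfolding bl_heis_def bh_heis_def[abs_def] to_h_minus hneg_minus by simp
      then show ?thesis
        unfolding tensor_op_mult additive.minus[OF clinear_additive[OF clinear_tensor_right]] by simp
    qed
    then show ?thesis using False by (simp add: A_def E_minus_fps_def cscale_mult_left cvec.scale_minus_left)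
  qed (simp add: A_def E_minus_fps_def)
  have "op_series_power A k N v = (E_minus_fps \<alpha> ^ k) $ N * v" for k N v
    by (induction k arbitrary: N)
      (simp_all add: op_series_mult_def A fps_mult_nth sum_distrib_right atLeast0AtMost mult.assoc)
  then show ?thesis
    unfolding E_minus_def A_def[symmetric] op_series_exp_def E_minus_coeff_def
    by (simp add: sum_distrib_right cscale_conv_mult mult.assoc)
qed

lemma E_minus_fps_power_nth_0: "N < k \<Longrightarrow> (E_minus_fps \<alpha> ^ k) $ N = 0"
proof (induction k arbitrary: N)
  case (Suc k)
  have "E_minus_fps \<alpha> $ i * (E_minus_fps \<alpha> ^ k) $ (N - i) = 0" if "i \<le> N" for i
    using Suc that by (cases i) (simp_all add: E_minus_fps_def)
  then show ?case by (simp add: fps_mult_nth)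
qed simp

lemma scalar_mult_scalar: "scalar c * (scalar d * p) = scalar (c * d) * p"
  by (simp add: mult.assoc[symmetric] mult_single)

text \<open>The coefficient of x^N in (exp a)' = a' exp a, where a is
  \<open>E_minus_fps \<alpha>\<close>, so that a' has the coefficients \<alpha>(-i-1).\<close>

lemma E_minus_coeff_Suc:
  "of_nat (Suc N) * E_minus_coeff \<alpha> (Suc N) = (\<Sum>i\<le>N. hneg_bl \<alpha> (Suc i) * E_minus_coeff \<alpha> (N - i))"
proof -
  let ?a = "E_minus_fps \<alpha>"
  have d: "fps_deriv ?a $ i = hneg_bl \<alpha> (Suc i)" for i
  proof -
    have "fps_deriv ?a $ i = cscale (of_nat (Suc i)) (?a $ Suc i)"
      by (simp add: cscale_conv_mult del: of_nat_Suc)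
    also have "\<dots> = hneg_bl \<alpha> (Suc i)"
      by (simp add: E_minus_fps_def cvec.scale_scale del: of_nat_Suc)
    finally show ?thesis .
  qed
  have "of_nat (Suc N) * E_minus_coeff \<alpha> (Suc N) = (\<Sum>k\<le>Suc N. scalar (1 / fact k) * fps_deriv (?a ^ k) $ N)"
    unfolding E_minus_coeff_def sum_distrib_left by (simp add: ac_simps del: of_nat_Suc sum.atMost_Suc)
  also have "\<dots> = (\<Sum>k\<le>N. scalar (1 / fact k) * (fps_deriv ?a * ?a ^ k) $ N)"
  proof -
    have k: "(scalar (1 / fact (Suc k)) :: 'a bl) * of_nat (Suc k) = scalar (1 / fact k)" for k
      unfolding single_of_nat[symmetric] mult_single by (simp del: of_nat_Suc single_of_nat)
    have "scalar (1 / fact (Suc k)) * fps_deriv (?a ^ Suc k) $ N = scalar (1 / fact k) * (fps_deriv ?a * ?a ^ k) $ N" for k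
    proof -
      have "fps_deriv (?a ^ Suc k) = fps_const (of_nat (Suc k)) * (fps_deriv ?a * ?a ^ k)"
        unfolding fps_deriv_power by (simp add: ac_simps)
      moreover have "scalar (1 / fact (Suc k)) * (fps_const (of_nat (Suc k)) * X) $ N = scalar (1 / fact k) * X $ N" for X :: "'a bl fps"
        unfolding fps_mult_left_const_nth mult.assoc[symmetric] k ..
      ultimately show ?thesis by (simp only:)
    qed
    then show ?thesis
      unfolding sum.atMost_Suc_shift by simp
  qed
  also have "\<dots> = (\<Sum>k\<le>N. \<Sum>i\<le>N. hneg_bl \<alpha> (Suc i) * (scalar (1 / fact k) * (?a ^ k) $ (N - i)))"
    by (simp only: fps_mult_nth d sum_distrib_left atLeast0AtMost ac_simps)
  also have "\<dots> = (\<Sum>i\<le>N. hneg_bl \<alpha> (Suc i) * (\<Sum>k\<le>N. scalar (1 / fact k) * (?a ^ k) $ (N - i)))"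
    by (subst sum.swap) (simp only: sum_distrib_left)
  \<comment> \<open>The sum over k runs to N instead of N - i, but powers above N - i have no
    coefficient in that degree.\<close>
  also have "\<dots> = (\<Sum>i\<le>N. hneg_bl \<alpha> (Suc i) * E_minus_coeff \<alpha> (N - i))"
  proof (intro sum.cong refl arg_cong2[where f = "(*)"])
    fix i
    show "(\<Sum>k\<le>N. scalar (1 / fact k) * (?a ^ k) $ (N - i)) = E_minus_coeff \<alpha> (N - i)"
      unfolding E_minus_coeff_def
      by (rule sum.mono_neutral_right) (auto simp: E_minus_fps_power_nth_0)
  qed
  finally show ?thesis .
qed

lemma bl_Lm1_hneg: "n \<ge> 1 \<Longrightarrow> bl_Lm1 (hneg_bl \<alpha> n) = cscale (of_nat n) (hneg_bl \<alpha> (Suc n))"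
proof -
  assume n: "n \<ge> 1"
  have c: "clinear (\<lambda>u. bl_Lm1 (one_tensor u))"
    by (rule clinear_comp[OF clinear_bl_Lm1 clinear_tensor_right])
  show ?thesis
    unfolding hneg_def unfolding clinear_sum[OF c] clinear_cscale[OF c]
    unfolding clinear_sum[OF clinear_tensor_right] cvec.scale_sum_right clinear_cscale[OF clinear_tensor_right]
    using n by (intro sum.cong refl) (simp add: bl_Lm1_hvar mult.commute del: cscale_single)
qed

lemma divided_power_hneg: "divided_power bl_Lm1 n (hneg_bl \<alpha> 1) = hneg_bl \<alpha> (Suc n)"
proof -
  have "(bl_Lm1 ^^ n) (hneg_bl \<alpha> 1) = cscale (fact n) (hneg_bl \<alpha> (Suc n))"
  proof (induction n)
    case (Suc n)
    have "(bl_Lm1 ^^ Suc n) (hneg_bl \<alpha> 1) = cscale (fact n) (bl_Lm1 (hneg_bl \<alpha> (Suc n)))"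
      by (simp only: funpow.simps o_apply Suc clinear_cscale[OF clinear_bl_Lm1])
    also have "\<dots> = cscale (fact (Suc n)) (hneg_bl \<alpha> (Suc (Suc n)))"
      by (subst bl_Lm1_hneg) (simp_all add: cvec.scale_scale mult.commute del: of_nat_Suc)
    finally show ?case .
  qed simp
  then show ?thesis by (simp add: divided_power_def cvec.scale_scale flip: cscale_conv_mult)
qed

lemma (in differential_algebra) divided_power_mult:
  "divided_power d n (p * q) = (\<Sum>i\<le>n. divided_power d i p * divided_power d (n - i) q)"
  using higher_derivation unfolding higher_derivation_def by blast

lemma (in differential_algebra) divided_power_Suc':
  "of_nat (Suc n) * divided_power d (Suc n) p = divided_power d n (d p)"
proof -
  have k: "of_nat (Suc n) * (scalar (1 / fact (Suc n)) :: 'x \<Rightarrow>\<^sub>0 complex) = scalar (1 / fact n)"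
    unfolding single_of_nat[symmetric] mult_single by (simp del: of_nat_Suc single_of_nat)
  show ?thesis
    unfolding divided_power_def mult.assoc[symmetric] k by (simp only: funpow_Suc_right o_apply)
qed

lemma of_nat_Suc_cancel:
  fixes p q :: "'x::comm_monoid_add vec"
  assumes "of_nat (Suc n) * p = of_nat (Suc n) * q"
  shows "p = q"
proof -
  have "scalar (1 / of_nat (Suc n)) * (of_nat (Suc n) * r) = r" for r :: "'x vec"
    unfolding single_of_nat[symmetric] scalar_mult_scalar by (simp del: of_nat_Suc single_of_nat)
  then show ?thesis using assms by metis
qed

text \<open>Both sequences satisfy the recursion of \<open>E_minus_coeff_Suc\<close>. For the
  divided powers it is the Leibniz rule applied to L(-1) e_\<alpha> = \<alpha>(-1) e_\<alpha>, since
  the i-th divided power sends \<alpha>(-1) to \<alpha>(-i-1).\<close>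

lemma divided_power_e_elt: "divided_power bl_Lm1 N (e_elt \<alpha>) = E_minus_coeff \<alpha> N * e_elt \<alpha>"
proof (induction N rule: less_induct)
  case (less N)
  show ?case
  proof (cases N)
    case 0
    then show ?thesis by (simp add: E_minus_coeff_def divided_power_def)
  next
    case (Suc M)
    have "of_nat N * divided_power bl_Lm1 N (e_elt \<alpha>) = divided_power bl_Lm1 M (hneg_bl \<alpha> 1 * e_elt \<alpha>)"
      unfolding Suc bl.divided_power_Suc' bl_Lm1_e_elt ..
    also have "\<dots> = (\<Sum>i\<le>M. hneg_bl \<alpha> (Suc i) * divided_power bl_Lm1 (M - i) (e_elt \<alpha>))"
      unfolding bl.divided_power_mult divided_power_hneg ..
    also have "\<dots> = (\<Sum>i\<le>M. hneg_bl \<alpha> (Suc i) * (E_minus_coeff \<alpha> (M - i) * e_elt \<alpha>))"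
      using Suc by (intro sum.cong refl arg_cong2[where f = "(*)"] less) auto
    also have "\<dots> = of_nat N * (E_minus_coeff \<alpha> N * e_elt \<alpha>)"
      unfolding Suc mult.assoc[symmetric] E_minus_coeff_Suc sum_distrib_right ..
    finally show ?thesis unfolding Suc by (rule of_nat_Suc_cancel)
  qed
qed

subsection \<open>The module structure on \<open>B\<^sub>L\<^sub>,\<^sub>\<epsilon>\<close>\<close>

locale even_form =
  fixes B :: "'l::fg_free_ab_group \<Rightarrow> 'l \<Rightarrow> int"
  assumes form: "nondegenerate_even_form B"
begin

lemma form_add_left: "B (\<alpha> + \<beta>) \<gamma> = B \<alpha> \<gamma> + B \<beta> \<gamma>" and form_commute: "B \<alpha> \<beta> = B \<beta> \<alpha>"
  using form unfolding nondegenerate_even_form_def by blast+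

lemma form_add_right: "B \<gamma> (\<alpha> + \<beta>) = B \<gamma> \<alpha> + B \<gamma> \<beta>"
  using form_add_left form_commute by metis

lemma form_additive: "additive (\<lambda>\<alpha>. B \<alpha> \<beta>)"
  by (simp add: additive_def form_add_left)

lemma form_zero [simp]: "B 0 \<beta> = 0" "B \<beta> 0 = 0"
  using additive_0[OF form_additive] form_commute by metis+

lemma form_minus_left: "B (- \<alpha>) \<beta> = - B \<alpha> \<beta>"
  by (rule additive.minus[OF form_additive])

lemma form_zscale: "B (zscale k \<alpha>) \<beta> = k * B \<alpha> \<beta>"
  by (simp add: zscale_def additive.sum[OF form_additive] additive.diff[OF form_additive]
      flip: left_diff_distrib)

lemma form_expand: "B \<alpha> \<beta> = (\<Sum>b\<in>zbasis. zcoord \<alpha> b * B b \<beta>)"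
proof -
  have "\<alpha> = (\<Sum>b\<in>zbasis. zscale (zcoord \<alpha> b) b)"
    using is_zcoord_zcoord[of \<alpha>] unfolding is_zcoord_def by blast
  then have "B \<alpha> \<beta> = B (\<Sum>b\<in>zbasis. zscale (zcoord \<alpha> b) b) \<beta>" by simp
  then show ?thesis by (simp add: additive.sum[OF form_additive] form_zscale)
qed

lemma hform_to_h_basis: "hform B (to_h \<alpha>) (basis_vec b) = of_int (B \<alpha> b)"
proof -
  have "Poly_Mapping.lookup (to_h \<alpha>) x = 0" if "x \<notin> zbasis" for x
    using that unfolding to_h_def lookup_sum by (intro sum.neutral) (auto simp: lookup_single when_def)
  then have "Poly_Mapping.keys (to_h \<alpha>) \<subseteq> zbasis"
    by (auto simp: in_keys_iff)
  then have "(\<Sum>a\<in>Poly_Mapping.keys (to_h \<alpha>). Poly_Mapping.lookup (to_h \<alpha>) a * of_int (B a b))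
      = (\<Sum>a\<in>zbasis. Poly_Mapping.lookup (to_h \<alpha>) a * of_int (B a b))"
    by (rule sum.mono_neutral_left[OF finite_zbasis]) (simp add: in_keys_iff)
  moreover have "hform B (to_h \<alpha>) (basis_vec b) = (\<Sum>a\<in>Poly_Mapping.keys (to_h \<alpha>). Poly_Mapping.lookup (to_h \<alpha>) a * of_int (B a b))"
    by (simp add: hform_def)
  ultimately have "hform B (to_h \<alpha>) (basis_vec b) = (\<Sum>a\<in>zbasis. Poly_Mapping.lookup (to_h \<alpha>) a * of_int (B a b))"
    by (rule trans[rotated])
  then show ?thesis by (simp add: lookup_to_h form_expand[of \<alpha> b])
qed

end

locale lattice_module = even_form B for B :: "'l::fg_free_ab_group \<Rightarrow> 'l \<Rightarrow> int" +
  fixes YM :: "'l bl \<Rightarrow> 'l bl \<Rightarrow> int \<Rightarrow> 'l bl"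
  assumes module_map: "is_bl_module_map B YM"
begin

interpretation M: nonlocal_vertex_algebra_module cscale UNIV "bl_Y trivial_cocycle" "e_elt 0" cscale UNIV YM
  using module_map unfolding is_bl_module_map_def by blast

lemma YM_e_elt: "YM (e_elt \<alpha>) v n = Sum_any (\<lambda>N::nat. E_plus B (- \<alpha>) N (x_pow_zero_mode B \<alpha> v (n + int N)))"
  using module_map unfolding is_bl_module_map_def by blast

lemma YM_weak_assoc: "\<exists>l. mult_binomial cscale 1 l (subst_add cscale (\<lambda>a b. YM u (YM v w b) a))
     = mult_binomial cscale 1 l (\<lambda>a b. YM (bl_Y trivial_cocycle u v a) w b)"
  by (rule M.YW_weak_assoc) simp_all

lemma clinear_YM_left: "clinear (\<lambda>h. YM h v n)" and clinear_YM_right: "clinear (\<lambda>v. YM h v n)"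
  by (simp_all add: clinear_def additive_def M.YW_add_left M.YW_scale_left M.YW_add_right M.YW_scale_right)

definition YM_series :: "'l bl \<Rightarrow> 'l bl \<Rightarrow> 'l bl fls" where
  "YM_series h v = Abs_fls (YM h v)"

lemma YM_series_nth [simp]: "YM_series h v $$ n = YM h v n"
  unfolding YM_series_def by (rule nth_Abs_fls_ex_lower_bound) (rule M.YW_truncated, simp_all)

text \<open>In degree \<beta> the factor x^\<alpha>(0) is the single power with exponent
  \<open>B \<alpha> \<beta>\<close>, so only one coefficient of E^+ reaches x^n.\<close>

lemma YM_e_elt_basis: "YM (e_elt \<alpha>) (basis_vec (\<beta>, m)) n =
    (if n \<le> B \<alpha> \<beta> then E_plus B (- \<alpha>) (nat (B \<alpha> \<beta> - n)) (basis_vec (\<beta>, m)) else 0)"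
proof -
  have x: "x_pow_zero_mode B \<alpha> (basis_vec (\<beta>, m)) k = (if k = B \<alpha> \<beta> then basis_vec (\<beta>, m) else 0)" for k
    by (simp add: x_pow_zero_mode_def)
  have "YM (e_elt \<alpha>) (basis_vec (\<beta>, m)) n
      = (\<Sum>N\<in>{nat (B \<alpha> \<beta> - n)}. E_plus B (- \<alpha>) N (x_pow_zero_mode B \<alpha> (basis_vec (\<beta>, m)) (n + int N)))"
    unfolding YM_e_elt by (rule Sum_any.expand_superset) (auto simp: x clinear_zero[OF clinear_E_plus] split: if_splits)
  then show ?thesis by (auto simp: x clinear_zero[OF clinear_E_plus])
qed

abbreviation Phi :: "'l \<Rightarrow> 'l bl \<Rightarrow> 'l bl fls" where
  "Phi \<alpha> \<equiv> YM_series (e_elt \<alpha>)"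

lemma additive_YM_series: "additive (YM_series h)"
  by (simp add: additive_def fls_eq_iff clinear_add[OF clinear_YM_right])

text \<open>E^+ is the exponential of derivations, hence multiplicative, and the exponents of
  x^\<alpha>(0) add up because the form is additive.\<close>

lemma Phi_mult_basis: "Phi \<alpha> (basis_vec x * basis_vec y) = Phi \<alpha> (basis_vec x) * Phi \<alpha> (basis_vec y)"
proof (rule fls_eqI)
  fix n
  obtain \<beta> m where x: "x = (\<beta>, m)" by (cases x)
  obtain \<gamma> k where y: "y = (\<gamma>, k)" by (cases y)
  let ?p = "basis_vec (\<beta>, m)" and ?q = "basis_vec (\<gamma>, k)"
  define b c where "b = B \<alpha> \<beta>" and "c = B \<alpha> \<gamma>"
  obtain M where M: "\<And>n. n<M \<Longrightarrow> Phi \<alpha> ?p $$ n = 0" by (rule fls_nth_vanishes_belowE) blast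
  obtain N where N: "\<And>n. n<N \<Longrightarrow> Phi \<alpha> ?q $$ n = 0" by (rule fls_nth_vanishes_belowE) blast
  let ?E = "E_plus B (- \<alpha>)"
  have p: "Phi \<alpha> ?p $$ i = (if i \<le> b then ?E (nat (b - i)) ?p else 0)" for i
    by (simp add: YM_e_elt_basis b_def)
  have q: "Phi \<alpha> ?q $$ i = (if i \<le> c then ?E (nat (c - i)) ?q else 0)" for i
    by (simp add: YM_e_elt_basis c_def)
  have "(Phi \<alpha> ?p * Phi \<alpha> ?q) $$ n = (\<Sum>i=M..n - N. Phi \<alpha> ?p $$ i * Phi \<alpha> ?q $$ (n - i))"
    by (rule fls_times_nth_bounds[OF M N])
  \<comment> \<open>The range M..n - N comes from lower bounds of the two series, the range n - c..b
    from their top exponents b and c. Outside either of them a factor vanishes.\<close>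
  also have "\<dots> = (\<Sum>i=n - c..b. Phi \<alpha> ?p $$ i * Phi \<alpha> ?q $$ (n - i))"
  proof (rule sum.mono_neutral_cong)
    fix i assume i: "i \<in> {n - c..b} - {M..n - N}"
    then have "i < M \<or> n - i < N" by auto
    then show "Phi \<alpha> ?p $$ i * Phi \<alpha> ?q $$ (n - i) = 0"
      using M N by (metis mult_zero_left mult_zero_right)
  next
    fix i assume i: "i \<in> {M..n - N} - {n - c..b}"
    then have "\<not> i \<le> b \<or> \<not> n - i \<le> c" by auto
    then show "Phi \<alpha> ?p $$ i * Phi \<alpha> ?q $$ (n - i) = 0"
      unfolding p q by auto
  qed auto
  also have "\<dots> = (\<Sum>i=n - c..b. ?E (nat (b - i)) ?p * ?E (nat (c - (n - i))) ?q)"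
    by (intro sum.cong refl) (unfold p q, auto)
  also have "\<dots> = (if n \<le> b + c then (\<Sum>i\<le>nat (b + c - n). ?E i ?p * ?E (nat (b + c - n) - i) ?q) else 0)"
  proof (cases "n \<le> b + c")
    case True
    have "(\<Sum>i=n - c..b. ?E (nat (b - i)) ?p * ?E (nat (c - (n - i))) ?q)
        = (\<Sum>i\<le>nat (b + c - n). ?E i ?p * ?E (nat (b + c - n) - i) ?q)"
    proof (rule sum.reindex_bij_witness[of _ "\<lambda>i. b - int i" "\<lambda>i. nat (b - i)"])
      fix i assume "i \<in> {n - c..b}"
      then have "nat (b + c - n) - nat (b - i) = nat (c - (n - i))" by auto
      then show "?E (nat (b - i)) ?p * ?E (nat (b + c - n) - nat (b - i)) ?q = ?E (nat (b - i)) ?p * ?E (nat (c - (n - i))) ?q"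
        by simp
    qed (use True in auto)
    then show ?thesis using True by simp
  qed auto
  also have "\<dots> = Phi \<alpha> (?p * ?q) $$ n"
  proof -
    have "Phi \<alpha> (?p * ?q) $$ n = (if n \<le> b + c then ?E (nat (b + c - n)) (?p * ?q) else 0)"
      by (simp add: mult_single YM_e_elt_basis b_def c_def form_add_right)
    then show ?thesis by (simp only: E_plus_mult)
  qed
  finally show "Phi \<alpha> (basis_vec x * basis_vec y) $$ n = (Phi \<alpha> (basis_vec x) * Phi \<alpha> (basis_vec y)) $$ n"
    unfolding x y by (rule sym)
qed

end

section \<open>Linear maps with values in Laurent series\<close>

definition series_linear :: "('x vec \<Rightarrow> 'y::comm_monoid_add vec fls) \<Rightarrow> bool" where
  "series_linear f \<longleftrightarrow> additive f \<and> (\<forall>c p. f (cscale c p) = fls_const (scalar c) * f p)"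

lemma series_linear_additive: "series_linear f \<Longrightarrow> additive f"
  by (simp add: series_linear_def)

lemma series_linear_cscale: "series_linear f \<Longrightarrow> f (cscale c p) = fls_const (scalar c) * f p"
  by (simp add: series_linear_def)

lemma series_linear_iff: "series_linear f \<longleftrightarrow> (\<forall>n. clinear (\<lambda>p. f p $$ n))"
  by (auto simp: series_linear_def clinear_def additive_def fls_eq_iff cscale_conv_mult)

lemma series_linear_eqI:
  assumes "series_linear f" "series_linear g" "\<And>x. f (basis_vec x) = g (basis_vec x)"
  shows "f p = g p"
proof (rule fls_eqI)
  fix n
  show "f p $$ n = g p $$ n"
    using assms by (intro clinear_eqI[of "\<lambda>p. f p $$ n" "\<lambda>p. g p $$ n" p]) (auto simp: series_linear_iff)
qed

lemma series_linear_comp: "series_linear f \<Longrightarrow> clinear g \<Longrightarrow> series_linear (\<lambda>p. f (g p))"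
  by (simp add: series_linear_def clinear_def additive_def)

lemma series_linear_mult_left: "series_linear f \<Longrightarrow> series_linear (\<lambda>p. C * f p)"
  by (simp add: series_linear_def additive_def algebra_simps)

lemma series_linear_mult_right: "series_linear f \<Longrightarrow> series_linear (\<lambda>p. f p * C)"
  by (simp add: series_linear_def additive_def algebra_simps)

lemma series_linear_map: "clinear L \<Longrightarrow> series_linear f \<Longrightarrow> series_linear (\<lambda>p. fls_map L (f p))"
  unfolding series_linear_iff using clinear_comp[of L "\<lambda>p. f p $$ n" for n] by (simp add: clinear_zero)

lemma (in differential_algebra) series_linear_exp_series: "series_linear (exp_series d)"
  using derivation_clinear[OF derivation] exp_series_additive
  by (simp add: series_linear_def cscale_conv_mult exp_series_mult exp_series_scalar)

lemma fls_map_series_scale: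
  assumes "series_linear f"
  shows "fls_map f (fls_const (scalar c) * X) = fls_const (fls_const (scalar c)) * fls_map f X"
  by (rule fls_eqI)
    (simp add: additive_0[OF series_linear_additive[OF assms]] series_linear_cscale[OF assms] flip: cscale_conv_mult)

lemma fls_map_scale: "clinear L \<Longrightarrow> fls_map L (fls_const (scalar c) * X) = fls_const (scalar c) * fls_map L X"
  by (rule fls_eqI) (simp add: clinear_zero clinear_cscale flip: cscale_conv_mult)

definition lin_series :: "('x \<Rightarrow> 'y::comm_monoid_add vec fls) \<Rightarrow> 'x vec \<Rightarrow> 'y vec fls" where
  "lin_series f p = (\<Sum>x\<in>Poly_Mapping.keys p. fls_const (scalar (Poly_Mapping.lookup p x)) * f x)"

lemma lin_series_nth: "lin_series f p $$ n = lin_ext (\<lambda>x. f x $$ n) p"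
  by (simp add: lin_series_def lin_ext_def fls_sum_nth cscale_conv_mult)

lemma series_linear_lin_series: "series_linear (lin_series f)"
  by (simp add: series_linear_iff lin_series_nth clinear_lin_ext)

lemma lin_series_basis [simp]: "lin_series f (basis_vec x) = f x"
  by (simp add: fls_eq_iff lin_series_nth)

lemma lin_series_mult_left: "C * lin_series f p = lin_series (\<lambda>x. C * f x) p"
  by (rule series_linear_eqI[of _ _ p, OF series_linear_mult_left[OF series_linear_lin_series] series_linear_lin_series]) simp

lemma lin_series_tensor:
  assumes "\<And>q. series_linear (\<lambda>p. f p q)" "\<And>p. series_linear (\<lambda>q. f p q)"
  shows "lin_series (\<lambda>(x, y). f (basis_vec x) (basis_vec y)) (p \<otimes> q) = f p q"
proof -
  let ?l = "lin_series (\<lambda>(x, y). f (basis_vec x) (basis_vec y))"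
  have 1: "?l (basis_vec x \<otimes> q) = f (basis_vec x) q" for x
    by (rule series_linear_eqI[of _ _ q, OF series_linear_comp[OF series_linear_lin_series clinear_tensor_right] assms(2)]) simp
  show ?thesis
    by (rule series_linear_eqI[of _ _ p, OF series_linear_comp[OF series_linear_lin_series clinear_tensor_left] assms(1) 1])
qed

lemma tensor_series_eqI:
  assumes "series_linear f" "series_linear g" "\<And>p q. f (p \<otimes> q) = g (p \<otimes> q)"
  shows "f t = g t"
proof (rule series_linear_eqI[OF assms(1,2)])
  fix x :: "'a \<times> 'b"
  show "f (basis_vec x) = g (basis_vec x)"
    using assms(3)[of "basis_vec (fst x)" "basis_vec (snd x)"] by simp
qed

context lattice_module
begin

lemma series_linear_YM_series: "series_linear (YM_series h)"
  and series_linear_YM_series_left: "series_linear (\<lambda>h. YM_series h v)"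
  by (simp_all add: series_linear_iff clinear_YM_left clinear_YM_right)

lemma Phi_mult: "Phi \<alpha> (p * q) = Phi \<alpha> p * Phi \<alpha> q"
proof -
  have 1: "Phi \<alpha> (basis_vec x * q) = Phi \<alpha> (basis_vec x) * Phi \<alpha> q" for x
    by (rule series_linear_eqI[of _ _ q, OF series_linear_comp[OF series_linear_YM_series clinear_mult_left]
          series_linear_mult_left[OF series_linear_YM_series] Phi_mult_basis])
  show ?thesis
    by (rule series_linear_eqI[of _ _ p, OF series_linear_comp[OF series_linear_YM_series clinear_mult_right]
          series_linear_mult_right[OF series_linear_YM_series] 1])
qed

lemma Phi_e_elt: "YM (e_elt \<alpha>) (e_elt \<beta>) n = (if n = B \<alpha> \<beta> then e_elt \<beta> else 0)"
  unfolding e_elt_conv[of \<beta>] YM_e_elt_basis unfolding e_elt_conv[of \<beta>, symmetric] E_plus_e_elt by auto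

lemma one_tensor_hvar: "one_tensor (hvar z) = basis_vec (0, Abs_mon {#z#})"
  unfolding hvar_def single_one[symmetric] by (subst tensor_single) simp

lemma Phi_hvar:
  assumes "(b, m) \<in> zbasis \<times> {1..}"
  shows "YM (e_elt \<alpha>) (one_tensor (hvar (b, m))) n =
    (if n = 0 then one_tensor (hvar (b, m)) else if n = - int m then scalar (- of_int (B \<alpha> b)) else 0)"
proof -
  have "YM (e_elt \<alpha>) (one_tensor (hvar (b, m))) n =
      (if n \<le> 0 then E_plus B (- \<alpha>) (nat (- n)) (one_tensor (hvar (b, m))) else 0)"
    unfolding one_tensor_hvar YM_e_elt_basis by simp
  then show ?thesis
    using assms unfolding E_plus_hvar[OF assms] hform_to_h_basis form_minus_left by auto
qed

lemma Phi_hneg: "YM (e_elt \<alpha>) (hneg_bl \<beta> 1) n =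
    (if n = 0 then hneg_bl \<beta> 1 else if n = -1 then scalar (- of_int (B \<alpha> \<beta>)) else 0)"
proof -
  have e: "YM (e_elt \<alpha>) (hneg_bl \<beta> 1) n = (\<Sum>b\<in>zbasis. cscale (of_int (zcoord \<beta> b))
      (if n = 0 then one_tensor (hvar (b, 1)) else if n = -1 then scalar (- of_int (B \<alpha> b)) else 0))"
    unfolding hneg_def clinear_sum[OF clinear_tensor_right] clinear_cscale[OF clinear_tensor_right]
      clinear_sum[OF clinear_YM_right] clinear_cscale[OF clinear_YM_right]
    by (intro sum.cong refl) (simp add: Phi_hvar lookup_to_h del: cscale_single)
  have h: "hneg_bl \<beta> 1 = (\<Sum>b\<in>zbasis. cscale (of_int (zcoord \<beta> b)) (one_tensor (hvar (b, 1))))"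
    unfolding hneg_def clinear_sum[OF clinear_tensor_right] clinear_cscale[OF clinear_tensor_right]
    by (intro sum.cong refl) (simp add: lookup_to_h)
  have "(scalar (- of_int (B \<alpha> \<beta>)) :: 'l bl) = (\<Sum>b\<in>zbasis. cscale (of_int (zcoord \<beta> b)) (scalar (- of_int (B \<alpha> b))))"
    unfolding form_commute[of \<alpha> \<beta>] form_expand[of \<beta> \<alpha>]
    using additive.sum[of "scalar :: _ \<Rightarrow> 'l bl" "\<lambda>b. - (of_int (zcoord \<beta> b) * of_int (B \<alpha> b))" zbasis]
    by (simp add: additive_def single_add form_commute[of _ \<alpha>] sum_negf del: single_uminus)
  then show ?thesis unfolding e using h by auto
qed

lemma fls_map_derivation_mult:
  assumes "derivation \<kappa> d"
  shows "fls_map d (f * g) = fls_map d f * g + f * fls_map d (g :: 'a::comm_ring_1 fls)"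
proof (rule fls_eqI)
  fix n
  have add: "additive d" using assms by (simp add: derivation_def)
  obtain M where M: "\<And>n. n<M \<Longrightarrow> f $$ n = 0" by (rule fls_nth_vanishes_belowE) blast
  obtain N where N: "\<And>n. n<N \<Longrightarrow> g $$ n = 0" by (rule fls_nth_vanishes_belowE) blast
  show "fls_map d (f * g) $$ n = (fls_map d f * g + f * fls_map d g) $$ n"
    by (simp add: additive_0[OF add] M N fls_times_nth_bounds[of M _ N] additive.sum[OF add]
        derivation_mult[OF assms] sum.distrib)
qed

text \<open>Both sides are derivations along the multiplicative \<Phi>, so generators suffice. For
  b(-m), which \<Phi> sends to b(-m) - \<langle>\<alpha>,b\<rangle> x^(-m), the derivative of the
  correction term cancels the correction in \<Phi>(m b(-m-1)). For e_\<beta> the derivative of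
  x^\<langle>\<alpha>,\<beta>\<rangle> cancels the correction to \<beta>(-1).\<close>

lemma Phi_deriv: "fls_map bl_Lm1 (Phi \<alpha> p) = Phi \<alpha> (bl_Lm1 p) + fls_deriv (Phi \<alpha> p)"
proof (induction p rule: bl_induct)
  case (scalar c)
  have "YM (e_elt \<alpha>) (scalar c) n = (if n = 0 then scalar c else 0)" for n
    using Phi_e_elt[of \<alpha> 0 n] clinear_cscale[OF clinear_YM_right, of "e_elt \<alpha>" c 1 n]
    by (simp add: one_tensor_one flip: scalar_conv_cscale)
  then show ?case
  proof -
    have "Phi \<alpha> (scalar c) = fls_const (scalar c)"
      by (simp add: fls_eq_iff \<open>\<And>n. YM (e_elt \<alpha>) (scalar c) n = _\<close>)
    then show ?thesis
      by (simp add: fls_map_const bl_Lm1_zero derivation_scalar[OF derivation_bl_Lm1]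
          additive_0[OF additive_YM_series])
  qed
next
  case (e_elt \<beta>)
  have a: "Phi \<alpha> (bl_Lm1 (e_elt \<beta>)) = Phi \<alpha> (hneg_bl \<beta> 1) * Phi \<alpha> (e_elt \<beta>)"
    by (simp only: bl_Lm1_e_elt Phi_mult)
  have b: "(Phi \<alpha> (hneg_bl \<beta> 1) * Phi \<alpha> (e_elt \<beta>)) $$ n = Phi \<alpha> (hneg_bl \<beta> 1) $$ (n - B \<alpha> \<beta>) * e_elt \<beta>" for n
  proof -
    have "Phi \<alpha> (e_elt \<beta>) = fls_shift (- B \<alpha> \<beta>) (fls_const (e_elt \<beta>))"
      by (simp add: fls_eq_iff Phi_e_elt)
    then have e: "Phi \<alpha> (e_elt \<beta>) = fls_shift (- B \<alpha> \<beta>) (fls_const (e_elt \<beta>))" .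
    show ?thesis unfolding e fls_shifted_times_simps(1) by simp
  qed
  have r: "YM (e_elt \<alpha>) (bl_Lm1 (e_elt \<beta>)) n = (if n = B \<alpha> \<beta> then bl_Lm1 (e_elt \<beta>) else
      if n = B \<alpha> \<beta> - 1 then scalar (- of_int (B \<alpha> \<beta>)) * e_elt \<beta> else 0)" for n
  proof -
    have "YM (e_elt \<alpha>) (bl_Lm1 (e_elt \<beta>)) n = YM (e_elt \<alpha>) (hneg_bl \<beta> 1) (n - B \<alpha> \<beta>) * e_elt \<beta>"
      using b a by (metis YM_series_nth)
    also have "\<dots> = (if n = B \<alpha> \<beta> then hneg_bl \<beta> 1 else if n = B \<alpha> \<beta> - 1 then scalar (- of_int (B \<alpha> \<beta>)) else 0) * e_elt \<beta>"
      unfolding Phi_hneg by (intro arg_cong2[where f = "(*)"] if_cong refl) auto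
    finally show ?thesis unfolding bl_Lm1_e_elt by (auto simp only: if_distrib[of "\<lambda>x. x * _"] mult_zero_left)
  qed
  show ?case
  proof (rule fls_eqI)
    fix n
    show "fls_map bl_Lm1 (Phi \<alpha> (e_elt \<beta>)) $$ n = (Phi \<alpha> (bl_Lm1 (e_elt \<beta>)) + fls_deriv (Phi \<alpha> (e_elt \<beta>))) $$ n"
      unfolding fls_plus_nth fls_deriv_nth YM_series_nth r Phi_e_elt fls_map_nth[where \<phi> = bl_Lm1, OF bl_Lm1_zero]
      by (cases "n = B \<alpha> \<beta>"; cases "n + 1 = B \<alpha> \<beta>")
        (simp_all add: bl_Lm1_zero single_uminus del: of_int_add)
  qed
next
  case (hvar z)
  obtain b m where z: "z = (b, m)" by (cases z)
  have z': "(b, m + 1) \<in> zbasis \<times> {1..}" "(b, m) \<in> zbasis \<times> {1..}" using hvar z by auto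
  show ?case
  proof (rule fls_eqI)
    fix n
    have r: "YM (e_elt \<alpha>) (bl_Lm1 (one_tensor (hvar z))) n =
       (if n = 0 then bl_Lm1 (one_tensor (hvar z)) else if n = - int m - 1 then scalar (- of_int (int m * B \<alpha> b)) else 0)"
      unfolding z bl_Lm1_hvar[OF z'(2)] clinear_cscale[OF clinear_YM_right] Phi_hvar[OF z'(1)] by simp
    have m: "m \<ge> 1" using z' by simp
    have l: "fls_deriv (Phi \<alpha> (one_tensor (hvar z))) $$ n = (if n = - int m - 1 then scalar (of_int (int m * B \<alpha> b)) else 0)"
    proof (cases "n = - int m - 1")
      case True
      then have "of_int (n + 1) * (scalar (- of_int (B \<alpha> b)) :: 'l bl) = scalar (of_int (int m * B \<alpha> b))"
        unfolding of_int_mult_conv_cscale by simp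
      then show ?thesis using True m unfolding fls_deriv_nth YM_series_nth z Phi_hvar[OF z'(2)] by auto
    next
      case False
      then show ?thesis unfolding fls_deriv_nth YM_series_nth z Phi_hvar[OF z'(2)]
        by (cases "n = -1") auto
    qed
    have s: "bl_Lm1 (scalar c) = 0" for c :: complex
      by (rule derivation_scalar[OF derivation_bl_Lm1])
    have l0: "bl_Lm1 (YM (e_elt \<alpha>) (one_tensor (hvar z)) n) = (if n = 0 then bl_Lm1 (one_tensor (hvar z)) else 0)"
      unfolding z Phi_hvar[OF z'(2)]
      by (cases "n = 0"; cases "n = - int m") (simp_all only: simp_thms if_True if_False s bl_Lm1_zero)
    show "fls_map bl_Lm1 (Phi \<alpha> (one_tensor (hvar z))) $$ n
        = (Phi \<alpha> (bl_Lm1 (one_tensor (hvar z))) + fls_deriv (Phi \<alpha> (one_tensor (hvar z)))) $$ n"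
      unfolding fls_plus_nth l YM_series_nth r fls_map_nth[where \<phi> = bl_Lm1, OF bl_Lm1_zero] l0
      using m by (cases "n = 0"; cases "n = - int m - 1") (simp_all add: single_uminus)
  qed
next
  case (add p q)
  then show ?case
    by (simp add: additive.add[OF additive_YM_series] clinear_add[OF clinear_bl_Lm1]
        fls_map_add[OF clinear_additive[OF clinear_bl_Lm1]])
next
  case (mult p q)
  then show ?case
    by (simp add: Phi_mult fls_map_derivation_mult[OF derivation_bl_Lm1] derivation_mult[OF derivation_bl_Lm1]
        additive.add[OF additive_YM_series] algebra_simps)
qed

text \<open>\<Phi> on the first tensor factor: since e^\<alpha> is group-like, this is how Y_M
  enters the operator of e_\<alpha> \<otimes> e^\<alpha> on the smash product.\<close>

definition Phi2 :: "'l \<Rightarrow> 'l bl2 \<Rightarrow> 'l bl2 fls" where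
  "Phi2 \<alpha> = lin_series (\<lambda>(x, y). fls_map (\<lambda>u. u \<otimes> basis_vec y) (Phi \<alpha> (basis_vec x)))"

lemma series_linear_Phi2: "series_linear (Phi2 \<alpha>)"
  unfolding Phi2_def by (rule series_linear_lin_series)

lemma Phi2_tensor: "Phi2 \<alpha> (p \<otimes> q) = fls_map (\<lambda>u. u \<otimes> q) (Phi \<alpha> p)"
  unfolding Phi2_def
proof (rule lin_series_tensor)
  show "series_linear (\<lambda>p. fls_map (\<lambda>u. u \<otimes> q) (Phi \<alpha> p))" for q :: "'l bl"
    by (rule series_linear_map[OF clinear_tensor_left series_linear_YM_series])
  show "series_linear (\<lambda>q. fls_map (\<lambda>u. u \<otimes> q) (Phi \<alpha> p))" for p
    by (simp add: series_linear_iff tensor_zero_left clinear_tensor_right)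
qed

lemma fls_map_tensor_const:
  "fls_map (\<lambda>u. u \<otimes> q) f = fls_map (\<lambda>u. u \<otimes> 1) f * fls_const (1 \<otimes> (q :: 'y::comm_monoid_add \<Rightarrow>\<^sub>0 complex))"
  for f :: "'x::comm_monoid_add vec fls"
  by (simp add: fls_eq_iff tensor_zero_left tensor_mult)

lemma Phi2_mult: "Phi2 \<alpha> (s * t) = Phi2 \<alpha> s * Phi2 \<alpha> t"
proof -
  have m: "fls_map (\<lambda>u. u \<otimes> (1 :: 'l bl)) (f * g) = fls_map (\<lambda>u. u \<otimes> 1) f * fls_map (\<lambda>u. u \<otimes> 1) g" for f g :: "'l bl fls"
    by (rule fls_map_mult[OF clinear_additive[OF clinear_tensor_left]]) (simp add: tensor_mult)
  have 1: "Phi2 \<alpha> ((p \<otimes> q) * (p' \<otimes> q')) = Phi2 \<alpha> (p \<otimes> q) * Phi2 \<alpha> (p' \<otimes> q')" for p q p' q'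
  proof -
    have c: "fls_const (1 \<otimes> (q * q')) = fls_const (1 \<otimes> q) * (fls_const (1 \<otimes> q') :: 'l bl2 fls)"
      by (simp add: fls_const_mult_const tensor_mult)
    show ?thesis
      unfolding tensor_mult Phi2_tensor
      unfolding fls_map_tensor_const[of "_ * _"] fls_map_tensor_const[of q] fls_map_tensor_const[of q'] Phi_mult m c
      by (simp only: ac_simps)
  qed
  have 2: "Phi2 \<alpha> ((p \<otimes> q) * t) = Phi2 \<alpha> (p \<otimes> q) * Phi2 \<alpha> t" for p q
    by (rule tensor_series_eqI[of _ _ t, OF series_linear_comp[OF series_linear_Phi2 clinear_mult_left]
          series_linear_mult_left[OF series_linear_Phi2] 1])
  show ?thesis
    by (rule tensor_series_eqI[of _ _ s, OF series_linear_comp[OF series_linear_Phi2 clinear_mult_right]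
          series_linear_mult_right[OF series_linear_Phi2] 2])
qed

lemma Phi2_deriv: "fls_map bl2_Lm1 (Phi2 \<alpha> t) = Phi2 \<alpha> (bl2_Lm1 t) + fls_deriv (Phi2 \<alpha> t)"
proof (rule tensor_series_eqI[of _ _ t])
  have D: "clinear (bl2_Lm1 :: 'l bl2 \<Rightarrow> _)" by (rule derivation_clinear[OF derivation_bl2_Lm1])
  show "series_linear (\<lambda>t. fls_map bl2_Lm1 (Phi2 \<alpha> t))"
    by (rule series_linear_map[OF D series_linear_Phi2])
  show "series_linear (\<lambda>t. Phi2 \<alpha> (bl2_Lm1 t) + fls_deriv (Phi2 \<alpha> t))"
    using series_linear_Phi2 D
    by (simp add: series_linear_def additive_def clinear_def algebra_simps)
  fix p q :: "'l bl"
  have "Phi \<alpha> (bl_Lm1 p) $$ n = bl_Lm1 (Phi \<alpha> p $$ n) - fls_deriv (Phi \<alpha> p) $$ n" for n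
    using Phi_deriv[of \<alpha> p] by (simp add: fls_eq_iff bl_Lm1_zero algebra_simps)
  moreover have "(of_int k * u) \<otimes> q = of_int k * (u \<otimes> q)" for k and u :: "'l bl"
    by (simp only: of_int_mult_conv_cscale tensor_cscale_left)
  ultimately show "fls_map bl2_Lm1 (Phi2 \<alpha> (p \<otimes> q)) = Phi2 \<alpha> (bl2_Lm1 (p \<otimes> q)) + fls_deriv (Phi2 \<alpha> (p \<otimes> q))"
    unfolding bl2_Lm1_tensor additive.add[OF series_linear_additive[OF series_linear_Phi2]] Phi2_tensor
    by (simp add: fls_eq_iff clinear_zero[OF D] tensor_zero_left bl2_Lm1_tensor
        additive.diff[OF clinear_additive[OF clinear_tensor_left]] del: of_int_add)
qed

lemma conformal_hom_Phi2: "conformal_hom bl2_Lm1 (Phi2 \<alpha>)"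
proof (intro conformal_hom.intro conformal_hom_axioms.intro)
  show "additive (Phi2 \<alpha>)" by (rule series_linear_additive[OF series_linear_Phi2])
  show "Phi2 \<alpha> (scalar c * p) = fls_const (scalar c) * Phi2 \<alpha> p" for c p
    using series_linear_cscale[OF series_linear_Phi2] by (simp add: cscale_conv_mult)
qed (rule bl2.differential_algebra_axioms Phi2_mult Phi2_deriv)+

text \<open>\<Phi> only changes e_\<beta> by a power of x and a variable by a scalar. The variable
  being primitive, the scalar appears once whether \<Phi> acts before \<Delta> or afterwards on the
  first factor. Multiplicativity gives the rest.\<close>

lemma Phi2_pi_map: "Phi2 \<alpha> (pi_map p) = fls_map pi_map (Phi \<alpha> p)"
proof (induction p rule: bl_induct)
  case (scalar c)
  have "YM (e_elt \<alpha>) 1 n = (if n = 0 then 1 else 0)" for n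
    using Phi_e_elt[of \<alpha> 0 n] by (simp add: one_tensor_one)
  then have "Phi2 \<alpha> (1 \<otimes> 1) = 1" "Phi \<alpha> 1 = 1" unfolding Phi2_tensor
    by (auto simp: fls_eq_iff tensor_zero_left one_tensor_one)
  then show ?case
    using series_linear_cscale[OF series_linear_Phi2, of \<alpha> c 1] series_linear_cscale[OF series_linear_YM_series, of "e_elt \<alpha>" c 1]
    by (simp add: pi_map_scalar one_tensor_one fls_map_const pi_map_zero flip: scalar_conv_cscale)
next
  case (e_elt \<beta>)
  show ?case unfolding pi_map_e_elt Phi2_tensor
    by (auto simp: fls_eq_iff tensor_zero_left pi_map_zero Phi_e_elt pi_map_e_elt)
next
  case (hvar z)
  obtain b m where z: "z = (b, m)" by (cases z)
  have z': "(b, m) \<in> zbasis \<times> {1..}" using hvar z by auto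
  have 1: "YM (e_elt \<alpha>) 1 n = (if n = 0 then 1 else 0)" for n
    using Phi_e_elt[of \<alpha> 0 n] by (simp add: one_tensor_one)
  have st: "scalar c \<otimes> 1 = (scalar c :: 'l bl2)" for c
    by (simp add: scalar_conv_cscale tensor_cscale_left one_tensor_one del: cscale_single)
  show ?case
    unfolding pi_map_hvar[OF hvar] additive.add[OF series_linear_additive[OF series_linear_Phi2]] Phi2_tensor
    using z' by (auto simp: fls_eq_iff tensor_zero_left pi_map_zero z
        Phi_hvar[OF z'] 1 pi_map_hvar[OF z'] pi_map_scalar st simp del: single_of_int single_uminus)
next
  case (add p q)
  then show ?case
    by (simp add: pi_map_add additive.add[OF series_linear_additive[OF series_linear_Phi2]]
        additive.add[OF additive_YM_series] fls_map_add[OF additive_pi_map])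
next
  case (mult p q)
  then show ?case
    by (simp add: pi_map_mult Phi2_mult Phi_mult fls_map_mult[OF additive_pi_map pi_map_mult])
qed

end

subsection \<open>Twisting by the cocycle\<close>

text \<open>With g = \<epsilon> \<beta> on the L-degree this carries the whole noncommutativity of
  the twisted product; see \<open>bl_mult_homog\<close>. All other products are taken in commutative
  algebras.\<close>

definition twist :: "('x \<Rightarrow> complex) \<Rightarrow> 'x vec \<Rightarrow> 'x vec" where
  "twist g = lin_ext (\<lambda>x. cscale (g x) (basis_vec x))"

lemma clinear_twist: "clinear (twist g)"
  unfolding twist_def by (rule clinear_lin_ext)

lemma twist_zero: "twist g 0 = 0"
  by (rule clinear_zero[OF clinear_twist])

lemma twist_basis [simp]: "twist g (basis_vec x) = Poly_Mapping.single x (g x)"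
  by (simp add: twist_def)

lemma twist_twist: "twist g (twist h p) = twist (\<lambda>x. g x * h x) p"
  by (rule clinear_eqI[of _ _ p, OF clinear_comp[OF clinear_twist clinear_twist] clinear_twist])
    (simp add: twist_def mult.commute)

lemma clinear_cscale_fun: "clinear f \<Longrightarrow> clinear (\<lambda>p. cscale c (f p))"
  by (simp add: clinear_def additive_def cvec.scale_right_distrib mult.commute)

lemma twist_cscale: "twist (\<lambda>x. c * g x) p = cscale c (twist g p)"
  by (rule clinear_eqI[of _ _ p, OF clinear_twist clinear_cscale_fun[OF clinear_twist]]) simp

lemma twist_tensor: "twist (\<lambda>x. g (fst x)) (p \<otimes> q) = twist g p \<otimes> q"
proof -
  have 1: "twist (\<lambda>x. g (fst x)) (basis_vec x \<otimes> q) = twist g (basis_vec x) \<otimes> q" for x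
    by (rule clinear_eqI[of _ _ q, OF clinear_comp[OF clinear_twist clinear_tensor_right] clinear_tensor_right]) simp
  show ?thesis
    by (rule clinear_eqI[of _ _ p, OF clinear_comp[OF clinear_twist clinear_tensor_left]
          clinear_comp[OF clinear_tensor_left clinear_twist]]) (rule 1)
qed

lemma twist_mult_basis:
  fixes t :: "'x::comm_monoid_add vec"
  assumes "\<And>y. g (x + y) = g' y"
  shows "twist g (basis_vec x * t) = basis_vec x * twist g' t"
  by (rule clinear_eqI[of _ _ t, OF clinear_comp[OF clinear_twist clinear_mult_left]
        clinear_comp[OF clinear_mult_left clinear_twist]])
    (simp add: mult_single assms)

definition homog :: "'x \<Rightarrow> ('x \<times> 'y) vec \<Rightarrow> bool" where
  "homog \<beta> p \<longleftrightarrow> (\<exists>u. p = basis_vec \<beta> \<otimes> u)"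

lemma homog_tensor: "homog \<beta> (basis_vec \<beta> \<otimes> u)"
  unfolding homog_def by blast

lemma homog_0: "homog \<beta> 0"
  unfolding homog_def using tensor_zero_right by metis

lemma homog_add: "homog \<beta> p \<Longrightarrow> homog \<beta> q \<Longrightarrow> homog \<beta> (p + q)"
  unfolding homog_def using tensor_add_right by metis

lemma homog_cscale: "homog \<beta> p \<Longrightarrow> homog \<beta> (cscale c p)"
  unfolding homog_def using tensor_cscale_right by metis

lemma homog_sum: "(\<And>x. x \<in> A \<Longrightarrow> homog \<beta> (f x)) \<Longrightarrow> homog \<beta> (sum f A)"
  by (induction A rule: infinite_finite_induct) (auto intro: homog_0 homog_add)

lemma homog_mult: "homog \<beta> p \<Longrightarrow> homog \<gamma> q \<Longrightarrow> homog (\<beta> + \<gamma>) (p * q)"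
  for p q :: "('x::comm_monoid_add \<times> 'y::comm_monoid_add) vec"
  unfolding homog_def using tensor_basis_mult by metis

lemma homog_twist: "homog \<beta> p \<Longrightarrow> twist (\<lambda>x. g (fst x)) p = cscale (g \<beta>) p"
  unfolding homog_def
  by (metis twist_tensor twist_basis mult.right_neutral cscale_single tensor_cscale_left)

lemma homog_bl_Lm1: "homog \<beta> p \<Longrightarrow> homog \<beta> (bl_Lm1 p)"
  unfolding homog_def by (metis bl_Lm1_tensor tensor_add_right)

lemma homog_divided_power: "homog \<beta> p \<Longrightarrow> homog \<beta> (divided_power bl_Lm1 n p)"
proof -
  assume "homog \<beta> p"
  then have "homog \<beta> ((bl_Lm1 ^^ n) p)"
    by (induction n) (simp_all add: homog_bl_Lm1)
  then show ?thesis
    unfolding divided_power_def cscale_conv_mult[symmetric] by (rule homog_cscale)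
qed

lemma homog_E_plus: "homog \<beta> p \<Longrightarrow> homog \<beta> (E_plus B \<alpha> N p)"
proof -
  assume p: "homog \<beta> p"
  have A: "homog \<beta> (E_plus_arg B \<alpha> n q)" if q: "homog \<beta> q" for n q
  proof (cases "n = 0")
    case False
    obtain u where u: "q = basis_vec \<beta> \<otimes> u" using q unfolding homog_def by blast
    show ?thesis unfolding u E_plus_arg_tensor[OF False[unfolded neq0_conv]]
      by (rule homog_cscale[OF homog_tensor])
  qed (simp add: homog_0)
  have pw: "homog \<beta> (op_series_power (E_plus_arg B \<alpha>) k N p)" for k N
  proof (induction k arbitrary: N)
    case (Suc k)
    show ?case unfolding op_series_power.simps op_series_mult_def by (rule homog_sum) (rule A[OF Suc])
  qed (simp add: p homog_0)
  show ?thesis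
    unfolding E_plus_def op_series_exp_def by (rule homog_sum, rule homog_cscale, rule pw)
qed

lemma clinear_bl_mult_left: "clinear (\<lambda>p. bl_mult \<epsilon> p q)" and clinear_bl_mult_right: "clinear (\<lambda>q. bl_mult \<epsilon> p q)"
  unfolding bl_mult_def by (rule clinear_comp[OF clinear_lin_ext clinear_tensor_left] clinear_comp[OF clinear_lin_ext clinear_tensor_right])+

lemma bl_mult_homog:
  assumes "homog \<beta> p"
  shows "bl_mult \<epsilon> p q = p * twist (\<lambda>x. \<epsilon> \<beta> (fst x)) q"
proof -
  obtain u where u: "p = basis_vec \<beta> \<otimes> u" using assms unfolding homog_def by blast
  have 1: "bl_mult \<epsilon> (basis_vec \<beta> \<otimes> basis_vec m) q = (basis_vec \<beta> \<otimes> basis_vec m) * twist (\<lambda>x. \<epsilon> \<beta> (fst x)) q" for m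
    by (rule clinear_eqI[of _ _ q, OF clinear_bl_mult_right clinear_comp[OF clinear_mult_left clinear_twist]])
      (simp add: bl_mult_def split_beta mult_single plus_prod_def)
  show ?thesis unfolding u
    by (rule clinear_eqI[of _ _ u, OF clinear_comp[OF clinear_bl_mult_left clinear_tensor_right]
          clinear_comp[OF clinear_mult_right clinear_tensor_right]]) (rule 1)
qed

lemma bl_mult_trivial: "bl_mult trivial_cocycle p q = p * q"
proof -
  have 1: "bl_mult trivial_cocycle (basis_vec x) q = basis_vec x * q" for x
    by (rule clinear_eqI[of _ _ q, OF clinear_bl_mult_right clinear_mult_left])
      (simp add: bl_mult_def split_beta mult_single plus_prod_def)
  show ?thesis
    by (rule clinear_eqI[of _ _ p, OF clinear_bl_mult_left clinear_mult_right]) (rule 1)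
qed

text \<open>L(-1) preserves the L-degree, so every coefficient of e^(x L(-1)) u meets the same
  cocycle factor.\<close>

lemma bl_Y_homog:
  assumes "homog \<beta> u"
  shows "bl_Y \<epsilon> u w n = exp_series bl_Lm1 u $$ n * twist (\<lambda>x. \<epsilon> \<beta> (fst x)) w"
proof -
  have "homog \<beta> ((bl_Lm1 ^^ k) u)" for k
    using assms by (induction k) (simp_all add: homog_bl_Lm1)
  then show ?thesis
    by (simp add: bl_Y_def differential_algebra_Y_def bl_mult_homog[where \<beta> = \<beta>] bl.exp_series_nth divided_power_def
        cscale_conv_mult mult.assoc)
qed

lemma bl_Y_trivial: "bl_Y trivial_cocycle u w n = exp_series bl_Lm1 u $$ n * w"
  by (simp add: bl_Y_def differential_algebra_Y_def bl_mult_trivial bl.exp_series_nth divided_power_def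
        cscale_conv_mult mult.assoc)

subsection \<open>Exponentials on the tensor square\<close>

lemma divided_power_bl2_left: "divided_power bl2_Lm1 n (p \<otimes> 1) = divided_power bl_Lm1 n p \<otimes> 1"
proof -
  have "(bl2_Lm1 ^^ n) (p \<otimes> 1) = (bl_Lm1 ^^ n) p \<otimes> 1"
    by (induction n) (simp_all add: bl2_Lm1_tensor derivation_1[OF derivation_bl_Lm1] tensor_zero_right)
  then show ?thesis by (simp add: divided_power_def tensor_cscale_left flip: cscale_conv_mult)
qed

lemma divided_power_bl2_right: "divided_power bl2_Lm1 n (1 \<otimes> q) = 1 \<otimes> divided_power bl_Lm1 n q"
proof -
  have "(bl2_Lm1 ^^ n) (1 \<otimes> q) = 1 \<otimes> (bl_Lm1 ^^ n) q"
    by (induction n) (simp_all add: bl2_Lm1_tensor derivation_1[OF derivation_bl_Lm1] tensor_zero_left)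
  then show ?thesis by (simp add: divided_power_def tensor_cscale_right flip: cscale_conv_mult)
qed

lemma tensor_conv_mult: "p \<otimes> q = (p \<otimes> 1) * (1 \<otimes> q)"
  for p :: "'x::comm_monoid_add vec" and q :: "'y::comm_monoid_add vec"
  by (simp add: tensor_mult)

lemma divided_power_bl2_tensor:
  "divided_power bl2_Lm1 n (p \<otimes> q) = (\<Sum>i\<le>n. divided_power bl_Lm1 i p \<otimes> divided_power bl_Lm1 (n - i) q)"
proof -
  have "divided_power bl2_Lm1 n ((p \<otimes> 1) * (1 \<otimes> q)) = (\<Sum>i\<le>n. divided_power bl_Lm1 i p \<otimes> divided_power bl_Lm1 (n - i) q)"
    unfolding bl2.divided_power_mult divided_power_bl2_left divided_power_bl2_right by (simp add: tensor_mult)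
  then show ?thesis by (simp only: tensor_conv_mult[of p q])
qed

lemma exp_series_bl2_left: "exp_series bl2_Lm1 (p \<otimes> 1) = fls_map (\<lambda>u. u \<otimes> 1) (exp_series bl_Lm1 p)"
  by (simp add: fls_eq_iff tensor_zero_left bl.exp_series_nth bl2.exp_series_nth divided_power_bl2_left)

lemma exp_series_bl2_right: "exp_series bl2_Lm1 (1 \<otimes> q) = fls_map (\<lambda>u. 1 \<otimes> u) (exp_series bl_Lm1 q)"
  by (simp add: fls_eq_iff tensor_zero_right bl.exp_series_nth bl2.exp_series_nth divided_power_bl2_right)

lemma exp_series_bl2_tensor: "exp_series bl2_Lm1 (p \<otimes> q) = exp_series bl2_Lm1 (p \<otimes> 1) * exp_series bl2_Lm1 (1 \<otimes> q)"
  by (subst tensor_conv_mult) (rule bl2.exp_series_mult)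

lemma exp_series_pi_map: "fls_map pi_map (exp_series bl_Lm1 p) = exp_series bl2_Lm1 (pi_map p)"
proof -
  have "pi_map ((bl_Lm1 ^^ n) p) = (bl2_Lm1 ^^ n) (pi_map p)" for n
    by (induction n) (simp_all add: pi_map_bl_Lm1)
  then have "pi_map (divided_power bl_Lm1 n p) = divided_power bl2_Lm1 n (pi_map p)" for n
    by (simp add: divided_power_def pi_map_cscale flip: cscale_conv_mult)
  then show ?thesis
    by (simp add: fls_eq_iff pi_map_zero bl.exp_series_nth bl2.exp_series_nth)
qed

lemma (in differential_algebra) exp_series_mult_nth:
  assumes f: "\<And>j. j < M \<Longrightarrow> f $$ j = 0" and K: "n - int K \<le> M"
  shows "(exp_series d p * f) $$ n = (\<Sum>i\<le>K. divided_power d i p * f $$ (n - int i))"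
proof -
  have "(exp_series d p * f) $$ n = (\<Sum>i=0..n - M. exp_series d p $$ i * f $$ (n - i))"
    by (rule fls_times_nth_bounds) (simp_all add: exp_series_nth f)
  also have "\<dots> = (\<Sum>i=0..int K. exp_series d p $$ i * f $$ (n - i))"
    by (rule sum.mono_neutral_left) (use K in \<open>auto simp: f\<close>)
  also have "\<dots> = (\<Sum>i\<le>K. divided_power d i p * f $$ (n - int i))"
    by (rule sum.reindex_bij_witness[of _ int nat]) (auto simp: exp_series_nth)
  finally show ?thesis .
qed

subsection \<open>The smash product as series\<close>

definition series2_linear :: "('x vec \<Rightarrow> 'y::comm_monoid_add vec fls fls) \<Rightarrow> bool" where
  "series2_linear f \<longleftrightarrow> additive f \<and> (\<forall>c p. f (cscale c p) = fls_const (fls_const (scalar c)) * f p)"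

lemma series2_linear_map: "series_linear f \<Longrightarrow> series_linear g \<Longrightarrow> series2_linear (\<lambda>p. fls_map f (g p))"
  using fls_map_add[OF series_linear_additive, of f] additive.add[OF series_linear_additive, of g]
  by (simp add: series2_linear_def additive_def[of "\<lambda>p. fls_map f (g p)"] series_linear_cscale fls_map_series_scale)

lemma series2_linear_map_param:
  assumes "\<And>t. series_linear (\<lambda>p. f p t)" "\<And>p. series_linear (f p)"
  shows "series2_linear (\<lambda>t. fls_map (\<lambda>p. f p t) X)"
proof -
  have "fls_map (\<lambda>p. f p t) X $$ n = f (X $$ n) t" for t n
    by (rule fls_map_nth) (rule additive_0[OF series_linear_additive[OF assms(1)]])
  note nth = this
  have "f p (s + t) = f p s + f p t" "f p (cscale c t) = fls_const (scalar c) * f p t" for p s t c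
    using assms(2) by (simp_all add: series_linear_def additive_def)
  then have "fls_map (\<lambda>p. f p (s + t)) X $$ n = (fls_map (\<lambda>p. f p s) X + fls_map (\<lambda>p. f p t) X) $$ n"
      "fls_map (\<lambda>p. f p (cscale c t)) X $$ n = (fls_const (fls_const (scalar c)) * fls_map (\<lambda>p. f p t) X) $$ n" for s t c n
    unfolding nth fls_plus_nth fls_mult_const_nth by blast+
  then show ?thesis
    unfolding series2_linear_def additive_def by (blast intro: fls_eqI)
qed

lemma series2_linear_expand:
  assumes "series2_linear f"
  shows "f p = (\<Sum>x\<in>Poly_Mapping.keys p. fls_const (fls_const (scalar (Poly_Mapping.lookup p x))) * f (basis_vec x))"
proof -
  have "f q = (\<Sum>x\<in>Poly_Mapping.keys p. fls_const (fls_const (scalar (Poly_Mapping.lookup p x))) * f (basis_vec x))"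
    if "q = (\<Sum>x\<in>Poly_Mapping.keys p. cscale (Poly_Mapping.lookup p x) (basis_vec x))" for q
    using assms unfolding that by (simp only: series2_linear_def additive.sum)
  then show ?thesis using basis_expansion[of p] by blast
qed

locale lattice_smash = lattice_module B YM for B :: "'l::fg_free_ab_group \<Rightarrow> 'l \<Rightarrow> int" and YM +
  fixes \<epsilon> :: "'l \<Rightarrow> 'l \<Rightarrow> complex"
  assumes cocycle: "normalized_2_cocycle \<epsilon>"
begin

abbreviation twist2 :: "('l \<Rightarrow> complex) \<Rightarrow> 'l bl2 \<Rightarrow> 'l bl2" where
  "twist2 g \<equiv> twist (\<lambda>x. g (fst (fst x)))"

lemma twist2_tensor: "twist2 g (p \<otimes> q) = twist (\<lambda>x. g (fst x)) p \<otimes> q"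
  using twist_tensor[of "\<lambda>x. g (fst x)" p q] .

lemma YM_twist: "YM (e_elt \<alpha>) (twist (\<lambda>x. g (fst x)) w) n = twist (\<lambda>x. g (fst x)) (YM (e_elt \<alpha>) w n)"
proof (rule clinear_eqI[of _ _ w, OF clinear_comp[OF clinear_YM_right clinear_twist] clinear_comp[OF clinear_twist clinear_YM_right]])
  fix x :: "'l \<times> 'l mon"
  obtain \<beta> m where x: "x = (\<beta>, m)" by (cases x)
  have "homog \<beta> (basis_vec (\<beta>, m))"
    using homog_tensor[of \<beta> "basis_vec m"] by simp
  then have h: "homog \<beta> (YM (e_elt \<alpha>) (basis_vec (\<beta>, m)) n)"
    unfolding YM_e_elt_basis by (simp add: homog_E_plus homog_0)
  have "twist (\<lambda>x. g (fst x)) (basis_vec (\<beta>, m)) = cscale (g \<beta>) (basis_vec (\<beta>, m))"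
    by (simp add: twist_def)
  then show "YM (e_elt \<alpha>) (twist (\<lambda>x. g (fst x)) (basis_vec x)) n = twist (\<lambda>x. g (fst x)) (YM (e_elt \<alpha>) (basis_vec x) n)"
    unfolding x homog_twist[OF h] by (simp only: clinear_cscale[OF clinear_YM_right])
qed

lemma homog_YM: "homog \<beta> w \<Longrightarrow> homog \<beta> (YM (e_elt \<alpha>) w n)"
proof -
  assume "homog \<beta> w"
  then obtain u where w: "w = basis_vec \<beta> \<otimes> u" unfolding homog_def by blast
  have "clinear (\<lambda>u. YM (e_elt \<alpha>) (basis_vec \<beta> \<otimes> u) n)"
    by (rule clinear_comp[OF clinear_YM_right clinear_tensor_right])
  from clinear_eq_lin_ext[OF this, of u] have "YM (e_elt \<alpha>) w n =
      (\<Sum>m\<in>Poly_Mapping.keys u. cscale (Poly_Mapping.lookup u m) (YM (e_elt \<alpha>) (basis_vec (\<beta>, m)) n))"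
    by (simp add: w lin_ext_def)
  moreover have "homog \<beta> (basis_vec (\<beta>, m))" for m :: "'l mon"
    using homog_tensor[of \<beta> "basis_vec m"] by simp
  ultimately show ?thesis
    by (simp add: YM_e_elt_basis homog_sum homog_cscale homog_E_plus homog_0)
qed

lemma Phi2_twist2: "Phi2 \<alpha> (twist2 g t) = fls_map (twist2 g) (Phi2 \<alpha> t)"
proof (rule tensor_series_eqI[of _ _ t, OF series_linear_comp[OF series_linear_Phi2 clinear_twist]
      series_linear_map[OF clinear_twist series_linear_Phi2]])
  fix p q :: "'l bl"
  show "Phi2 \<alpha> (twist2 g (p \<otimes> q)) = fls_map (twist2 g) (Phi2 \<alpha> (p \<otimes> q))"
    unfolding twist2_tensor Phi2_tensor
    by (simp add: fls_eq_iff tensor_zero_left twist_zero twist2_tensor YM_twist)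
qed

text \<open>In \<open>Y\<^sup>\<sharp>(u \<otimes> h, x)(v \<otimes> k)\<close> with \<open>u\<close> of degree \<open>\<beta>\<close>, the contribution of
  \<open>Y\<^sub>M(a, x)v \<otimes> k\<close>, including the cocycle of the product with \<open>u\<close>.\<close>

definition act_series :: "'l \<Rightarrow> 'l bl \<Rightarrow> 'l bl \<Rightarrow> 'l bl \<Rightarrow> 'l bl2 fls" where
  "act_series \<beta> v k a = fls_map (\<lambda>w. twist2 (\<epsilon> \<beta>) (w \<otimes> k)) (YM_series a v)"

text \<open>The factor of the smash product operator that depends on h, as a linear function of the
  coproduct \<Delta>(h). It thus makes sense on any tensor and can be evaluated on one summand h1
  \<otimes> h2 at a time.\<close>

definition coact_series :: "'l \<Rightarrow> 'l bl \<Rightarrow> 'l bl \<Rightarrow> 'l bl2 \<Rightarrow> 'l bl2 fls" where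
  "coact_series \<beta> v k = lin_series (\<lambda>(x, y). exp_series bl2_Lm1 (1 \<otimes> basis_vec y) * act_series \<beta> v k (basis_vec x))"

definition smash_series :: "'l bl2 \<Rightarrow> 'l bl2 \<Rightarrow> 'l bl2 fls" where
  "smash_series s t = lin_series (\<lambda>((u, h), (v, k)). exp_series bl2_Lm1 (basis_vec u \<otimes> 1) *
     coact_series (fst u) (basis_vec v) (basis_vec k) (pi_map (basis_vec h))) (s \<otimes> t)"

lemma clinear_act: "clinear (\<lambda>w. twist2 (\<epsilon> \<beta>) (w \<otimes> k))"
  by (rule clinear_comp[OF clinear_twist clinear_tensor_left])

lemma series_linear_act_series: "series_linear (act_series \<beta> v k)"
  unfolding act_series_def[abs_def] by (rule series_linear_map[OF clinear_act series_linear_YM_series_left])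

lemma coact_series_tensor: "coact_series \<beta> v k (a \<otimes> b) = exp_series bl2_Lm1 (1 \<otimes> b) * act_series \<beta> v k a"
  unfolding coact_series_def
proof (rule lin_series_tensor)
  show "series_linear (\<lambda>p. exp_series bl2_Lm1 (1 \<otimes> q) * act_series \<beta> v k p)" for q
    by (rule series_linear_mult_left[OF series_linear_act_series])
  show "series_linear (\<lambda>q. exp_series bl2_Lm1 (1 \<otimes> q) * act_series \<beta> v k p)" for p
    by (rule series_linear_mult_right[OF series_linear_comp[OF bl2.series_linear_exp_series clinear_tensor_right]])
qed

lemma series_linear_coact: "series_linear (coact_series \<beta> v k)"
  unfolding coact_series_def by (rule series_linear_lin_series)

text \<open>The exponential of L(-1) on u \<otimes> h2 splits into exponentials on the two factors.
  Collecting powers of x then gives the three exponents a, b and n - a - b of the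
  definition.\<close>

lemma smash_coeff:
  "(exp_series bl2_Lm1 (basis_vec u \<otimes> h2) * act_series (fst u) v k h1) $$ n =
     Sum_any (\<lambda>(a, b). bl_Y \<epsilon> (basis_vec u) (YM h1 v b) a \<otimes> bl_Y trivial_cocycle h2 k (n - a - b))"
proof -
  obtain \<beta> m where u: "u = (\<beta>, m)" by (cases u)
  have hu: "homog \<beta> (basis_vec u)"
    using homog_tensor[of \<beta> "basis_vec m"] u by simp
  let ?t = "twist (\<lambda>x. \<epsilon> \<beta> (fst x))"
  obtain M where "\<And>n. n<M \<Longrightarrow> YM_series h1 v $$ n = 0" by (rule fls_nth_vanishes_belowE) blast
  then have M: "YM h1 v n = 0" if "n < M" for n using that by simp
  define K where "K = nat (n - M)"
  have t0: "?t 0 = 0" "p \<otimes> (0 :: 'l bl) = 0" "(0 :: 'l bl) \<otimes> p = 0" for p :: "'l bl"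
    by (simp_all add: twist_zero tensor_zero_left tensor_zero_right)
  have act: "act_series (fst u) v k h1 $$ j = ?t (YM h1 v j) \<otimes> k" for j
    unfolding act_series_def
    by (subst fls_map_nth[where \<phi> = "\<lambda>w. twist2 (\<epsilon> (fst u)) (w \<otimes> k)", OF clinear_zero[OF clinear_act]])
      (simp add: twist2_tensor u)
  let ?D = "divided_power bl_Lm1"
  let ?g = "\<lambda>(a, b). bl_Y \<epsilon> (basis_vec u) (YM h1 v b) a \<otimes> bl_Y trivial_cocycle h2 k (n - a - b)"
  \<comment> \<open>Here i is the total power of x from the two exponentials and a the part of it
    from u; Y_M contributes the exponent n - i.\<close>
  let ?f = "\<lambda>(i, a). (int a, n - int i)"
  have g: "?g (int a, n - int i) = (?D a (basis_vec u) * ?t (YM h1 v (n - int i))) \<otimes> (?D (i - a) h2 * k)"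
    if "a \<le> i" for a i
  proof -
    have "nat (int i - int a) = i - a" using that by auto
    then show ?thesis using that
      by (simp add: bl_Y_homog[OF hu] bl_Y_trivial bl.exp_series_nth)
  qed
  have "(exp_series bl2_Lm1 (basis_vec u \<otimes> h2) * act_series (fst u) v k h1) $$ n
      = (\<Sum>i\<le>K. divided_power bl2_Lm1 i (basis_vec u \<otimes> h2) * (?t (YM h1 v (n - int i)) \<otimes> k))"
    by (subst bl2.exp_series_mult_nth[of M _ n K]) (auto simp: act M t0 K_def)
  also have "\<dots> = (\<Sum>i\<le>K. \<Sum>a\<le>i. ?g (?f (i, a)))"
    unfolding divided_power_bl2_tensor sum_distrib_right tensor_mult
    by (intro sum.cong refl) (auto simp: g[simplified])
  also have "\<dots> = (\<Sum>x\<in>(SIGMA i:{..K}. {..i}). ?g (?f x))"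
    by (simp add: sum.Sigma case_prod_unfold)
  also have "\<dots> = sum ?g (?f ` (SIGMA i:{..K}. {..i}))"
    by (rule sum.reindex[symmetric, unfolded o_def]) (auto simp: inj_on_def)
  also have "\<dots> = Sum_any ?g"
  proof (rule Sum_any.expand_superset[symmetric])
    show "{x. ?g x \<noteq> 0} \<subseteq> ?f ` (SIGMA i:{..K}. {..i})"
    proof
      fix x assume "x \<in> {x. ?g x \<noteq> 0}"
      then obtain a b where x: "x = (a, b)" and nz: "?g (a, b) \<noteq> 0" by (cases x) auto
      have a: "a \<ge> 0"
        using nz by (auto simp: bl_Y_homog[OF hu] bl.exp_series_nth t0 split: if_splits)
      have b: "b \<ge> M"
      proof (rule ccontr)
        assume "\<not> b \<ge> M"
        then have "YM h1 v b = 0" by (intro M) simp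
        then show False using nz by (simp add: bl_Y_homog[OF hu] t0)
      qed
      have c: "n - a - b \<ge> 0"
        using nz by (auto simp: bl_Y_trivial bl.exp_series_nth t0 split: if_splits)
      have "x = ?f (nat (n - b), nat a)" using a c x by simp
      moreover have "(nat (n - b), nat a) \<in> (SIGMA i:{..K}. {..i})"
        using a b c by (auto simp: K_def)
      ultimately show "x \<in> ?f ` (SIGMA i:{..K}. {..i})" by blast
    qed
  qed simp
  finally show ?thesis .
qed

lemma smash_series_nth: "smash_series s t $$ n = lattice_smash_Y \<epsilon> YM s t n"
proof -
  have "(exp_series bl2_Lm1 (basis_vec u \<otimes> 1) * coact_series (fst u) (basis_vec v) (basis_vec k) (pi_map (basis_vec h))) $$ n
     = lin_ext (\<lambda>(h1, h2). Sum_any (\<lambda>(a, b). bl_Y \<epsilon> (basis_vec u) (YM (basis_vec h1) (basis_vec v) b) a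
             \<otimes> bl_Y trivial_cocycle (basis_vec h2) (basis_vec k) (n - a - b))) (bl_comult (basis_vec h))" for u h v k
    unfolding coact_series_def lin_series_mult_left lin_series_nth bl_comult_eq_pi_map
  proof (rule arg_cong[where f = "\<lambda>f. lin_ext f (pi_map (basis_vec h))"], rule ext)
    fix z :: "('l \<times> 'l mon) \<times> ('l \<times> 'l mon)"
    obtain h1 h2 where z: "z = (h1, h2)" by (cases z)
    have "exp_series bl2_Lm1 (basis_vec u \<otimes> 1) * (exp_series bl2_Lm1 (1 \<otimes> basis_vec h2) * act_series (fst u) (basis_vec v) (basis_vec k) (basis_vec h1))
        = exp_series bl2_Lm1 (basis_vec u \<otimes> basis_vec h2) * act_series (fst u) (basis_vec v) (basis_vec k) (basis_vec h1)"
      by (simp only: exp_series_bl2_tensor[of "basis_vec u" "basis_vec h2"] mult.assoc)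
    then show "(exp_series bl2_Lm1 (basis_vec u \<otimes> 1) * (case z of (x, y) \<Rightarrow> exp_series bl2_Lm1 (1 \<otimes> basis_vec y) *
          act_series (fst u) (basis_vec v) (basis_vec k) (basis_vec x))) $$ n =
        (case z of (h1, h2) \<Rightarrow> Sum_any (\<lambda>(a, b). bl_Y \<epsilon> (basis_vec u) (YM (basis_vec h1) (basis_vec v) b) a
             \<otimes> bl_Y trivial_cocycle (basis_vec h2) (basis_vec k) (n - a - b)))"
      unfolding z by (simp only: prod.case smash_coeff)
  qed
  then show ?thesis
    unfolding smash_series_def smash_Y_def lin_series_nth by (simp add: case_prod_unfold)
qed

lemma series_linear_smash_left: "series_linear (\<lambda>s. smash_series s t)"
  unfolding smash_series_def by (rule series_linear_comp[OF series_linear_lin_series clinear_tensor_left])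

lemma series_linear_smash_right: "series_linear (smash_series s)"
  unfolding smash_series_def[abs_def] by (rule series_linear_comp[OF series_linear_lin_series clinear_tensor_right])

lemma smash_series_homog:
  assumes "homog \<beta> u"
  shows "smash_series (u \<otimes> h) (basis_vec v \<otimes> basis_vec k) =
    exp_series bl2_Lm1 (u \<otimes> 1) * coact_series \<beta> (basis_vec v) (basis_vec k) (pi_map h)"
proof -
  obtain u' where u': "u = basis_vec \<beta> \<otimes> u'" using assms unfolding homog_def by blast
  have 1: "smash_series ((basis_vec \<beta> \<otimes> basis_vec m) \<otimes> h) (basis_vec v \<otimes> basis_vec k) =
    exp_series bl2_Lm1 ((basis_vec \<beta> \<otimes> basis_vec m) \<otimes> 1) * coact_series \<beta> (basis_vec v) (basis_vec k) (pi_map h)" for m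
    by (rule series_linear_eqI[of _ _ h, OF series_linear_comp[OF series_linear_smash_left clinear_tensor_right]
          series_linear_mult_left[OF series_linear_comp[OF series_linear_coact clinear_pi_map]]])
      (simp add: smash_series_def)
  show ?thesis unfolding u'
    by (rule series_linear_eqI[of _ _ u', OF
          series_linear_comp[OF series_linear_smash_left clinear_comp[OF clinear_tensor_left clinear_tensor_right]]
          series_linear_mult_right[OF series_linear_comp[OF bl2.series_linear_exp_series clinear_comp[OF clinear_tensor_left clinear_tensor_right]]]])
      (rule 1)
qed

section \<open>The operators of e_\<alpha> \<otimes> e^\<alpha> and their weak associativity\<close>

abbreviation diag_e :: "'l \<Rightarrow> 'l bl2" where
  "diag_e \<alpha> \<equiv> e_elt \<alpha> \<otimes> e_elt \<alpha>"

lemma homog_e_elt: "homog \<alpha> (e_elt \<alpha>)"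
  by (rule homog_tensor)

text \<open>The coproduct of e^\<alpha> has the single term e^\<alpha> \<otimes> e^\<alpha>, so the
  sum in the smash product collapses to one exponential times \<Phi> on the first factor.\<close>

lemma smash_series_diag_e: "smash_series (diag_e \<alpha>) t = exp_series bl2_Lm1 (diag_e \<alpha>) * Phi2 \<alpha> (twist2 (\<epsilon> \<alpha>) t)"
proof (rule series_linear_eqI[of _ _ t, OF series_linear_smash_right
      series_linear_mult_left[OF series_linear_comp[OF series_linear_Phi2 clinear_twist]]])
  fix x :: "('l \<times> 'l mon) \<times> ('l \<times> 'l mon)"
  obtain v k where x: "basis_vec x = basis_vec v \<otimes> basis_vec k"
    by (metis mult_1 prod.collapse tensor_single)
  show "smash_series (diag_e \<alpha>) (basis_vec x) = exp_series bl2_Lm1 (diag_e \<alpha>) * Phi2 \<alpha> (twist2 (\<epsilon> \<alpha>) (basis_vec x))"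
    unfolding x smash_series_homog[OF homog_e_elt] pi_map_e_elt coact_series_tensor
      exp_series_bl2_tensor[of "e_elt \<alpha>" "e_elt \<alpha>"] Phi2_twist2 Phi2_tensor act_series_def
    by (simp add: mult.assoc fls_map_comp twist_zero tensor_zero_left)
qed

text \<open>The cocycle identity for \<alpha>, \<beta>, \<gamma>, with \<gamma> the degree of the
  first tensor factor of t.\<close>

lemma twist2_act: "twist2 (\<lambda>\<gamma>. \<epsilon> \<alpha> (\<beta> + \<gamma>)) (twist2 (\<epsilon> \<beta>) t) = cscale (\<epsilon> \<alpha> \<beta>) (twist2 (\<epsilon> (\<alpha> + \<beta>)) t)"
proof -
  have "\<epsilon> \<alpha> (\<beta> + \<gamma>) * \<epsilon> \<beta> \<gamma> = \<epsilon> \<alpha> \<beta> * \<epsilon> (\<alpha> + \<beta>) \<gamma>" for \<gamma>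
    using cocycle unfolding normalized_2_cocycle_def by (simp add: mult.commute)
  then show ?thesis unfolding twist_twist by (simp add: twist_cscale[symmetric])
qed

text \<open>Holds for sums of tensors with first factor of degree \<open>\<beta>\<close>; stated through the twists, the
  condition is visibly closed under sums.\<close>

definition homog2 :: "'l \<Rightarrow> 'l bl2 \<Rightarrow> bool" where
  "homog2 \<beta> a \<longleftrightarrow> (\<forall>g t. twist2 g (a * t) = a * twist2 (\<lambda>\<gamma>. g (\<beta> + \<gamma>)) t)"

lemma homog2_tensor:
  assumes "homog \<beta> u"
  shows "homog2 \<beta> (u \<otimes> h)"
  unfolding homog2_def
proof (intro allI)
  fix g t
  obtain u' where u': "u = basis_vec \<beta> \<otimes> u'" using assms unfolding homog_def by blast
  have 1: "twist2 g (basis_vec ((\<beta>, m), y) * t) = basis_vec ((\<beta>, m), y) * twist2 (\<lambda>\<gamma>. g (\<beta> + \<gamma>)) t" for m y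
    by (rule twist_mult_basis) simp
  have 2: "twist2 g (((basis_vec \<beta> \<otimes> basis_vec m) \<otimes> h) * t) = ((basis_vec \<beta> \<otimes> basis_vec m) \<otimes> h) * twist2 (\<lambda>\<gamma>. g (\<beta> + \<gamma>)) t" for m
    by (rule clinear_eqI[of _ _ h, OF clinear_comp[OF clinear_twist clinear_comp[OF clinear_mult_right clinear_tensor_right]]
          clinear_comp[OF clinear_mult_right clinear_tensor_right]]) (simp add: 1)
  show "twist2 g ((u \<otimes> h) * t) = (u \<otimes> h) * twist2 (\<lambda>\<gamma>. g (\<beta> + \<gamma>)) t"
    unfolding u'
    by (rule clinear_eqI[of _ _ u', OF clinear_comp[OF clinear_twist clinear_comp[OF clinear_mult_right clinear_comp[OF clinear_tensor_left clinear_tensor_right]]]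
          clinear_comp[OF clinear_mult_right clinear_comp[OF clinear_tensor_left clinear_tensor_right]]]) (rule 2)
qed

lemma homog2_sum: "(\<And>x. x \<in> A \<Longrightarrow> homog2 \<beta> (f x)) \<Longrightarrow> homog2 \<beta> (sum f A)"
  unfolding homog2_def by (simp add: sum_distrib_right clinear_sum[OF clinear_twist])

lemma homog2_exp_series: "homog \<beta> u \<Longrightarrow> homog2 \<beta> (exp_series bl2_Lm1 (u \<otimes> h) $$ n)"
  unfolding bl2.exp_series_nth divided_power_bl2_tensor
  using homog2_sum[of "{}" \<beta>] by (auto intro!: homog2_sum homog2_tensor homog_divided_power)

text \<open>Passing a factor of degree \<beta> shifts the argument of the twist by \<epsilon>
  \<alpha> to \<beta> + \<gamma>. Combined with the twist by \<epsilon> \<beta> inside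
  \<open>act_series\<close>, the cocycle identity leaves \<epsilon>(\<alpha>,\<beta>) and the twist
  by \<epsilon> (\<alpha> + \<beta>).\<close>

lemma twist2_exp_act:
  assumes "homog \<beta> u"
  shows "fls_map (twist2 (\<epsilon> \<alpha>)) (exp_series bl2_Lm1 (u \<otimes> h) * act_series \<beta> v k a) =
    fls_const (scalar (\<epsilon> \<alpha> \<beta>)) * (exp_series bl2_Lm1 (u \<otimes> h) * act_series (\<alpha> + \<beta>) v k a)"
proof -
  have id: "additive (\<lambda>x :: 'l bl2. x)" "fls_map (\<lambda>x. x) f = f" for f :: "'l bl2 fls"
    by (simp_all add: additive_def fls_eq_iff)
  let ?g = "twist2 (\<lambda>\<gamma>. \<epsilon> \<alpha> (\<beta> + \<gamma>))"
  \<comment> \<open>The identity maps give the product the shape of \<open>fls_map_bilinear\<close>,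
    with trivial embeddings and the twist as Q.\<close>
  have "fls_map (twist2 (\<epsilon> \<alpha>)) (fls_map (\<lambda>x. x) (exp_series bl2_Lm1 (u \<otimes> h)) * fls_map (\<lambda>x. x) (act_series \<beta> v k a))
      = fls_map (\<lambda>x. x) (exp_series bl2_Lm1 (u \<otimes> h)) * fls_map ?g (act_series \<beta> v k a)"
    using homog2_exp_series[OF assms, of h]
    by (intro fls_map_bilinear clinear_additive[OF clinear_twist] id) (simp add: homog2_def)
  also have "fls_map ?g (act_series \<beta> v k a) = fls_const (scalar (\<epsilon> \<alpha> \<beta>)) * act_series (\<alpha> + \<beta>) v k a"
    unfolding act_series_def
    by (rule fls_eqI) (simp add: clinear_zero[OF clinear_act] twist_zero twist2_act flip: cscale_conv_mult)
  finally show ?thesis by (simp add: id ac_simps)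
qed

lemma YM_series_fun: "fls_nth (YM_series h v) = YM h v"
  by (rule ext) simp

text \<open>Weak associativity of Y_M for e^\<alpha>, h, v is carried over by the linear map that
  tensors with k and twists. This map commutes with \<Phi>, which acts on the first factor only and
  preserves its L-degree.\<close>

lemma weakly_assoc_act:
  "weakly_assoc (fls_map (Phi2 \<alpha>) (act_series \<beta> v k h))
     (fls_map (act_series \<beta> v k) (exp_series bl_Lm1 (e_elt \<alpha>) * fls_const h))"
proof -
  let ?L = "\<lambda>w. twist2 (\<epsilon> \<beta>) (w \<otimes> k)"
  note z = additive_0[OF series_linear_additive[OF series_linear_YM_series_left]]
    additive_0[OF series_linear_additive[OF series_linear_YM_series]]
    additive_0[OF series_linear_additive[OF series_linear_Phi2]]
    additive_0[OF series_linear_additive[OF series_linear_act_series]]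
    clinear_zero[OF clinear_act] additive_0[OF additive_fls_map[OF clinear_additive[OF clinear_act]]]
  have "weakly_assoc (fls_map (Phi \<alpha>) (YM_series h v))
      (fls_map (\<lambda>a. YM_series a v) (exp_series bl_Lm1 (e_elt \<alpha>) * fls_const h))"
    unfolding weakly_assoc_iff
    using YM_weak_assoc[of "e_elt \<alpha>" h v] by (simp add: z bl_Y_trivial YM_series_fun)
  from weakly_assoc_map[OF clinear_act this]
  have "weakly_assoc (fls_map (fls_map ?L) (fls_map (Phi \<alpha>) (YM_series h v)))
      (fls_map (fls_map ?L) (fls_map (\<lambda>a. YM_series a v) (exp_series bl_Lm1 (e_elt \<alpha>) * fls_const h)))" .
  moreover have "fls_map (fls_map ?L) (fls_map (Phi \<alpha>) (YM_series h v)) = fls_map (Phi2 \<alpha>) (act_series \<beta> v k h)"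
  proof -
    have "fls_map ?L (Phi \<alpha> w) = Phi2 \<alpha> (?L w)" for w
      unfolding Phi2_twist2 Phi2_tensor
      by (simp add: fls_map_comp twist_zero tensor_zero_left)
    then show ?thesis
      unfolding act_series_def by (simp add: fls_map_comp z)
  qed
  moreover have "fls_map (fls_map ?L) (fls_map (\<lambda>a. YM_series a v) (exp_series bl_Lm1 (e_elt \<alpha>) * fls_const h))
      = fls_map (act_series \<beta> v k) (exp_series bl_Lm1 (e_elt \<alpha>) * fls_const h)"
    unfolding act_series_def[abs_def] by (simp add: fls_map_comp z)
  ultimately show ?thesis by simp
qed

text \<open>Over the terms h1 \<otimes> h2 of \<Delta>(h) both sides become sums with the same
  coefficients; termwise they are the two sides of \<open>core\<close>. On the right this takes the
  homomorphism property of \<Delta>, since there the coproduct is applied to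
  Y(e^\<alpha>,x)h.\<close>

lemma weakly_assoc_smash_basis:
  "weakly_assoc (fls_map (smash_series (diag_e \<alpha>)) (smash_series (basis_vec u \<otimes> basis_vec h) (basis_vec v \<otimes> basis_vec k)))
     (fls_map (\<lambda>p. smash_series p (basis_vec v \<otimes> basis_vec k)) (smash_series (diag_e \<alpha>) (basis_vec u \<otimes> basis_vec h)))"
proof -
  obtain \<beta> m where u: "u = (\<beta>, m)" by (cases u)
  have hu: "homog \<beta> (basis_vec u)"
    using homog_tensor[of \<beta> "basis_vec m"] u by simp
  define I where "I = Poly_Mapping.keys (pi_map (basis_vec h))"
  define c :: "_ \<Rightarrow> 'l bl2 fls fls" where "c i = fls_const (fls_const (scalar (Poly_Mapping.lookup (pi_map (basis_vec h)) i)))" for i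
  \<comment> \<open>\<epsilon>(\<alpha>,\<beta>) appears on both sides: on the left when the twist
    by \<epsilon> \<alpha> passes the factor of degree \<beta>, on the right when e_\<alpha> is
    multiplied with u.\<close>
  define e :: "'l bl2 fls fls" where "e = fls_const (fls_const (scalar (\<epsilon> \<alpha> \<beta>)))"
  let ?v = "basis_vec v" and ?k = "basis_vec k" and ?u = "basis_vec u" and ?h = "basis_vec h"
  let ?h1 = "\<lambda>i. basis_vec (fst i)" and ?h2 = "\<lambda>i. basis_vec (snd i)"
  let ?E = "exp_series bl2_Lm1" and ?P = "diag_e \<alpha>" and ?N = "act_series (\<alpha> + \<beta>) ?v ?k"
  let ?ee = "exp_series bl_Lm1 (e_elt \<alpha>)"
  let ?in1 = "\<lambda>p :: 'l bl. p \<otimes> (1 :: 'l bl)" and ?in2 = "\<lambda>p :: 'l bl. (1 :: 'l bl) \<otimes> p"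
  have add: "additive ?in1" "additive ?in2"
    by (rule clinear_additive[OF clinear_tensor_left] clinear_additive[OF clinear_tensor_right])+
  have m1: "fls_map ?in1 (f * g) = fls_map ?in1 f * fls_map ?in1 g" for f g
    by (rule fls_map_mult[OF add(1)]) (simp add: tensor_mult)
  have m2: "fls_map ?in2 (f * g) = fls_map ?in2 f * fls_map ?in2 g" for f g
    by (rule fls_map_mult[OF add(2)]) (simp add: tensor_mult)
  have mE: "fls_map ?E (f * g) = fls_map ?E f * fls_map ?E g" for f g
    by (rule fls_map_mult[OF bl2.exp_series_additive bl2.exp_series_mult])
  note sl = series_linear_smash_left series_linear_smash_right series_linear_coact series_linear_Phi2 series_linear_act_series
    bl2.series_linear_exp_series
  \<comment> \<open>\<open>weakly_assoc_conformal\<close> with P = e_\<alpha> \<otimes> e^\<alpha>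
    and s = u \<otimes> h2; the given pair is Y_M for e^\<alpha> and h1, already in degree \<alpha>
    + \<beta>.\<close>
  have core: "weakly_assoc (fls_const (?E ?P) * fls_map (Phi2 \<alpha>) (?E (?u \<otimes> ?h2 i) * ?N (?h1 i)))
      (fls_map ?E (?E ?P * Phi2 \<alpha> (?u \<otimes> ?h2 i)) * fls_map ?N (?ee * fls_const (?h1 i)))" for i
    by (rule conformal_hom.weakly_assoc_conformal[OF conformal_hom_Phi2 weakly_assoc_act])

  have st: "smash_series (?u \<otimes> ?h) (?v \<otimes> ?k) = (\<Sum>i\<in>I. fls_const (scalar (Poly_Mapping.lookup (pi_map ?h) i)) *
      (?E (?u \<otimes> ?h2 i) * act_series \<beta> ?v ?k (?h1 i)))"
    unfolding smash_series_homog[OF hu] coact_series_def lin_series_mult_left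
    unfolding lin_series_def I_def
    by (simp only: split_beta exp_series_bl2_tensor[of ?u "basis_vec _"] mult.assoc sum_distrib_left ac_simps)
  have trm: "fls_map (smash_series ?P) (?E (?u \<otimes> ?h2 i) * act_series \<beta> ?v ?k (?h1 i))
      = e * (fls_const (?E ?P) * fls_map (Phi2 \<alpha>) (?E (?u \<otimes> ?h2 i) * ?N (?h1 i)))" for i
  proof -
    have "fls_map (smash_series ?P) X = fls_const (?E ?P) * fls_map (Phi2 \<alpha>) (fls_map (twist2 (\<epsilon> \<alpha>)) X)" for X
      by (rule fls_eqI) (simp add: additive_0[OF series_linear_additive[OF sl(2)]] additive_0[OF series_linear_additive[OF sl(4)]]
          twist_zero smash_series_diag_e)
    then show ?thesis
      unfolding twist2_exp_act[OF hu] fls_map_series_scale[OF sl(4)] by (simp only: twist2_exp_act[OF hu] fls_map_series_scale[OF sl(4)] e_def ac_simps)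
  qed
  have F: "fls_map (smash_series ?P) (smash_series (?u \<otimes> ?h) (?v \<otimes> ?k))
      = (\<Sum>i\<in>I. c i * (e * (fls_const (?E ?P) * fls_map (Phi2 \<alpha>) (?E (?u \<otimes> ?h2 i) * ?N (?h1 i)))))"
    unfolding st fls_map_sum[OF series_linear_additive[OF sl(2)]] fls_map_series_scale[OF sl(2)] trm c_def ..

  \<comment> \<open>Up to \<epsilon>(\<alpha>,\<beta>), the operator of e_\<alpha> \<otimes>
    e^\<alpha> sends u \<otimes> h to a product of a series U in the first tensor factor and H =
    Y(e^\<alpha>,x)h in the second.\<close>
  define U where "U = ?ee * Phi \<alpha> ?u"
  define H where "H = ?ee * fls_const ?h"
  have P: "?E ?P = fls_map ?in1 ?ee * fls_map ?in2 ?ee"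
    unfolding exp_series_bl2_tensor[of "e_elt \<alpha>" "e_elt \<alpha>"] exp_series_bl2_left exp_series_bl2_right ..
  have PU: "?E ?P * Phi2 \<alpha> (?u \<otimes> q) = fls_map ?in1 U * fls_map ?in2 (?ee * fls_const q)" for q
    unfolding P U_def Phi2_tensor fls_map_tensor_const[of q] m1 m2 fls_map_const[of ?in2, OF additive_0[OF add(2)]]
    by (simp only: ac_simps)
  have UH: "smash_series ?P (?u \<otimes> ?h) = fls_const (scalar (\<epsilon> \<alpha> \<beta>)) * (fls_map ?in1 U * fls_map ?in2 H)"
  proof -
    have "twist2 (\<epsilon> \<alpha>) (?u \<otimes> ?h) = cscale (\<epsilon> \<alpha> \<beta>) (?u \<otimes> ?h)"
      unfolding twist2_tensor homog_twist[OF hu] tensor_cscale_left ..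
    then show ?thesis
      unfolding smash_series_diag_e H_def PU[symmetric]
      by (simp only: series_linear_cscale[OF sl(4)] ac_simps)
  qed
  \<comment> \<open>This degree selects the cocycle twist when coefficients of U become first
    arguments in \<open>smash_series_homog\<close>.\<close>
  have hU: "homog (\<alpha> + \<beta>) (U $$ j)" for j
  proof -
    obtain M where M: "\<And>n. n<M \<Longrightarrow> Phi \<alpha> ?u $$ n = 0" by (rule fls_nth_vanishes_belowE) blast
    have "U $$ j = (\<Sum>i=0..j - M. ?ee $$ i * Phi \<alpha> ?u $$ (j - i))"
      unfolding U_def by (rule fls_times_nth_bounds[OF _ M]) (simp add: bl.exp_series_nth)
    also have "homog (\<alpha> + \<beta>) \<dots>"
      unfolding bl.exp_series_nth YM_series_nth
      by (intro homog_sum homog_mult homog_YM hu) (simp add: homog_0 homog_divided_power homog_e_elt)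
    finally show ?thesis .
  qed
  have 1: "fls_map (\<lambda>p. smash_series p (?v \<otimes> ?k)) (fls_map ?in1 U * fls_map ?in2 H)
      = fls_map (\<lambda>a. ?E (?in1 a)) U * fls_map (\<lambda>b. coact_series (\<alpha> + \<beta>) ?v ?k (pi_map b)) H"
  proof (rule fls_map_bilinear[OF series_linear_additive[OF sl(1)] add])
    show "additive (\<lambda>a. ?E (?in1 a))"
      by (rule series_linear_additive[OF series_linear_comp[OF sl(6) clinear_tensor_left]])
    show "additive (\<lambda>b. coact_series (\<alpha> + \<beta>) ?v ?k (pi_map b))"
      by (rule series_linear_additive[OF series_linear_comp[OF sl(3) clinear_pi_map]])
    show "smash_series (?in1 (U $$ i) * ?in2 (H $$ j)) (?v \<otimes> ?k)
        = ?E (?in1 (U $$ i)) * coact_series (\<alpha> + \<beta>) ?v ?k (pi_map (H $$ j))" for i j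
      unfolding tensor_conv_mult[symmetric] by (rule smash_series_homog[OF hU])
  qed
  \<comment> \<open>As \<Delta> is multiplicative, commutes with L(-1) and has e^\<alpha>
    group-like, it sends Y(e^\<alpha>,x)h to the sum of the Y(e^\<alpha>,x)h1 \<otimes>
    Y(e^\<alpha>,x)h2.\<close>
  have piH: "fls_map pi_map H = (\<Sum>i\<in>I. fls_const (scalar (Poly_Mapping.lookup (pi_map ?h) i)) *
      (fls_map ?in1 (?ee * fls_const (?h1 i)) * fls_map ?in2 (?ee * fls_const (?h2 i))))"
  proof -
    have "pi_map ?h = (\<Sum>i\<in>I. cscale (Poly_Mapping.lookup (pi_map ?h) i) (?h1 i \<otimes> ?h2 i))"
      using basis_expansion[of "pi_map ?h"] by (simp add: I_def)
    then have "fls_const (pi_map ?h) = (\<Sum>i\<in>I. fls_const (cscale (Poly_Mapping.lookup (pi_map ?h) i) (?h1 i \<otimes> ?h2 i)))"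
      using additive.sum[of "fls_const :: 'l bl2 \<Rightarrow> _"] by (simp add: additive_def fls_eq_iff fls_sum_nth)
    also have "\<dots> = (\<Sum>i\<in>I. fls_const (scalar (Poly_Mapping.lookup (pi_map ?h) i)) * (fls_const (?in1 (?h1 i)) * fls_const (?in2 (?h2 i))))"
      by (simp add: cscale_conv_mult fls_const_mult_const tensor_mult del: cscale_single tensor_single)
    finally have "fls_const (pi_map ?h) = \<dots>" .
    then show ?thesis
      unfolding H_def fls_map_mult[OF additive_pi_map pi_map_mult] exp_series_pi_map pi_map_e_elt P
        fls_map_const[where \<phi> = pi_map, OF pi_map_zero] m1 m2 fls_map_const[of ?in1, OF additive_0[OF add(1)]]
        fls_map_const[of ?in2, OF additive_0[OF add(2)]]
      by (simp only: sum_distrib_left ac_simps)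
  qed
  have 2: "fls_map (coact_series (\<alpha> + \<beta>) ?v ?k) (fls_map ?in1 f * fls_map ?in2 g) = fls_map ?N f * fls_map (\<lambda>b. ?E (?in2 b)) g" for f g
  proof (rule fls_map_bilinear[OF series_linear_additive[OF sl(3)] add series_linear_additive[OF sl(5)]])
    show "additive (\<lambda>b. ?E (?in2 b))"
      by (rule series_linear_additive[OF series_linear_comp[OF sl(6) clinear_tensor_right]])
    show "coact_series (\<alpha> + \<beta>) ?v ?k (?in1 (f $$ i) * ?in2 (g $$ j)) = ?N (f $$ i) * ?E (?in2 (g $$ j))" for i j
      unfolding tensor_conv_mult[symmetric] coact_series_tensor by (rule mult.commute)
  qed
  have 3: "fls_map (\<lambda>b. coact_series (\<alpha> + \<beta>) ?v ?k (pi_map b)) H = fls_map (coact_series (\<alpha> + \<beta>) ?v ?k) (fls_map pi_map H)"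
    by (rule fls_map_comp[symmetric]) (simp_all add: additive_0[OF series_linear_additive[OF sl(3)]] pi_map_zero)
  have 4: "fls_map ?E (?E ?P * Phi2 \<alpha> (?u \<otimes> q)) = fls_map (\<lambda>a. ?E (?in1 a)) U * fls_map (\<lambda>b. ?E (?in2 b)) (?ee * fls_const q)" for q
    unfolding PU mE
    by (simp add: fls_map_comp[of ?E] bl2.exp_series_zero additive_0[OF add(1)] additive_0[OF add(2)])
  have G: "fls_map (\<lambda>p. smash_series p (?v \<otimes> ?k)) (smash_series ?P (?u \<otimes> ?h))
      = (\<Sum>i\<in>I. c i * (e * (fls_map ?E (?E ?P * Phi2 \<alpha> (?u \<otimes> ?h2 i)) * fls_map ?N (?ee * fls_const (?h1 i)))))"
    unfolding UH fls_map_series_scale[OF sl(1)] 1 3 piH fls_map_sum[OF series_linear_additive[OF sl(3)]]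
      fls_map_series_scale[OF sl(3)] 2 4 c_def e_def sum_distrib_left
    by (simp only: ac_simps)
  show ?thesis
    unfolding F G unfolding c_def e_def
    by (intro weakly_assoc_sum weakly_assoc_scale core)
qed

text \<open>Both sides are linear in s and in t, and the finitely many weak associativities for
  basis vectors have a common power of x0 + x2.\<close>

lemma weakly_assoc_smash:
  "weakly_assoc (fls_map (smash_series (diag_e \<alpha>)) (smash_series s t))
     (fls_map (\<lambda>p. smash_series p t) (smash_series (diag_e \<alpha>) s))"
proof -
  let ?P = "diag_e \<alpha>"
  let ?F = "\<lambda>s t. fls_map (smash_series ?P) (smash_series s t)" and ?G = "\<lambda>s t. fls_map (\<lambda>p. smash_series p t) (smash_series ?P s)"
  note sl = series_linear_smash_left series_linear_smash_right
  have Fs: "series2_linear (\<lambda>s. ?F s t)" and Ft: "series2_linear (\<lambda>t. ?F s t)" and Gs: "series2_linear (\<lambda>s. ?G s t)" for s t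
    by (rule series2_linear_map sl)+
  have Gt: "series2_linear (\<lambda>t. ?G s t)" for s
    by (rule series2_linear_map_param) (rule sl)+
  have b: "basis_vec x = basis_vec (fst x) \<otimes> basis_vec (snd x)" for x :: "('l \<times> 'l mon) \<times> ('l \<times> 'l mon)" by simp
  have 1: "weakly_assoc (?F (basis_vec x) (basis_vec y)) (?G (basis_vec x) (basis_vec y))" for x y
    unfolding b[of x] b[of y] by (rule weakly_assoc_smash_basis)
  have 2: "weakly_assoc (?F (basis_vec x) t) (?G (basis_vec x) t)" for x
  proof -
    let ?c = "\<lambda>y. fls_const (fls_const (scalar (Poly_Mapping.lookup t y)))"
    have "?F (basis_vec x) t = (\<Sum>y\<in>Poly_Mapping.keys t. ?c y * ?F (basis_vec x) (basis_vec y))"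
      by (rule series2_linear_expand[OF Ft])
    moreover have "?G (basis_vec x) t = (\<Sum>y\<in>Poly_Mapping.keys t. ?c y * ?G (basis_vec x) (basis_vec y))"
      by (rule series2_linear_expand[OF Gt])
    moreover have "weakly_assoc (\<Sum>y\<in>Poly_Mapping.keys t. ?c y * ?F (basis_vec x) (basis_vec y))
        (\<Sum>y\<in>Poly_Mapping.keys t. ?c y * ?G (basis_vec x) (basis_vec y))"
      by (intro weakly_assoc_sum weakly_assoc_scale 1)
    ultimately show ?thesis by (simp only:)
  qed
  let ?c = "\<lambda>x. fls_const (fls_const (scalar (Poly_Mapping.lookup s x)))"
  have "?F s t = (\<Sum>x\<in>Poly_Mapping.keys s. ?c x * ?F (basis_vec x) t)"
    by (rule series2_linear_expand[OF Fs])
  moreover have "?G s t = (\<Sum>x\<in>Poly_Mapping.keys s. ?c x * ?G (basis_vec x) t)"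
    by (rule series2_linear_expand[OF Gs])
  moreover have "weakly_assoc (\<Sum>x\<in>Poly_Mapping.keys s. ?c x * ?F (basis_vec x) t)
      (\<Sum>x\<in>Poly_Mapping.keys s. ?c x * ?G (basis_vec x) t)"
    by (intro weakly_assoc_sum weakly_assoc_scale 2)
  ultimately show ?thesis by (simp only:)
qed

end

subsection \<open>Comparison with \<open>V\<^sub>L\<close>\<close>

text \<open>After raising both relations to a common power, (x0+x2)^m kills G - H. This difference
  is bounded below in x0, so the power can be cancelled: \<open>mult_binomial_closed\<close> for the
  zero subspace.\<close>

lemma weakly_assoc_unique:
  assumes "weakly_assoc F G" "weakly_assoc F H"
  shows "G = H"
proof -
  obtain l where l: "mult_binomial cscale 1 l (subst_add cscale (\<lambda>a b. F $$ b $$ a)) = mult_binomial cscale 1 l (\<lambda>a b. G $$ a $$ b)"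
    using assms(1) unfolding weakly_assoc_iff by blast
  obtain k where k: "mult_binomial cscale 1 k (subst_add cscale (\<lambda>a b. F $$ b $$ a)) = mult_binomial cscale 1 k (\<lambda>a b. H $$ a $$ b)"
    using assms(2) unfolding weakly_assoc_iff by blast
  obtain M where M: "\<And>n. n<M \<Longrightarrow> G $$ n = 0" by (rule fls_nth_vanishes_belowE) blast
  obtain N where N: "\<And>n. n<N \<Longrightarrow> H $$ n = 0" by (rule fls_nth_vanishes_belowE) blast
  let ?m = "max l k"
  have "mult_binomial cscale 1 ?m (\<lambda>a b. G $$ a $$ b) = mult_binomial cscale 1 ?m (\<lambda>a b. H $$ a $$ b)"
    using mult_binomial_mono[OF l, of ?m] mult_binomial_mono[OF k, of ?m] by simp
  then have "G $$ a $$ b - H $$ a $$ b \<in> {0}" for a b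
    by (intro mult_binomial_closed[of "{0}" "min M N" "\<lambda>a b. G $$ a $$ b - H $$ a $$ b" ?m])
      (auto simp: mult_binomial_diff M N cvec.subspace_single_0)
  then show ?thesis by (intro fls_eqI) simp
qed

lemma twist2_diag_elt: "twist (\<lambda>x. g (fst (fst x))) (diag_elt \<beta> t) = cscale (g \<beta>) (diag_elt \<beta> t)"
proof (rule clinear_eqI[of _ _ t, OF clinear_comp[OF clinear_twist clinear_diag_elt] clinear_cscale_fun[OF clinear_diag_elt]])
  fix z :: "'a mon \<times> 'a mon"
  have "diag_elt \<beta> (basis_vec z) = basis_vec ((\<beta>, fst z), (\<beta>, snd z))"
    using diag_elt_tensor[of \<beta> "basis_vec (fst z)" "basis_vec (snd z)"] by simp
  then show "twist (\<lambda>x. g (fst (fst x))) (diag_elt \<beta> (basis_vec z)) = cscale (g \<beta>) (diag_elt \<beta> (basis_vec z))"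
    by simp
qed

lemma Sum_any_in_subspace:
  assumes "cvec.subspace S" "\<And>j. f j \<in> S"
  shows "Sum_any f \<in> S"
  unfolding Sum_any.expand_set by (rule cvec.subspace_sum[OF assms(1)]) (rule assms(2))

lemma mult_binomial_in_subspace:
  assumes "cvec.subspace S" "\<And>a b. F a b \<in> S"
  shows "mult_binomial cscale c l F a b \<in> S"
  unfolding mult_binomial_def by (intro cvec.subspace_sum[OF assms(1)] cvec.subspace_scale[OF assms(1)] assms(2))

lemma subst_add_in_subspace:
  assumes "cvec.subspace S" "\<And>a b. F a b \<in> S"
  shows "subst_add cscale F a b \<in> S"
  unfolding subst_add_def by (intro Sum_any_in_subspace[OF assms(1)] cvec.subspace_scale[OF assms(1)] assms(2))

lemma mult_binomial_map:
  "clinear L \<Longrightarrow> mult_binomial cscale c l (\<lambda>a b. L (F a b)) a b = L (mult_binomial cscale c l F a b)"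
  by (simp add: mult_binomial_def clinear_sum clinear_cscale)

locale lattice_comparison = lattice_smash B YM \<epsilon>
  for B :: "'l::fg_free_ab_group \<Rightarrow> 'l \<Rightarrow> int" and YM \<epsilon> +
  fixes YVL :: "'l bl \<Rightarrow> 'l bl \<Rightarrow> int \<Rightarrow> 'l bl"
  assumes VL: "is_lattice_vertex_algebra B \<epsilon> YVL"
begin

lemma vertex_algebra_VL: "vertex_algebra cscale UNIV YVL (e_elt 0)"
  and generated_VL: "vertex_algebra_generated_by cscale UNIV YVL (e_elt 0) (range e_elt)"
  and YVL_e_elt: "YVL (e_elt \<alpha>) v n = Sum_any (\<lambda>(i::nat, j::nat). E_minus B (- \<alpha>) i (E_plus B (- \<alpha>) j
          (bl_mult \<epsilon> (e_elt \<alpha>) (x_pow_zero_mode B \<alpha> v (n - int i + int j)))))"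
  using VL unfolding is_lattice_vertex_algebra_def by blast+

interpretation V: vertex_algebra cscale UNIV YVL "e_elt 0"
  by (rule vertex_algebra_VL)

lemma clinear_YVL_left: "clinear (\<lambda>u. YVL u v n)" and clinear_YVL_right: "clinear (\<lambda>v. YVL u v n)"
  by (simp_all add: clinear_def additive_def V.Y_add_left V.Y_scale_left V.Y_add_right V.Y_scale_right)

definition VL_series :: "'l bl \<Rightarrow> 'l bl \<Rightarrow> 'l bl fls" where
  "VL_series u v = Abs_fls (YVL u v)"

lemma VL_series_nth [simp]: "VL_series u v $$ n = YVL u v n"
  unfolding VL_series_def by (rule nth_Abs_fls_ex_lower_bound) (rule V.Y_truncated, simp_all)

lemma VL_series_fun: "fls_nth (VL_series u v) = YVL u v"
  by (rule ext) simp

lemma VL_series_zero: "VL_series u 0 = 0" "VL_series 0 v = 0"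
  by (simp_all add: fls_eq_iff clinear_zero[OF clinear_YVL_left] clinear_zero[OF clinear_YVL_right])

lemma E_plus_e_elt_mult: "E_plus B \<alpha> N (e_elt \<beta> * w) = e_elt \<beta> * E_plus B \<alpha> N w"
proof -
  have "E_plus B \<alpha> N (e_elt \<beta> * w) = (\<Sum>i\<in>{0}. E_plus B \<alpha> i (e_elt \<beta>) * E_plus B \<alpha> (N - i) w)"
    unfolding E_plus_mult by (rule sum.mono_neutral_right) (simp_all add: E_plus_e_elt)
  then show ?thesis by (simp add: E_plus_e_elt)
qed

text \<open>E^+ is multiplicative and fixes e_\<alpha>, so e_\<alpha> moves to its left, next to
  E^-; the remaining E^+(-\<alpha>,x) x^\<alpha>(0) is \<Phi>. The twisted product contributes
  \<epsilon>(\<alpha>,\<beta>).\<close>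

lemma YVL_e_elt_basis:
  "YVL (e_elt \<alpha>) (basis_vec (\<beta>, m)) n =
     cscale (\<epsilon> \<alpha> \<beta>) ((exp_series bl_Lm1 (e_elt \<alpha>) * Phi \<alpha> (basis_vec (\<beta>, m))) $$ n)"
proof -
  let ?w = "basis_vec (\<beta>, m)" and ?E = "E_plus B (- \<alpha>)" and ?D = "\<lambda>i. divided_power bl_Lm1 i (e_elt \<alpha>)"
  define b where "b = B \<alpha> \<beta>"
  obtain M where M: "\<And>n. n<M \<Longrightarrow> Phi \<alpha> ?w $$ n = 0" by (rule fls_nth_vanishes_belowE) blast
  define K where "K = nat (n - M)"
  let ?g = "\<lambda>(i, j). E_minus B (- \<alpha>) i (?E j (bl_mult \<epsilon> (e_elt \<alpha>) (x_pow_zero_mode B \<alpha> ?w (n - int i + int j))))"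
  have P: "Phi \<alpha> ?w $$ k = (if k \<le> b then ?E (nat (b - k)) ?w else 0)" for k
    by (simp add: YM_e_elt_basis b_def)
  have tw: "twist (\<lambda>x. \<epsilon> \<alpha> (fst x)) ?w = cscale (\<epsilon> \<alpha> \<beta>) ?w"
    by (simp add: twist_def)
  have g: "?g (i, j) = (if n - int i + int j = b then cscale (\<epsilon> \<alpha> \<beta>) (?D i * ?E j ?w) else 0)" for i j
  proof (cases "n - int i + int j = b")
    case True
    then have "x_pow_zero_mode B \<alpha> ?w (n - int i + int j) = ?w"
      by (simp add: x_pow_zero_mode_def b_def)
    then have "?g (i, j) = E_minus_coeff \<alpha> i * ?E j (e_elt \<alpha> * cscale (\<epsilon> \<alpha> \<beta>) ?w)"
      unfolding prod.case E_minus_conv bl_mult_homog[OF homog_e_elt] by (simp only: tw)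
    also have "\<dots> = cscale (\<epsilon> \<alpha> \<beta>) (?D i * ?E j ?w)"
      unfolding E_plus_e_elt_mult clinear_cscale[OF clinear_E_plus] cscale_mult_right divided_power_e_elt
      by (simp only: mult.assoc)
    finally show ?thesis using True by simp
  next
    case False
    then have "x_pow_zero_mode B \<alpha> ?w (n - int i + int j) = 0"
      by (simp add: x_pow_zero_mode_def b_def)
    then show ?thesis using False
      by (simp add: E_minus_conv clinear_zero[OF clinear_bl_mult_right] clinear_zero[OF clinear_E_plus])
  qed
  let ?S = "{i \<in> {..K}. n - int i \<le> b}"
  have "YVL (e_elt \<alpha>) ?w n = Sum_any ?g"
    by (rule YVL_e_elt)
  \<comment> \<open>For given i only the j at which x^\<alpha>(0) yields its single exponent b
    contributes. Moreover i \<le> K, because the coefficients of \<Phi> vanish below M.\<close>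
  also have "\<dots> = sum ?g ((\<lambda>i. (i, nat (b - (n - int i)))) ` ?S)"
  proof (rule Sum_any.expand_superset)
    show "{x. ?g x \<noteq> 0} \<subseteq> (\<lambda>i. (i, nat (b - (n - int i)))) ` ?S"
    proof
      fix x assume "x \<in> {x. ?g x \<noteq> 0}"
      then obtain i j where x: "x = (i, j)" and nz: "?g (i, j) \<noteq> 0" by (cases x) auto
      have e: "n - int i + int j = b" using nz unfolding g by (meson)
      then have j: "j = nat (b - (n - int i))" "n - int i \<le> b" by auto
      have "?E j ?w \<noteq> 0" using nz e unfolding g by auto
      then have "Phi \<alpha> ?w $$ (n - int i) \<noteq> 0" unfolding P using j by simp
      then have "M \<le> n - int i" using M by force
      then have "i \<le> K" by (auto simp: K_def)
      then show "x \<in> (\<lambda>i. (i, nat (b - (n - int i)))) ` ?S" using x j by auto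
    qed
  qed simp
  also have "\<dots> = (\<Sum>i\<in>?S. ?g (i, nat (b - (n - int i))))"
    by (subst sum.reindex) (auto simp: inj_on_def)
  also have "\<dots> = (\<Sum>i\<in>?S. cscale (\<epsilon> \<alpha> \<beta>) (?D i * Phi \<alpha> ?w $$ (n - int i)))"
    by (intro sum.cong refl) (unfold g P, auto)
  also have "\<dots> = (\<Sum>i\<le>K. cscale (\<epsilon> \<alpha> \<beta>) (?D i * Phi \<alpha> ?w $$ (n - int i)))"
    by (rule sum.mono_neutral_left) (auto simp: P simp del: YM_series_nth)
  also have "\<dots> = cscale (\<epsilon> \<alpha> \<beta>) ((exp_series bl_Lm1 (e_elt \<alpha>) * Phi \<alpha> ?w) $$ n)"
    by (subst bl.exp_series_mult_nth[of M _ n K]) (simp_all add: M K_def cvec.scale_sum_right del: YM_series_nth)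
  finally show ?thesis .
qed

lemma pi_map_YVL_e_elt:
  "fls_map pi_map (VL_series (e_elt \<alpha>) v) = smash_series (pi_map (e_elt \<alpha>)) (pi_map v)"
proof (rule series_linear_eqI[of _ _ v])
  have "series_linear (VL_series (e_elt \<alpha>))"
    by (simp add: series_linear_iff clinear_YVL_right)
  then show "series_linear (\<lambda>v. fls_map pi_map (VL_series (e_elt \<alpha>) v))"
    by (rule series_linear_map[OF clinear_pi_map])
  show "series_linear (\<lambda>v. smash_series (pi_map (e_elt \<alpha>)) (pi_map v))"
    by (rule series_linear_comp[OF series_linear_smash_right clinear_pi_map])
  fix x :: "'l \<times> 'l mon"
  obtain \<beta> m where x: "x = (\<beta>, m)" by (cases x)
  have "pi_map (basis_vec x) = diag_elt \<beta> (bh_comult (basis_vec m))"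
    using pi_map_tensor[of \<beta> "basis_vec m"] by (simp add: x)
  then have tw: "twist2 (\<epsilon> \<alpha>) (pi_map (basis_vec x)) = cscale (\<epsilon> \<alpha> \<beta>) (pi_map (basis_vec x))"
    by (simp only: twist2_diag_elt)
  have "VL_series (e_elt \<alpha>) (basis_vec x) = fls_const (scalar (\<epsilon> \<alpha> \<beta>)) * (exp_series bl_Lm1 (e_elt \<alpha>) * Phi \<alpha> (basis_vec x))"
    by (rule fls_eqI) (simp add: x YVL_e_elt_basis flip: cscale_conv_mult)
  moreover have \<pi>: "fls_map pi_map (exp_series bl_Lm1 (e_elt \<alpha>) * Phi \<alpha> (basis_vec x))
      = exp_series bl2_Lm1 (diag_e \<alpha>) * Phi2 \<alpha> (pi_map (basis_vec x))"
    by (simp only: fls_map_mult[OF additive_pi_map pi_map_mult] exp_series_pi_map Phi2_pi_map pi_map_e_elt)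
  ultimately show "fls_map pi_map (VL_series (e_elt \<alpha>) (basis_vec x)) = smash_series (pi_map (e_elt \<alpha>)) (pi_map (basis_vec x))"
    unfolding pi_map_e_elt smash_series_diag_e tw series_linear_cscale[OF series_linear_Phi2]
    by (simp only: fls_map_scale[OF clinear_pi_map] \<pi> ac_simps)
qed

definition compatible :: "'l bl set" where
  "compatible = {v. \<forall>w. fls_map pi_map (VL_series v w) = smash_series (pi_map v) (pi_map w)}"

lemma e_elt_compatible: "e_elt \<alpha> \<in> compatible"
  by (simp add: compatible_def pi_map_YVL_e_elt)

lemma weakly_assoc_VL:
  "weakly_assoc (fls_map (fls_map pi_map) (fls_map (VL_series u) (VL_series v w)))
     (fls_map (fls_map pi_map) (fls_map (\<lambda>a. VL_series a w) (VL_series u v)))"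
proof (rule weakly_assoc_map[OF clinear_pi_map])
  show "weakly_assoc (fls_map (VL_series u) (VL_series v w)) (fls_map (\<lambda>a. VL_series a w) (VL_series u v))"
    unfolding weakly_assoc_iff
    using V.weak_assoc[OF UNIV_I UNIV_I UNIV_I, of u v w] by (simp add: VL_series_zero VL_series_fun)
qed

lemma fls_map_pi_zero: "fls_map pi_map 0 = 0"
  by (rule additive_0[OF additive_fls_map[OF additive_pi_map]])

lemma fls_map_pi_fun: "fls_nth (fls_map pi_map f) = (\<lambda>n. pi_map (f $$ n))"
  by (rule ext) (simp add: pi_map_zero)

lemma smash_zero: "smash_series s 0 = 0" "smash_series 0 t = 0"
  using additive_0[OF series_linear_additive[OF series_linear_smash_right]]
    additive_0[OF series_linear_additive[OF series_linear_smash_left]] by auto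

text \<open>V_L and the smash product are weakly associative for e_\<alpha>, v, w and their images.
  Since e_\<alpha> and v are compatible, Y(e_\<alpha>,x1)Y(v,x2)w has the right image, and
  \<open>weakly_assoc_unique\<close> gives the same for Y(Y(e_\<alpha>,x0)v,x2)w.\<close>

lemma YVL_e_elt_compatible:
  assumes v: "v \<in> compatible"
  shows "YVL (e_elt \<alpha>) v n \<in> compatible"
proof -
  let ?p = "pi_map (e_elt \<alpha>)"
  note z = VL_series_zero fls_map_pi_zero smash_zero pi_map_zero
  have vw: "fls_map pi_map (VL_series v w) = smash_series (pi_map v) (pi_map w)" for w
    using v by (simp add: compatible_def)
  have "fls_map pi_map (VL_series (YVL (e_elt \<alpha>) v n) w) = smash_series (pi_map (YVL (e_elt \<alpha>) v n)) (pi_map w)" for w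
  proof -
    have F: "fls_map (fls_map pi_map) (fls_map (VL_series (e_elt \<alpha>)) (VL_series v w))
        = fls_map (smash_series ?p) (smash_series (pi_map v) (pi_map w))"
      unfolding vw[symmetric] by (simp add: fls_map_comp z pi_map_YVL_e_elt)
    have "weakly_assoc (fls_map (smash_series ?p) (smash_series (pi_map v) (pi_map w)))
        (fls_map (\<lambda>p. smash_series p (pi_map w)) (smash_series ?p (pi_map v)))"
      unfolding pi_map_e_elt by (rule weakly_assoc_smash)
    then have "fls_map (fls_map pi_map) (fls_map (\<lambda>a. VL_series a w) (VL_series (e_elt \<alpha>) v))
        = fls_map (\<lambda>p. smash_series p (pi_map w)) (smash_series ?p (pi_map v))"
      using weakly_assoc_VL[of "e_elt \<alpha>" v w] unfolding F by (intro weakly_assoc_unique)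
    then have "fls_map (fls_map pi_map) (fls_map (\<lambda>a. VL_series a w) (VL_series (e_elt \<alpha>) v)) $$ n
        = fls_map (\<lambda>p. smash_series p (pi_map w)) (fls_map pi_map (VL_series (e_elt \<alpha>) v)) $$ n"
      by (simp only: pi_map_YVL_e_elt)
    then show ?thesis by (simp add: z)
  qed
  then show ?thesis by (simp add: compatible_def)
qed

lemma subspace_compatible: "cvec.subspace compatible"
proof (rule cvec.subspaceI)
  note add = additive.add[OF series_linear_additive]
  have l: "series_linear (\<lambda>v. fls_map pi_map (VL_series v w))" for w
    by (rule series_linear_map[OF clinear_pi_map]) (simp add: series_linear_iff clinear_YVL_left)
  have r: "series_linear (\<lambda>v. smash_series (pi_map v) (pi_map w))" for w
    by (rule series_linear_comp[OF series_linear_smash_left clinear_pi_map])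
  show "0 \<in> compatible"
    by (simp add: compatible_def VL_series_zero fls_map_pi_zero pi_map_zero smash_zero)
  show "x + y \<in> compatible" if "x \<in> compatible" "y \<in> compatible" for x y
    using that unfolding compatible_def by (simp only: mem_Collect_eq add[OF l] add[OF r] simp_thms)
  show "cscale c x \<in> compatible" if "x \<in> compatible" for c x
    using that unfolding compatible_def
    by (simp only: mem_Collect_eq series_linear_cscale[OF l] series_linear_cscale[OF r] simp_thms)
qed

text \<open>The vectors u whose modes all preserve \<open>compatible\<close> form a vertex
  subalgebra J that contains every e_\<alpha>, so J is all of V_L. Then v, the constant term of
  Y(v,x)e_0, is compatible because e_0 is.\<close>

lemma compatible_UNIV: "v \<in> compatible"
proof -
  define J where "J = {u. \<forall>v\<in>compatible. \<forall>n. YVL u v n \<in> compatible}"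
  note S = subspace_compatible
  have subJ: "cvec.subspace J"
    unfolding J_def
    by (rule cvec.subspaceI)
      (simp_all add: clinear_zero[OF clinear_YVL_left] clinear_add[OF clinear_YVL_left] clinear_cscale[OF clinear_YVL_left]
        cvec.subspace_0[OF S] cvec.subspace_add[OF S] cvec.subspace_scale[OF S])
  have eJ: "e_elt \<alpha> \<in> J" for \<alpha>
    unfolding J_def using YVL_e_elt_compatible by blast
  have prod: "YVL u u' n \<in> J" if u: "u \<in> J" and u': "u' \<in> J" for u u' n
    unfolding J_def
  proof (intro CollectI ballI allI)
    fix v m assume v: "v \<in> compatible"
    let ?F = "\<lambda>a b. YVL u (YVL u' v b) a" and ?G = "\<lambda>a b. YVL (YVL u u' a) v b"
    obtain l where l: "mult_binomial cscale 1 l (subst_add cscale ?F) = mult_binomial cscale 1 l ?G"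
      using V.weak_assoc[OF UNIV_I UNIV_I UNIV_I, of u u' v] by blast
    obtain N where N: "\<forall>n<N. YVL u u' n = 0" using V.Y_truncated[of u u'] by auto
    have F: "?F a b \<in> compatible" for a b using u u' v unfolding J_def by blast
    \<comment> \<open>By weak associativity these are coefficients of (x0+x2)^l Y(u,x0+x2)Y(u',x2)v,
      linear combinations of compatible vectors. The power is then cancelled in the subspace
      \<open>compatible\<close>, with N bounding the exponents of x0.\<close>
    have "mult_binomial cscale 1 l ?G a b \<in> compatible" for a b
      unfolding l[symmetric] by (rule mult_binomial_in_subspace[OF S]) (rule subst_add_in_subspace[OF S F])
    then show "YVL (YVL u u' n) v m \<in> compatible"
      by (intro mult_binomial_closed[OF S, of N ?G l]) (simp_all add: N clinear_zero[OF clinear_YVL_left])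
  qed
  have "vertex_subalgebra cscale UNIV YVL (e_elt 0) J"
    unfolding vertex_subalgebra_def using subJ eJ[of 0] prod by auto
  then have "J = UNIV"
    using generated_VL eJ unfolding vertex_algebra_generated_by_def by blast
  then have "YVL v (e_elt 0) 0 \<in> compatible"
    using e_elt_compatible[of 0] unfolding J_def by blast
  then show ?thesis using V.Y_creation_0[of v] by simp
qed

lemma pi_map_YVL: "pi_map (YVL u v n) = lattice_smash_Y \<epsilon> YM (pi_map u) (pi_map v) n"
proof -
  have "fls_map pi_map (VL_series u v) = smash_series (pi_map u) (pi_map v)"
    using compatible_UNIV[of u] by (simp add: compatible_def)
  then have "fls_map pi_map (VL_series u v) $$ n = smash_series (pi_map u) (pi_map v) $$ n" by simp
  then show ?thesis by (simp add: pi_map_zero smash_series_nth)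
qed

text \<open>Every element of U is some \<open>pi_map u\<close>, and \<open>pi_map_YVL\<close> turns
  each axiom on U into the image of the same axiom of V_L, locality included.\<close>

lemma vertex_algebra_U: "vertex_algebra cscale U_space (lattice_smash_Y \<epsilon> YM) (e_elt 0 \<otimes> e_elt 0)"
proof -
  have U: "\<exists>u'. u = pi_map u'" if "u \<in> U_space" for u :: "'l bl2"
    using that unfolding U_space_eq by blast
  have piU: "pi_map u \<in> U_space" for u :: "'l bl" unfolding U_space_eq by blast
  have vac: "e_elt 0 \<otimes> e_elt 0 = pi_map (e_elt 0 :: 'l bl)" by (rule pi_map_e_elt[symmetric])
  let ?Y = "lattice_smash_Y \<epsilon> YM"
  note pi = pi_map_add pi_map_cscale pi_map_zero
  have Y: "?Y (pi_map u) (pi_map v) n = pi_map (YVL u v n)" for u v n by (rule pi_map_YVL[symmetric])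
  show ?thesis
    unfolding vac
  \<comment> \<open>The cases follow the order of the locale assumptions: 1 to 3 closure, 4
    truncation, 5 to 8 bilinearity, 9 to 11 vacuum and creation, 12 weak associativity, 13
    locality.\<close>
  proof (unfold_locales, goal_cases)
    case 1
    show ?case unfolding U_space_def by (rule cvec.subspace_span)
  next
    case 2
    show ?case by (rule piU)
  next
    case (3 u v n)
    then show ?case using U[of u] U[of v] by (metis Y piU)
  next
    case (4 u v)
    then obtain u' v' where u: "u = pi_map u'" and v: "v = pi_map v'" using U by blast
    obtain N where "\<forall>n<N. YVL u' v' n = 0" using V.Y_truncated[of u' v'] by auto
    then show ?case unfolding u v Y by (intro exI[of _ N]) (simp add: pi)
  next
    case (5 u u' v n)
    then obtain a b c where "u = pi_map a" "u' = pi_map b" "v = pi_map c" using U by metis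
    then show ?case by (simp only: pi(1)[symmetric] Y V.Y_add_left[OF UNIV_I UNIV_I UNIV_I])
  next
    case (6 u v c n)
    then obtain a b where "u = pi_map a" "v = pi_map b" using U by metis
    then show ?case by (simp only: pi(2)[symmetric] Y V.Y_scale_left[OF UNIV_I UNIV_I])
  next
    case (7 u v v' n)
    then obtain a b c where "u = pi_map a" "v = pi_map b" "v' = pi_map c" using U by metis
    then show ?case by (simp only: pi(1)[symmetric] Y V.Y_add_right[OF UNIV_I UNIV_I UNIV_I])
  next
    case (8 u v c n)
    then obtain a b where "u = pi_map a" "v = pi_map b" using U by metis
    then show ?case by (simp only: pi(2)[symmetric] Y V.Y_scale_right[OF UNIV_I UNIV_I])
  next
    case (9 v n)
    then obtain a where v: "v = pi_map a" using U by metis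
    show ?case unfolding v Y V.Y_vac[OF UNIV_I] by (simp add: pi)
  next
    case (10 v n)
    then obtain a where v: "v = pi_map a" using U by metis
    show ?case unfolding v Y V.Y_creation[OF UNIV_I 10(2)] by (rule pi)
  next
    case (11 v)
    then obtain a where v: "v = pi_map a" using U by metis
    show ?case unfolding v Y V.Y_creation_0[OF UNIV_I] ..
  next
    case (12 u v w)
    then obtain a b c where uvw: "u = pi_map a" "v = pi_map b" "w = pi_map c" using U by metis
    show ?case
      using weakly_assoc_VL[of a b c] unfolding weakly_assoc_iff uvw Y
      by (simp add: VL_series_zero fls_map_pi_zero pi fls_map_pi_fun)
  next
    case (13 u v)
    then obtain a b where uv: "u = pi_map a" "v = pi_map b" using U by metis
    obtain k where k: "\<forall>w\<in>UNIV. \<forall>i j. mult_binomial cscale (-1) k (\<lambda>i j. YVL a (YVL b w j) i - YVL b (YVL a w i) j) i j = 0"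
      using V.locality[OF UNIV_I UNIV_I, of a b] by blast
    have "mult_binomial cscale (-1) k (\<lambda>i j. ?Y u (?Y v w j) i - ?Y v (?Y u w i) j) i j = 0" if "w \<in> U_space" for w i j
    proof -
      obtain c where w: "w = pi_map c" using U \<open>w \<in> U_space\<close> by metis
      have "(\<lambda>i j. ?Y u (?Y v w j) i - ?Y v (?Y u w i) j) = (\<lambda>i j. pi_map (YVL a (YVL b c j) i - YVL b (YVL a c i) j))"
        unfolding uv w Y by (simp add: additive.diff[OF additive_pi_map])
      then show ?thesis using k by (simp add: mult_binomial_map[OF clinear_pi_map] pi)
    qed
    then show ?case by blast
  qed
qed

lemma isomorphism:
  "vertex_subalgebra cscale UNIV (lattice_smash_Y \<epsilon> YM) (e_elt 0 \<otimes> e_elt 0) U_space \<and>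
    vertex_algebra cscale U_space (lattice_smash_Y \<epsilon> YM) (e_elt 0 \<otimes> e_elt 0) \<and>
    vertex_algebra_iso cscale UNIV YVL (e_elt 0)
      cscale U_space (lattice_smash_Y \<epsilon> YM) (e_elt 0 \<otimes> e_elt 0) pi_map"
proof -
  interpret U: vertex_algebra cscale U_space "lattice_smash_Y \<epsilon> YM" "e_elt 0 \<otimes> e_elt 0"
    by (rule vertex_algebra_U)
  have "vertex_subalgebra cscale UNIV (lattice_smash_Y \<epsilon> YM) (e_elt 0 \<otimes> e_elt 0) U_space"
    unfolding vertex_subalgebra_def using U.subspace_V U.vac_in U.Y_in by auto
  moreover have "bij_betw pi_map UNIV (U_space :: 'l bl2 set)"
    unfolding U_space_eq by (rule inj_on_imp_bij_betw[OF inj_pi_map])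
  ultimately show ?thesis
    unfolding vertex_algebra_iso_def
    using vertex_algebra_U vertex_algebra_VL pi_map_YVL pi_map_e_elt[of 0]
      pi_map_add pi_map_cscale by auto
qed

end

theorem proposition5p7:
  fixes B :: "'l::fg_free_ab_group \<Rightarrow> 'l \<Rightarrow> int"
    and \<epsilon> :: "'l \<Rightarrow> 'l \<Rightarrow> complex"
    and YM YVL :: "'l bl \<Rightarrow> 'l bl \<Rightarrow> int \<Rightarrow> 'l bl"
  assumes "nondegenerate_even_form B"
    and "normalized_2_cocycle \<epsilon>"
    and "\<And>\<alpha> \<beta>. \<epsilon> \<alpha> \<beta> * inverse (\<epsilon> \<beta> \<alpha>) = (-1) powi (B \<alpha> \<beta>)"
    and "is_bl_module_map B YM"
    and "is_lattice_vertex_algebra B \<epsilon> YVL"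
  shows "vertex_subalgebra cscale UNIV (lattice_smash_Y \<epsilon> YM) (e_elt 0 \<otimes> e_elt 0) U_space \<and>
    vertex_algebra cscale U_space (lattice_smash_Y \<epsilon> YM) (e_elt 0 \<otimes> e_elt 0) \<and>
    vertex_algebra_iso cscale UNIV YVL (e_elt 0)
      cscale U_space (lattice_smash_Y \<epsilon> YM) (e_elt 0 \<otimes> e_elt 0) pi_map"
proof -
  interpret lattice_comparison B YM \<epsilon> YVL
    using assms by unfold_locales
  show ?thesis by (rule isomorphism)
qed

end
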